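(* Let $\phi_i,\psi_i$ ($i=1,\dots,6$), $\phi_{j,k},\psi_{j,k}$ ($j,k\in\mathbb Z$) be constructed as in the context and let $\Psi=\{\phi_{0,k}:k\in\mathbb Z\}\cup\{\psi_{j,k}:j\ge0,k\in\mathbb Z\}$. Then: a) The generators $\psi_i$, $i=1,\dots,6$, and wavelets $\psi_{j,k}$, $j,k\in\mathbb Z$, are cubic splines belonging to $C^1(\mathbb R)$. b) For $i,j=1,\dots,6$: $\langle\phi_i,\phi_j\rangle=\delta_{i,j}$, $\langle\psi_i,\psi_j\rangle=\delta_{i,j}$, $\langle\phi_i,\psi_j\rangle=0$. c) For $i,j,k,l\in\mathbb Z$: $\langle\phi_{i,k},\phi_{i,l}\rangle=\delta_{k,l}$, $\langle\psi_{i,k},\psi_{j,l}\rangle=\delta_{i,j}\delta_{k,l}$, and if $i\le j$ then $\langle\phi_{i,k},\psi_{j,l}\rangle=0$. d) The wavelets $\psi_{j,k}$, $j,k\in\mathbb Z$, have four vanishing moments, i.e. $\int_{\mathbb R}p(x)\psi_{j,k}(x)\,dx=0$ for every polynomial $p$ of degree less than $4$. e) $\Psi$ is an orthogonal basis of $L^2(\mathbb R)$. f) $\operatorname{diam}\operatorname{supp}\phi_{0,k}\le2$ and $\operatorname{diam}\operatorname{supp}\psi_{j,k}\le2^{1-j}$.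
   Context: $\langle\cdot,\cdot\rangle$, $\|\cdot\|$ are the inner product and norm of real $L^2(\mathbb R)$; $\mathcal X\ominus\mathcal Y$ is the $L^2$-orthogonal complement of $\mathcal Y$ in $\mathcal X$; $\chi_{[0,1]}$ is an indicator function. Hermite cubics. $\xi_1(x)=(x+1)^2(1-2x)$ on $[-1,0]$, $(1-x)^2(1+2x)$ on $[0,1]$, $0$ otherwise; $\xi_2(x)=(x+1)^2x$ on $[-1,0]$, $(1-x)^2x$ on $[0,1]$, $0$ otherwise. $\xi_{j,2k+l-1}(x)=2^{j/2}\xi_l(2^jx-k)$ for $l=1,2$. Scaling generators. $\phi_1=\xi_{1,2}/\|\xi_{1,2}\|$, $\phi_2=\xi_{1,3}/\|\xi_{1,3}\|$. $\mathcal A_0=\operatorname{span}\{\xi_{1,2},\xi_{1,3}\}$, $\mathcal A_1=\operatorname{span}\{\xi_{2,k}:k=2,\dots,7\}$. $\mathcal B_0=\operatorname{span}(\{\xi_{1,0}\chi_{[0,1]},\xi_{1,1}\chi_{[0,1]}\}\cup\mathcal A_0)$, $\mathcal B_1=\operatorname{span}(\{\xi_{1,4}\chi_{[0,1]},\xi_{1,5}\chi_{[0,1]}\}\cup\mathcal A_0)$, $\mathcal C_h=\mathcal B_h\ominus\mathcal A_0$, $h=0,1$. $\phi_3,\phi_4$ form an orthonormal basis of a two-dimensional subspace $W\subset\mathcal A_1\ominus\mathcal A_0$ with $(I-P_W)\mathcal C_0\perp(I-P_W)\mathcal C_1$, $P_W$ being the orthogonal projection onto $W$. Further $$g_5=\xi_{1,0}-\sum_{j=1}^4\langle\xi_{1,0},\phi_j\rangle\phi_j-\sum_{j=1}^4\langle\xi_{1,0},\phi_j(\cdot+1)\rangle\phi_j(\cdot+1),\quad\phi_5=g_5/\|g_5\|,$$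 $$g_6=\xi_{1,1}-\sum_{j=1}^5\langle\xi_{1,1},\phi_j\rangle\phi_j-\sum_{j=1}^5\langle\xi_{1,1},\phi_j(\cdot+1)\rangle\phi_j(\cdot+1),\quad\phi_6=g_6/\|g_6\|.$$ Scaling functions. For $j,k\in\mathbb Z$: $\phi_{j,6k+l}(x)=2^{j/2}\phi_l(2^jx-k)$ for $l=1,2,3,4$, and $\phi_{j,6k+l}(x)=2^{j/2}\phi_l(2^jx-k-1)$ for $l=5,6$; $V_j=\overline{\operatorname{span}}\{\phi_{j,k}:k\in\mathbb Z\}$. Wavelet generators. (1) $\psi_1,\psi_2$ form an orthonormal basis of the space of all $f\in\operatorname{span}\{\phi_k(2\cdot),k=1,\dots,4;\ \phi_k(2\cdot-1),k=1,\dots,6\}$ orthogonal to $\phi_1,\dots,\phi_6,\phi_5(\cdot-1),\phi_6(\cdot-1)$; the construction takes this space to be two-dimensional. (2) With $h_i=\phi_{i+4}(2\cdot)-\langle\phi_{i+4}(2\cdot),\phi_5\rangle\phi_5-\langle\phi_{i+4}(2\cdot),\phi_6\rangle\phi_6$, $i=1,2$, put $\psi_3=h_1/\|h_1\|$ and $\psi_4=(h_2-\langle h_2,\psi_3\rangle\psi_3)/\|h_2-\langle h_2,\psi_3\rangle\psi_3\|$. (3) $\psi_5,\psi_6$ form an orthonormal basis of the space of all $f\in\operatorname{span}\{\phi_{1,k}:k=-11,\dots,10\}$ orthogonal to $\phi_{0,k}$ ($k=-7,\dots,6$), to $\psi_1(\cdot+1),\psi_2(\cdot+1)$ and to $\psi_1,\psi_2,\psi_3,\psi_4$;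 this space is two-dimensional. Wavelets. For $j,k\in\mathbb Z$: $\psi_{j,6k+l}(x)=2^{j/2}\psi_l(2^jx-k)$ for $l=1,2$, and $\psi_{j,6k+l}(x)=2^{j/2}\psi_l(2^jx-k-1)$ for $l=3,4,5,6$. *)

theory Defs
  imports "HOL-Analysis.Analysis" "HOL-Library.Function_Algebras"
begin

text \<open>
  Functions \<open>real \<Rightarrow> real\<close> form a real vector space under the pointwise operations, so that
  the library notion \<^const>\<open>span\<close> applies to them.
\<close>

instantiation "fun" :: (type, real_vector) real_vector
begin

definition scaleR_fun_def: "c *\<^sub>R f = (\<lambda>x. c *\<^sub>R f x)"

instance
  by standard (auto simp: scaleR_fun_def fun_eq_iff algebra_simps)

end

lemma scaleR_fun_apply [simp]: "(c *\<^sub>R f) x = c *\<^sub>R f x"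
  by (simp add: scaleR_fun_def)

text \<open>
  Elements of $L^2$ are represented by functions rather than by classes of functions modulo
  equality almost everywhere.
\<close>

definition L2 :: "(real \<Rightarrow> real) set" where
  "L2 = {f \<in> borel_measurable lebesgue. integrable lebesgue (\<lambda>x. (f x)\<^sup>2)}"

definition L2_inner :: "(real \<Rightarrow> real) \<Rightarrow> (real \<Rightarrow> real) \<Rightarrow> real" where
  "L2_inner f g = (LINT x|lebesgue. f x * g x)"

definition L2_norm :: "(real \<Rightarrow> real) \<Rightarrow> real" where
  "L2_norm f = sqrt (L2_inner f f)"

definition L2_normalize :: "(real \<Rightarrow> real) \<Rightarrow> real \<Rightarrow> real" where
  "L2_normalize f = f /\<^sub>R L2_norm f"

definition ortho_in :: "(real \<Rightarrow> real) set \<Rightarrow> (real \<Rightarrow> real) set \<Rightarrow> (real \<Rightarrow> real) set"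
    (infixl "\<ominus>" 65) where
  "X \<ominus> Y = {f \<in> X. \<forall>g\<in>Y. L2_inner f g = 0}"

definition orthonormal_basis_of :: "nat set \<Rightarrow> (nat \<Rightarrow> real \<Rightarrow> real) \<Rightarrow> (real \<Rightarrow> real) set \<Rightarrow> bool" where
  "orthonormal_basis_of I e X \<longleftrightarrow>
     (\<forall>i\<in>I. \<forall>j\<in>I. L2_inner (e i) (e j) = of_bool (i = j)) \<and> span (e ` I) = X"

text \<open>
  The description below is only used for finite-dimensional \<open>W\<close> consisting of continuous
  functions, for which the projection is unique as a function and not just almost everywhere.
\<close>

definition ortho_proj :: "(real \<Rightarrow> real) set \<Rightarrow> (real \<Rightarrow> real) \<Rightarrow> real \<Rightarrow> real" where
  "ortho_proj W f = (THE g. g \<in> W \<and> (\<forall>w\<in>W. L2_inner (f - g) w = 0))"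

definition orthogonal_basis_L2 :: "(real \<Rightarrow> real) set \<Rightarrow> bool" where
  "orthogonal_basis_L2 B \<longleftrightarrow>
     B \<subseteq> L2 \<and> (\<forall>f\<in>B. L2_norm f \<noteq> 0) \<and> pairwise (\<lambda>f g. L2_inner f g = 0) B \<and>
     (\<forall>f\<in>L2. \<forall>\<epsilon>>0. \<exists>g\<in>span B. L2_norm (f - g) < \<epsilon>)"

definition supp :: "(real \<Rightarrow> real) \<Rightarrow> real set" where
  "supp f = closure {x. f x \<noteq> 0}"

text \<open>
  Finitely many knots, and on every interval free of knots (bounded or not) the function is a
  polynomial of degree at most three. Smoothness across the knots is not part of the definition.
\<close>

definition cubic_spline :: "(real \<Rightarrow> real) \<Rightarrow> bool" where
  "cubic_spline f \<longleftrightarrow>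
     (\<exists>T. finite T \<and> (\<forall>I. is_interval I \<and> I \<inter> T = {} \<longrightarrow>
        (\<exists>p :: real poly. degree p \<le> 3 \<and> (\<forall>x\<in>I. f x = poly p x))))"

definition hermite :: "nat \<Rightarrow> real \<Rightarrow> real" where
  "hermite l x =
     (if l = 1 then
        (if x \<in> {-1..0} then (x + 1)\<^sup>2 * (1 - 2 * x)
         else if x \<in> {0..1} then (1 - x)\<^sup>2 * (1 + 2 * x) else 0)
      else
        (if x \<in> {-1..0} then (x + 1)\<^sup>2 * x
         else if x \<in> {0..1} then (1 - x)\<^sup>2 * x else 0))"

text \<open>The index \<open>m\<close> is split as \<open>m = 2 * k + l - 1\<close> with \<open>l \<in> {1, 2}\<close>.\<close>

definition \<xi> :: "int \<Rightarrow> int \<Rightarrow> real \<Rightarrow> real" where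
  "\<xi> j m = (\<lambda>x. 2 powr (real_of_int j / 2) *
      hermite (nat (m mod 2) + 1) (2 powi j * x - real_of_int (m div 2)))"

lemma \<xi>_index:
  assumes "l \<in> {1, 2}"
  shows "\<xi> j (2 * k + int l - 1) =
    (\<lambda>x. 2 powr (real_of_int j / 2) * hermite l (2 powi j * x - real_of_int k))"
  using assms by (auto simp: \<xi>_def numeral_2_eq_2)

text \<open>
  The index \<open>m\<close> is split as \<open>m = 6 * k + l\<close> with \<open>l \<in> {1..6}\<close>; the generators \<open>g l\<close> with
  \<open>l > r\<close> carry an additional unit shift.
\<close>

definition dilates :: "nat \<Rightarrow> (nat \<Rightarrow> real \<Rightarrow> real) \<Rightarrow> int \<Rightarrow> int \<Rightarrow> real \<Rightarrow> real" where
  "dilates r g j m =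
     (let k = (m - 1) div 6; l = nat ((m - 1) mod 6) + 1
      in (\<lambda>x. 2 powr (real_of_int j / 2) *
            g l (2 powi j * x - real_of_int (if l \<le> r then k else k + 1))))"

definition scaling_fn :: "(nat \<Rightarrow> real \<Rightarrow> real) \<Rightarrow> int \<Rightarrow> int \<Rightarrow> real \<Rightarrow> real" where
  "scaling_fn \<phi> = dilates 4 \<phi>"

definition wavelet_fn :: "(nat \<Rightarrow> real \<Rightarrow> real) \<Rightarrow> int \<Rightarrow> int \<Rightarrow> real \<Rightarrow> real" where
  "wavelet_fn \<psi> = dilates 2 \<psi>"

lemma dilates_index:
  assumes "l \<in> {1..6}"
  shows "dilates r g j (6 * k + int l) =
    (\<lambda>x. 2 powr (real_of_int j / 2) *
       g l (2 powi j * x - real_of_int (if l \<le> r then k else k + 1)))"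
proof -
  have "(6 * k + int l - 1) div 6 = k" "(6 * k + int l - 1) mod 6 = int l - 1"
    using assms by (auto; presburger)+
  moreover have "nat (int l - 1) + 1 = l"
    using assms by auto
  ultimately show ?thesis
    by (simp add: dilates_def Let_def)
qed

definition shift :: "real \<Rightarrow> (real \<Rightarrow> real) \<Rightarrow> real \<Rightarrow> real" where
  "shift a f = (\<lambda>x. f (x + a))"

definition dil2 :: "(real \<Rightarrow> real) \<Rightarrow> real \<Rightarrow> real" where
  "dil2 f = (\<lambda>x. f (2 * x))"

definition \<A>\<^sub>0 :: "(real \<Rightarrow> real) set" where
  "\<A>\<^sub>0 = span {\<xi> 1 2, \<xi> 1 3}"

definition \<A>\<^sub>1 :: "(real \<Rightarrow> real) set" where
  "\<A>\<^sub>1 = span (\<xi> 2 ` {2..7})"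

definition restrict01 :: "(real \<Rightarrow> real) \<Rightarrow> real \<Rightarrow> real" where
  "restrict01 f = (\<lambda>x. f x * indicator {0..1} x)"

definition \<B>\<^sub>0 :: "(real \<Rightarrow> real) set" where
  "\<B>\<^sub>0 = span ({restrict01 (\<xi> 1 0), restrict01 (\<xi> 1 1)} \<union> \<A>\<^sub>0)"

definition \<B>\<^sub>1 :: "(real \<Rightarrow> real) set" where
  "\<B>\<^sub>1 = span ({restrict01 (\<xi> 1 4), restrict01 (\<xi> 1 5)} \<union> \<A>\<^sub>0)"

definition \<C>\<^sub>0 :: "(real \<Rightarrow> real) set" where "\<C>\<^sub>0 = \<B>\<^sub>0 \<ominus> \<A>\<^sub>0"

definition \<C>\<^sub>1 :: "(real \<Rightarrow> real) set" where "\<C>\<^sub>1 = \<B>\<^sub>1 \<ominus> \<A>\<^sub>0"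

definition remove_components ::
    "nat \<Rightarrow> (nat \<Rightarrow> real \<Rightarrow> real) \<Rightarrow> (real \<Rightarrow> real) \<Rightarrow> real \<Rightarrow> real" where
  "remove_components n \<phi> f =
     f - (\<Sum>j=1..n. L2_inner f (\<phi> j) *\<^sub>R \<phi> j)
       - (\<Sum>j=1..n. L2_inner f (shift 1 (\<phi> j)) *\<^sub>R shift 1 (\<phi> j))"

definition scaling_generators :: "(nat \<Rightarrow> real \<Rightarrow> real) \<Rightarrow> bool" where
  "scaling_generators \<phi> \<longleftrightarrow>
     \<phi> 1 = L2_normalize (\<xi> 1 2) \<and>
     \<phi> 2 = L2_normalize (\<xi> 1 3) \<and>
     (\<exists>W. W \<subseteq> \<A>\<^sub>1 \<ominus> \<A>\<^sub>0 \<and> orthonormal_basis_of {3, 4} \<phi> W \<and>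
        (\<forall>u\<in>\<C>\<^sub>0. \<forall>v\<in>\<C>\<^sub>1. L2_inner (u - ortho_proj W u) (v - ortho_proj W v) = 0)) \<and>
     \<phi> 5 = L2_normalize (remove_components 4 \<phi> (\<xi> 1 0)) \<and>
     \<phi> 6 = L2_normalize (remove_components 5 \<phi> (\<xi> 1 1))"

definition inner_wavelet_space :: "(nat \<Rightarrow> real \<Rightarrow> real) \<Rightarrow> (real \<Rightarrow> real) set" where
  "inner_wavelet_space \<phi> =
     span ((\<lambda>k. dil2 (\<phi> k)) ` {1..4} \<union> (\<lambda>k x. \<phi> k (2 * x - 1)) ` {1..6})
       \<ominus> (\<phi> ` {1..6} \<union> {shift (-1) (\<phi> 5), shift (-1) (\<phi> 6)})"

definition boundary_part :: "(nat \<Rightarrow> real \<Rightarrow> real) \<Rightarrow> nat \<Rightarrow> real \<Rightarrow> real" where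
  "boundary_part \<phi> i =
     dil2 (\<phi> (i + 4)) - L2_inner (dil2 (\<phi> (i + 4))) (\<phi> 5) *\<^sub>R \<phi> 5
                      - L2_inner (dil2 (\<phi> (i + 4))) (\<phi> 6) *\<^sub>R \<phi> 6"

definition outer_wavelet_space ::
    "(nat \<Rightarrow> real \<Rightarrow> real) \<Rightarrow> (nat \<Rightarrow> real \<Rightarrow> real) \<Rightarrow> (real \<Rightarrow> real) set" where
  "outer_wavelet_space \<phi> \<psi> =
     span (scaling_fn \<phi> 1 ` {-11..10})
       \<ominus> (scaling_fn \<phi> 0 ` {-7..6} \<union> {shift 1 (\<psi> 1), shift 1 (\<psi> 2)} \<union> \<psi> ` {1..4})"

definition wavelet_generators ::
    "(nat \<Rightarrow> real \<Rightarrow> real) \<Rightarrow> (nat \<Rightarrow> real \<Rightarrow> real) \<Rightarrow> bool" where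
  "wavelet_generators \<phi> \<psi> \<longleftrightarrow>
     orthonormal_basis_of {1, 2} \<psi> (inner_wavelet_space \<phi>) \<and>
     \<psi> 3 = L2_normalize (boundary_part \<phi> 1) \<and>
     \<psi> 4 = L2_normalize (boundary_part \<phi> 2 - L2_inner (boundary_part \<phi> 2) (\<psi> 3) *\<^sub>R \<psi> 3) \<and>
     orthonormal_basis_of {5, 6} \<psi> (outer_wavelet_space \<phi> \<psi>)"

definition wavelet_system ::
    "(nat \<Rightarrow> real \<Rightarrow> real) \<Rightarrow> (nat \<Rightarrow> real \<Rightarrow> real) \<Rightarrow> (real \<Rightarrow> real) set" where
  "wavelet_system \<phi> \<psi> =
     {scaling_fn \<phi> 0 k | k. True} \<union> {wavelet_fn \<psi> j k | j k. j \<ge> 0}"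

end

theory Submission
  imports Defs
begin

text \<open>
  Everything is reduced to finite orthonormal systems on the scale \<open>1\<close>. Number the scaling
  functions of that scale so that \<open>\<phi>\<^bsub>1,1\<^esub>, \<dots>, \<phi>\<^bsub>1,10\<^esub>\<close> are those supported in \<open>[0,1]\<close> and
  \<open>\<phi>\<^bsub>1,-11\<^esub>, \<dots>, \<phi>\<^bsub>1,10\<^esub>\<close> those supported in \<open>[-1,1]\<close>; most orthogonality relations then
  hold because the functions lie in the spans of disjoint parts of the system. The condition on \<open>W\<close>
  says that the residuals of \<open>\<xi>\<^bsub>1,0\<^esub>\<close>, \<open>\<xi>\<^bsub>1,1\<^esub>\<close> after removing \<open>\<phi>\<^sub>1, \<dots>, \<phi>\<^sub>4\<close> and their
  translates are orthogonal to their own integer translates.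

  Three points are less direct. First, \<open>\<psi>\<^sub>3\<close> and \<open>\<psi>\<^sub>4\<close> do not degenerate: otherwise a nonzero
  combination of \<open>\<phi>\<^sub>5, \<phi>\<^sub>6\<close> would be orthogonal to the ten-dimensional space of functions
  supported in \<open>[0,1]\<close>, which would then be spanned by nine functions because the inner wavelet
  space is spanned by two. Second, \<open>\<psi>\<^sub>5, \<psi>\<^sub>6\<close> are orthogonal to their neighbours, since on
  \<open>[0,1]\<close> an outer wavelet projects into the span of the projections of \<open>\<phi>\<^sub>5, \<phi>\<^sub>6\<close>, the
  neighbour into the span of those of \<open>\<phi>\<^sub>5(\<cdot> - 1), \<phi>\<^sub>6(\<cdot> - 1)\<close>, and these are orthogonal. Third,
  the same decomposition expresses each \<open>\<phi>\<^bsub>1,k\<^esub>\<close> as a finite combination of the \<open>\<phi>\<^bsub>0,m\<^esub>\<close> and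
  \<open>\<psi>\<^bsub>0,m\<^esub>\<close>. Hence the linear span of the system contains all Hermite cubics on dyadic grids,
  and quasi-interpolation makes these dense in $L^2$. The moments vanish because cubic
  polynomials are locally combinations of Hermite cubics.
\<close>

section \<open>Square-integrable functions\<close>

text \<open>Elements of \<open>L2\<close> are functions, so a vanishing norm gives equality only for
  continuous ones. All generators lie in \<open>CC\<close>, and every step from norm zero to zero
  (uniqueness of projections, nondegeneracy of a Gram-Schmidt step, exactness of Fourier sums) is
  made there. More general functions are needed only for density and for the restricted Hermite
  cubics, one of which jumps. No coefficient of \<phi>_3, ..., \<phi>_6 or of any wavelet is ever
  computed: W and the wavelet spaces are known only through orthogonality and spanning conditions,
  so the argument must run on dimensions and index windows. The decisive count:
  \<open>V {1..10}\<close> has dimension ten and the inner wavelets are cut out of it by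
  orthogonality to the eight functions \<open>E 0 k\<close>, \<open>k\<close> from -1 to 6. That the
  result is two-dimensional says exactly that these eight conditions are independent on
  \<open>V {1..10}\<close>; this is the only source of nondegeneracy for the boundary
  wavelets.\<close>

lemma sum_fun_apply: "(\<Sum>i\<in>I. f i) x = (\<Sum>i\<in>I. f i x)" for f :: "'i \<Rightarrow> 'a \<Rightarrow> 'b::comm_monoid_add"
  by (induction I rule: infinite_finite_induct) auto

lemma subspaceD:
  assumes "subspace S"
  shows subspaceD_0: "0 \<in> S"
    and subspaceD_add: "f \<in> S \<Longrightarrow> g \<in> S \<Longrightarrow> f + g \<in> S"
    and subspaceD_scale: "f \<in> S \<Longrightarrow> c *\<^sub>R f \<in> S"
    and subspaceD_diff: "f \<in> S \<Longrightarrow> g \<in> S \<Longrightarrow> f - g \<in> S"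
    and subspaceD_sum: "(\<And>i. i \<in> I \<Longrightarrow> F i \<in> S) \<Longrightarrow> sum F I \<in> S"
  using assms by (auto intro: subspace_0 subspace_add subspace_scale subspace_diff subspace_sum)

lemma L2_mult_integrable:
  assumes "f \<in> L2" "g \<in> L2"
  shows "integrable lebesgue (\<lambda>x. f x * g x)"
proof (rule Bochner_Integration.integrable_bound)
  show "integrable lebesgue (\<lambda>x. (f x)\<^sup>2 + (g x)\<^sup>2)"
    using assms by (auto simp: L2_def)
  show "(\<lambda>x. f x * g x) \<in> borel_measurable lebesgue"
    using assms by (auto simp: L2_def)
  show "AE x in lebesgue. norm (f x * g x) \<le> norm ((f x)\<^sup>2 + (g x)\<^sup>2)"
  proof (rule AE_I2)
    fix x
    have "2 * (\<bar>f x\<bar> * \<bar>g x\<bar>) \<le> (f x)\<^sup>2 + (g x)\<^sup>2"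
      using sum_squares_bound[of "\<bar>f x\<bar>" "\<bar>g x\<bar>"] by simp
    moreover have "0 \<le> \<bar>f x\<bar> * \<bar>g x\<bar>" by simp
    ultimately have "\<bar>f x\<bar> * \<bar>g x\<bar> \<le> (f x)\<^sup>2 + (g x)\<^sup>2" by linarith
    then show "norm (f x * g x) \<le> norm ((f x)\<^sup>2 + (g x)\<^sup>2)"
      by (simp add: abs_mult)
  qed
qed

lemma L2_measurable [measurable_dest]: "f \<in> L2 \<Longrightarrow> f \<in> borel_measurable lebesgue"
  by (simp add: L2_def)

lemma subspace_L2: "subspace L2"
proof (rule subspaceI)
  show "0 \<in> L2" by (simp add: L2_def zero_fun_def)
next
  fix f g assume fg: "f \<in> L2" "g \<in> L2"
  have "integrable lebesgue (\<lambda>x. f x * f x + 2 * (f x * g x) + g x * g x)"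
    using L2_mult_integrable fg by simp
  then have "integrable lebesgue (\<lambda>x. (f x + g x)\<^sup>2)"
    by (rule Bochner_Integration.integrable_cong[THEN iffD1, rotated 2])
       (auto simp: power2_eq_square algebra_simps)
  then show "f + g \<in> L2" using fg by (auto simp: L2_def plus_fun_def)
next
  fix c f assume "f \<in> L2"
  then show "c *\<^sub>R f \<in> L2"
    by (auto simp: L2_def scaleR_fun_def power_mult_distrib)
qed

lemmas L2_0 [simp] = subspace_L2[THEN subspaceD_0]
lemmas L2_add [simp] = subspace_L2[THEN subspaceD_add]
lemmas L2_scale [simp] = subspace_L2[THEN subspaceD_scale]
lemmas L2_diff [simp] = subspace_L2[THEN subspaceD_diff]
lemmas L2_sum = subspace_L2[THEN subspaceD_sum]

lemma L2_inner_commute: "L2_inner f g = L2_inner g f"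
  by (simp add: L2_inner_def mult.commute)

lemma L2_inner_0 [simp]: "L2_inner 0 g = 0" "L2_inner f 0 = 0"
  by (simp_all add: L2_inner_def)

lemma L2_inner_scale [simp]:
  "L2_inner (c *\<^sub>R f) g = c * L2_inner f g" "L2_inner f (c *\<^sub>R g) = c * L2_inner f g"
  by (simp_all add: L2_inner_def mult.assoc mult.left_commute)

lemma L2_inner_add_left:
  assumes "f \<in> L2" "g \<in> L2" "h \<in> L2"
  shows "L2_inner (f + g) h = L2_inner f h + L2_inner g h"
  using Bochner_Integration.integral_add[OF L2_mult_integrable[OF assms(1,3)] L2_mult_integrable[OF assms(2,3)]]
  by (simp add: L2_inner_def distrib_right)

lemma L2_inner_diff_left:
  assumes "f \<in> L2" "g \<in> L2" "h \<in> L2"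
  shows "L2_inner (f - g) h = L2_inner f h - L2_inner g h"
  using Bochner_Integration.integral_diff[OF L2_mult_integrable[OF assms(1,3)] L2_mult_integrable[OF assms(2,3)]]
  by (simp add: L2_inner_def left_diff_distrib)

lemma L2_inner_add_right:
  "f \<in> L2 \<Longrightarrow> g \<in> L2 \<Longrightarrow> h \<in> L2 \<Longrightarrow> L2_inner h (f + g) = L2_inner h f + L2_inner h g"
  using L2_inner_add_left L2_inner_commute by metis

lemma L2_inner_diff_right:
  "f \<in> L2 \<Longrightarrow> g \<in> L2 \<Longrightarrow> h \<in> L2 \<Longrightarrow> L2_inner h (f - g) = L2_inner h f - L2_inner h g"
  using L2_inner_diff_left L2_inner_commute by metis

lemma L2_inner_sum_left:
  assumes "\<And>i. i \<in> I \<Longrightarrow> F i \<in> L2" "g \<in> L2"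
  shows "L2_inner (\<Sum>i\<in>I. F i) g = (\<Sum>i\<in>I. L2_inner (F i) g)"
  using assms(1)
  by (induction I rule: infinite_finite_induct) (auto simp: L2_inner_add_left assms(2) L2_sum)

lemma L2_inner_sum_right:
  assumes "\<And>i. i \<in> I \<Longrightarrow> F i \<in> L2" "g \<in> L2"
  shows "L2_inner g (\<Sum>i\<in>I. F i) = (\<Sum>i\<in>I. L2_inner g (F i))"
  using L2_inner_sum_left[OF assms] by (simp add: L2_inner_commute)

lemma span_subset_L2: "S \<subseteq> L2 \<Longrightarrow> span S \<subseteq> L2"
  by (simp add: span_minimal subspace_L2)

lemma L2_inner_span_right:
  assumes "g \<in> span S" "S \<subseteq> L2" "f \<in> L2" "\<And>s. s \<in> S \<Longrightarrow> L2_inner f s = 0"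
  shows "L2_inner f g = 0"
proof -
  have "subspace {g \<in> L2. L2_inner f g = 0}"
    using assms(3) by (auto intro!: subspaceI simp: L2_inner_add_right)
  then have "span S \<subseteq> {g \<in> L2. L2_inner f g = 0}"
    using assms by (intro span_minimal) auto
  then show ?thesis using assms(1) by blast
qed

lemma L2_inner_span:
  assumes "f \<in> span S" "g \<in> span T" "S \<subseteq> L2" "T \<subseteq> L2"
    "\<And>s t. s \<in> S \<Longrightarrow> t \<in> T \<Longrightarrow> L2_inner s t = 0"
  shows "L2_inner f g = 0"
proof -
  have "L2_inner s g = 0" if "s \<in> S" for s
    using that assms by (intro L2_inner_span_right[of g T]) auto
  then have "L2_inner g f = 0"
    using assms span_subset_L2[of T] L2_inner_commute[of g]
    by (intro L2_inner_span_right[of f S]) auto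
  then show ?thesis by (simp add: L2_inner_commute)
qed

lemma L2_inner_nonneg [simp]: "0 \<le> L2_inner f f"
  by (simp add: L2_inner_def)

lemma L2_norm_eq_0_iff: "L2_norm f = 0 \<longleftrightarrow> L2_inner f f = 0"
  by (simp add: L2_norm_def)

lemma L2_norm_power2: "(L2_norm f)\<^sup>2 = L2_inner f f"
  by (simp add: L2_norm_def)

lemma L2_normalize_inner_self:
  assumes "L2_norm f \<noteq> 0"
  shows "L2_inner (L2_normalize f) (L2_normalize f) = 1"
proof -
  have "L2_inner f f = L2_norm f * L2_norm f"
    by (metis L2_norm_power2 power2_eq_square)
  then show ?thesis using assms by (simp add: L2_normalize_def field_simps)
qed

lemma span_normalize:
  assumes "L2_norm f \<noteq> 0"
  shows "f \<in> span {L2_normalize f}"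
proof -
  have "f = L2_norm f *\<^sub>R L2_normalize f"
    using assms by (simp add: L2_normalize_def)
  then show ?thesis
    by (metis singletonI span_base span_scale)
qed

section \<open>Continuous functions with compact support\<close>

definition CC :: "(real \<Rightarrow> real) set" where
  "CC = {f. continuous_on UNIV f \<and> (\<exists>a. \<forall>x. a < \<bar>x\<bar> \<longrightarrow> f x = 0)}"

lemma CC_continuous: "f \<in> CC \<Longrightarrow> continuous_on S f"
  unfolding CC_def using continuous_on_subset by blast

lemma CC_measurable [measurable_dest]: "f \<in> CC \<Longrightarrow> f \<in> borel_measurable borel"
  by (simp add: CC_continuous borel_measurable_continuous_onI)

lemma CC_mult: "f \<in> CC \<Longrightarrow> continuous_on UNIV g \<Longrightarrow> (\<lambda>x. f x * g x) \<in> CC"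
  unfolding CC_def by (auto intro: continuous_on_mult)

lemma CC_integrable:
  assumes "f \<in> CC"
  shows "integrable lborel f"
proof -
  obtain a where a: "\<And>x. a < \<bar>x\<bar> \<Longrightarrow> f x = 0"
    using assms by (auto simp: CC_def)
  have "integrable lborel (\<lambda>x. indicator {- a..a} x *\<^sub>R f x)"
    by (rule borel_integrable_compact) (use CC_continuous[OF assms] in auto)
  moreover have "(\<lambda>x. indicator {- a..a} x *\<^sub>R f x) = f"
    using a by (force simp: indicator_def fun_eq_iff abs_le_iff not_less[symmetric])
  ultimately show ?thesis by simp
qed

lemma CC_integrable_lebesgue: "f \<in> CC \<Longrightarrow> integrable lebesgue f"
  by (simp add: CC_integrable integrable_completion CC_measurable)

lemma CC_subset_L2: "CC \<subseteq> L2"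
proof
  fix f assume f: "f \<in> CC"
  have "integrable lebesgue (\<lambda>x. f x * f x)"
    by (intro CC_integrable_lebesgue CC_mult f CC_continuous)
  then show "f \<in> L2"
    using f by (simp add: L2_def power2_eq_square measurable_completion CC_measurable)
qed

lemma CC_L2: "f \<in> CC \<Longrightarrow> f \<in> L2"
  using CC_subset_L2 by blast

lemma subspace_CC: "subspace CC"
proof (rule subspaceI)
  show "0 \<in> CC" by (simp add: CC_def zero_fun_def)
next
  fix f g assume fg: "f \<in> CC" "g \<in> CC"
  obtain a b where "\<And>x. a < \<bar>x\<bar> \<Longrightarrow> f x = 0" "\<And>x. b < \<bar>x\<bar> \<Longrightarrow> g x = 0"
    using fg unfolding CC_def by auto
  then have "\<forall>x. max a b < \<bar>x\<bar> \<longrightarrow> (f + g) x = 0" by auto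
  then show "f + g \<in> CC"
    using fg unfolding CC_def plus_fun_def by (blast intro: continuous_on_add)
next
  fix c f assume "f \<in> CC"
  then show "c *\<^sub>R f \<in> CC"
    unfolding CC_def scaleR_fun_def by (auto intro: continuous_on_scaleR continuous_on_mult)
qed

lemma span_subset_CC: "S \<subseteq> CC \<Longrightarrow> span S \<subseteq> CC"
  by (simp add: span_minimal subspace_CC)

lemmas CC_0 [simp] = subspace_CC[THEN subspaceD_0]
lemmas CC_add [simp] = subspace_CC[THEN subspaceD_add]
lemmas CC_scale [simp] = subspace_CC[THEN subspaceD_scale]
lemmas CC_diff [simp] = subspace_CC[THEN subspaceD_diff]
lemmas CC_sum = subspace_CC[THEN subspaceD_sum]

text \<open>The set where \<open>f\<close> is nonzero is open, and it is null because the square has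
  integral zero; a nonempty open set is not negligible.\<close>

lemma CC_inner_eq_0:
  assumes f: "f \<in> CC" and "L2_inner f f = 0"
  shows "f = 0"
proof (rule ccontr)
  assume "f \<noteq> 0"
  then obtain x where x: "f x \<noteq> 0" by (auto simp: fun_eq_iff)
  have "integrable lebesgue (\<lambda>x. f x * f x)"
    by (intro CC_integrable_lebesgue CC_mult f CC_continuous)
  moreover have "(LINT x|lebesgue. f x * f x) = 0"
    using assms by (simp add: L2_inner_def)
  ultimately have "AE x in lebesgue. f x * f x = 0"
    by (subst (asm) integral_nonneg_eq_0_iff_AE) auto
  then have "AE x in lebesgue. f x = 0" by simp
  moreover have op: "open {x. f x \<noteq> 0}"
    using CC_continuous[OF f, of UNIV] open_vimage[of "- {0}" f] by (simp add: vimage_def open_Compl)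
  ultimately have "{x. f x \<noteq> 0} \<in> null_sets lebesgue"
    by (subst AE_iff_null_sets) auto
  then have "negligible {x. f x \<noteq> 0}"
    by (simp add: negligible_iff_null_sets)
  then have "f x = 0"
    using open_not_negligible[OF op] by blast
  then show False using x by simp
qed

lemma CC_norm_eq_0: "f \<in> CC \<Longrightarrow> L2_norm f = 0 \<Longrightarrow> f = 0"
  by (simp add: CC_inner_eq_0 L2_norm_eq_0_iff)

section \<open>Translations and dilations as isometries\<close>

lemma shift_linear: "linear (shift a)"
  by (rule linearI) (auto simp: shift_def fun_eq_iff)

lemma shift_shift [simp]: "shift a (shift b f) = shift (a + b) f"
  by (simp add: shift_def fun_eq_iff add.assoc)

lemma shift_0 [simp]: "shift 0 f = f"
  by (simp add: shift_def)

lemma shift_CC [simp]: "f \<in> CC \<Longrightarrow> shift a f \<in> CC"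
proof -
  assume f: "f \<in> CC"
  then obtain c where c: "\<And>x. c < \<bar>x\<bar> \<Longrightarrow> f x = 0" by (auto simp: CC_def)
  have "\<forall>x. c + \<bar>a\<bar> < \<bar>x\<bar> \<longrightarrow> f (x + a) = 0" using c by auto
  moreover have "continuous_on UNIV (\<lambda>x. f (x + a))"
    by (rule continuous_on_compose2[OF CC_continuous[OF f, of UNIV]]) (auto intro: continuous_on_add continuous_on_id continuous_on_const)
  ultimately show ?thesis unfolding CC_def shift_def by blast
qed

lemma shift_isometry: "L2_inner (shift a f) (shift a g) = L2_inner f g"
  using lebesgue_integral_real_affine[of 1 "\<lambda>x. f x * g x" a]
  by (simp add: L2_inner_def shift_def add.commute)

lemma L2_inner_shift_right: "L2_inner f (shift a g) = L2_inner (shift (- a) f) g"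
  using shift_isometry[of "- a" f "shift a g"] by simp

text \<open>The factor makes the dilation unitary and agrees with the normalisation in
  \<open>\<xi>\<close> and \<open>dilates\<close>, so facts proved on one scale pass to all
  others.\<close>

definition dil :: "int \<Rightarrow> (real \<Rightarrow> real) \<Rightarrow> real \<Rightarrow> real" where
  "dil j f = (\<lambda>x. 2 powr (real_of_int j / 2) * f (2 powi j * x))"

lemma dil_linear: "linear (dil j)"
  by (rule linearI) (auto simp: dil_def fun_eq_iff algebra_simps)

lemma dil_dil: "dil i (dil j f) = dil (i + j) f"
proof -
  have "2 powr (real_of_int i / 2) * 2 powr (real_of_int j / 2) = 2 powr (real_of_int (i + j) / 2)"
    by (simp add: powr_add[symmetric] add_divide_distrib)
  moreover have "2 powi j * (2 powi i * x) = 2 powi (i + j) * x" for x :: real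
    by (simp add: power_int_add)
  ultimately show ?thesis unfolding dil_def by (metis (no_types, lifting) mult.assoc)
qed

lemma dil_0 [simp]: "dil 0 f = f"
  by (simp add: dil_def)

lemma dil_shift: "dil j (shift a f) = shift (a / 2 powi j) (dil j f)"
  by (simp add: dil_def shift_def fun_eq_iff distrib_left)

lemma dil_CC [simp]: "f \<in> CC \<Longrightarrow> dil j f \<in> CC"
proof -
  assume f: "f \<in> CC"
  then obtain c where c: "\<And>x. c < \<bar>x\<bar> \<Longrightarrow> f x = 0" by (auto simp: CC_def)
  have "\<forall>x. c / 2 powi j < \<bar>x\<bar> \<longrightarrow> dil j f x = 0"
    using c by (auto simp: dil_def divide_less_eq mult.commute abs_mult)
  moreover have "continuous_on UNIV (dil j f)"
    unfolding dil_def
    by (intro continuous_on_mult continuous_on_const continuous_on_id subset_UNIV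
        continuous_on_compose2[OF CC_continuous[OF f, of UNIV]])
  ultimately show ?thesis unfolding CC_def by blast
qed

lemma dil_isometry: "L2_inner (dil j f) (dil j g) = L2_inner f g"
proof -
  let ?s = "2 powr (real_of_int j / 2) :: real" and ?c = "2 powi j :: real"
  have s: "?s * ?s = ?c"
    by (simp add: powr_add[symmetric] powr_real_of_int' add_divide_distrib[symmetric])
  have "L2_inner (dil j f) (dil j g) = (LINT x|lebesgue. (?s * ?s) * (f (?c * x) * g (?c * x)))"
    by (simp add: L2_inner_def dil_def mult_ac)
  also have "\<dots> = ?c * (LINT x|lebesgue. f (?c * x) * g (?c * x))"
    unfolding s by simp
  also have "\<dots> = L2_inner f g"
    using lebesgue_integral_real_affine[of ?c "\<lambda>x. f x * g x" 0]
    by (simp add: L2_inner_def abs_mult)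
  finally show ?thesis .
qed

lemma span_linear_image:
  assumes "linear L" "f \<in> span S"
  shows "L f \<in> span (L ` S)"
  using assms by (simp add: linear_span_image)

section \<open>Hermite cubics and splines\<close>

text \<open>The truncated power x_+^n. For n = 0 it is constantly 1, whence the condition
  \<open>0 < n\<close> where it has to vanish on the left.\<close>

definition trunc_pow :: "nat \<Rightarrow> real \<Rightarrow> real" where
  "trunc_pow n x = (max 0 x) ^ n"

lemma trunc_pow_pos: "0 \<le> x \<Longrightarrow> trunc_pow n x = x ^ n"
  and trunc_pow_neg: "x \<le> 0 \<Longrightarrow> 0 < n \<Longrightarrow> trunc_pow n x = 0"
  by (auto simp: trunc_pow_def max_def)

lemma trunc_pow_deriv:
  "(trunc_pow (Suc (Suc n)) has_real_derivative real (Suc (Suc n)) * trunc_pow (Suc n) x) (at x)"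
proof (cases x "0::real" rule: linorder_cases)
  case less
  have "((\<lambda>x. 0) has_real_derivative 0) (at x)" by simp
  then have "(trunc_pow (Suc (Suc n)) has_real_derivative 0) (at x)"
    by (rule has_field_derivative_transform_within_open[of _ _ _ "{..<0}"])
       (use less in \<open>auto simp: trunc_pow_neg\<close>)
  then show ?thesis using less by (simp add: trunc_pow_neg)
next
  case equal
  \<comment> \<open>Caratheodory's criterion: the difference quotient at 0 is the next lower
    truncated power, which is continuous.\<close>
  have "trunc_pow (Suc (Suc n)) z - trunc_pow (Suc (Suc n)) 0 = trunc_pow (Suc n) z * (z - 0)" for z
    by (simp add: trunc_pow_def max_def)
  moreover have "isCont (trunc_pow (Suc n)) 0"
    unfolding trunc_pow_def by (intro continuous_intros)
  ultimately show ?thesis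
    unfolding equal by (subst CARAT_DERIV) (auto simp: trunc_pow_def intro!: exI[of _ "trunc_pow (Suc n)"])
next
  case greater
  have "((\<lambda>x. x ^ Suc (Suc n)) has_real_derivative real (Suc (Suc n)) * x ^ Suc n) (at x)"
    by (rule derivative_eq_intros refl | simp)+
  then have "(trunc_pow (Suc (Suc n)) has_real_derivative real (Suc (Suc n)) * x ^ Suc n) (at x)"
    by (rule has_field_derivative_transform_within_open[of _ _ _ "{0<..}"])
       (use greater in \<open>auto simp: trunc_pow_pos\<close>)
  then show ?thesis using greater by (simp add: trunc_pow_pos)
qed

definition C1_splines :: "(real \<Rightarrow> real) set" where
  "C1_splines = {f. cubic_spline f \<and> f C1_differentiable_on UNIV}"

lemma cubic_spline_add:
  assumes "cubic_spline f" "cubic_spline g"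
  shows "cubic_spline (f + g)"
proof -
  obtain S where S: "finite S" "\<And>I. is_interval I \<Longrightarrow> I \<inter> S = {} \<Longrightarrow>
      \<exists>p::real poly. degree p \<le> 3 \<and> (\<forall>x\<in>I. f x = poly p x)"
    using assms(1) unfolding cubic_spline_def by blast
  obtain T where T: "finite T" "\<And>I. is_interval I \<Longrightarrow> I \<inter> T = {} \<Longrightarrow>
      \<exists>p::real poly. degree p \<le> 3 \<and> (\<forall>x\<in>I. g x = poly p x)"
    using assms(2) unfolding cubic_spline_def by blast
  show ?thesis unfolding cubic_spline_def
  proof (intro exI[of _ "S \<union> T"] conjI allI impI)
    fix I :: "real set" assume "is_interval I \<and> I \<inter> (S \<union> T) = {}"
    then obtain p q :: "real poly" where "degree p \<le> 3" "\<forall>x\<in>I. f x = poly p x" "degree q \<le> 3" "\<forall>x\<in>I. g x = poly q x"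
      using S(2)[of I] T(2)[of I] by blast
    then show "\<exists>p::real poly. degree p \<le> 3 \<and> (\<forall>x\<in>I. (f + g) x = poly p x)"
      by (intro exI[of _ "p + q"]) (auto intro: degree_add_le)
  qed (use S T in auto)
qed

lemma cubic_spline_scale:
  assumes "cubic_spline f"
  shows "cubic_spline (c *\<^sub>R f)"
proof -
  obtain S where S: "finite S" "\<And>I. is_interval I \<Longrightarrow> I \<inter> S = {} \<Longrightarrow>
      \<exists>p::real poly. degree p \<le> 3 \<and> (\<forall>x\<in>I. f x = poly p x)"
    using assms(1) unfolding cubic_spline_def by blast
  show ?thesis unfolding cubic_spline_def
  proof (intro exI[of _ S] conjI allI impI)
    fix I :: "real set" assume "is_interval I \<and> I \<inter> S = {}"
    then obtain p :: "real poly" where "degree p \<le> 3" "\<forall>x\<in>I. f x = poly p x"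
      using S(2)[of I] by blast
    then show "\<exists>p::real poly. degree p \<le> 3 \<and> (\<forall>x\<in>I. (c *\<^sub>R f) x = poly p x)"
      by (intro exI[of _ "smult c p"]) (auto intro: order_trans[OF degree_smult_le])
  qed (use S in auto)
qed

lemma subspace_C1_splines: "subspace C1_splines"
proof (rule subspaceI)
  have "\<forall>I. \<exists>p::real poly. degree p \<le> 3 \<and> (\<forall>x\<in>I. (0 :: real \<Rightarrow> real) x = poly p x)"
    by (intro allI exI[of _ 0]) auto
  then have "cubic_spline 0" unfolding cubic_spline_def by blast
  then show "0 \<in> C1_splines"
    by (simp add: C1_splines_def zero_fun_def C1_differentiable_on_const)
next
  fix f g assume "f \<in> C1_splines" "g \<in> C1_splines"
  then show "f + g \<in> C1_splines"
    by (auto simp: C1_splines_def cubic_spline_add) (auto simp: plus_fun_def C1_differentiable_on_add)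
next
  fix c f assume "f \<in> C1_splines"
  then show "c *\<^sub>R f \<in> C1_splines"
    by (auto simp: C1_splines_def cubic_spline_scale)
       (auto simp: scaleR_fun_def intro!: C1_differentiable_on_mult)
qed

lemma C1_splines_affine:
  assumes f: "f \<in> C1_splines" and a: "a \<noteq> 0"
  shows "(\<lambda>x. f (a * x + b)) \<in> C1_splines"
proof -
  obtain S where S: "finite S" "\<And>I. is_interval I \<Longrightarrow> I \<inter> S = {} \<Longrightarrow>
      \<exists>p::real poly. degree p \<le> 3 \<and> (\<forall>x\<in>I. f x = poly p x)"
    using f unfolding C1_splines_def cubic_spline_def by blast
  let ?h = "\<lambda>x. a * x + b"
  have "cubic_spline (\<lambda>x. f (?h x))" unfolding cubic_spline_def
  proof (intro exI[of _ "?h -` S"] conjI allI impI)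
    show "finite (?h -` S)"
      using S(1) a by (intro finite_vimageI) (auto simp: inj_on_def)
    fix I :: "real set" assume I: "is_interval I \<and> I \<inter> ?h -` S = {}"
    have "is_interval (?h ` I)"
      using I unfolding is_interval_connected_1 by (intro connected_continuous_image continuous_intros) auto
    moreover have "?h ` I \<inter> S = {}" using I by auto
    ultimately obtain p :: "real poly" where p: "degree p \<le> 3" "\<forall>x\<in>?h ` I. f x = poly p x"
      using S(2) by blast
    have "degree (pcompose p [:b, a:]) \<le> 3"
      using p(1) a by (simp add: degree_pcompose)
    then show "\<exists>p::real poly. degree p \<le> 3 \<and> (\<forall>x\<in>I. f (?h x) = poly p x)"
      using p(2) by (intro exI[of _ "pcompose p [:b, a:]"]) (auto simp: poly_pcompose algebra_simps)
  qed
  moreover obtain D where D: "\<And>x. (f has_vector_derivative D x) (at x)" "continuous_on UNIV D"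
    using f by (auto simp: C1_splines_def C1_differentiable_on_def)
  have "(\<lambda>x. f (?h x)) C1_differentiable_on UNIV"
    unfolding C1_differentiable_on_def
  proof (intro exI[of _ "\<lambda>x. D (?h x) * a"] conjI ballI)
    fix x
    have "((\<lambda>x. f (?h x)) has_real_derivative D (?h x) * a) (at x)"
      by (rule DERIV_chain'[where g = f and f = ?h])
         (use D(1) in \<open>auto intro!: derivative_eq_intros simp: has_real_derivative_iff_has_vector_derivative\<close>)
    then show "((\<lambda>x. f (?h x)) has_vector_derivative D (?h x) * a) (at x)"
      by (simp add: has_real_derivative_iff_has_vector_derivative)
    show "continuous_on UNIV (\<lambda>x. D (?h x) * a)"
      by (intro continuous_on_mult continuous_on_const continuous_on_compose2[OF D(2)])
         (auto intro!: continuous_intros)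
  qed
  ultimately show ?thesis by (simp add: C1_splines_def)
qed

lemma trunc_pow_C1_splines:
  assumes "n \<in> {2, 3}"
  shows "trunc_pow n \<in> C1_splines"
proof -
  obtain m where m: "n = Suc (Suc m)" "m \<le> 1"
    using assms by (auto simp: numeral_eq_Suc)
  have "trunc_pow n C1_differentiable_on UNIV"
    unfolding C1_differentiable_on_def
  proof (intro exI[of _ "\<lambda>x. real n * trunc_pow (Suc m) x"] conjI ballI)
    show "(trunc_pow n has_vector_derivative real n * trunc_pow (Suc m) x) (at x)" for x
      using trunc_pow_deriv[of m x] by (simp add: m has_real_derivative_iff_has_vector_derivative)
    show "continuous_on UNIV (\<lambda>x. real n * trunc_pow (Suc m) x)"
      unfolding trunc_pow_def by (intro continuous_intros)
  qed
  moreover have "cubic_spline (trunc_pow n)" unfolding cubic_spline_def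
  proof (intro exI[of _ "{0}"] conjI allI impI)
    fix I :: "real set" assume I: "is_interval I \<and> I \<inter> {0} = {}"
    consider "\<forall>x\<in>I. x < 0" | "\<forall>x\<in>I. x > 0"
      using I unfolding is_interval_1 by (metis disjoint_insert(2) linorder_less_linear order_less_imp_le)
    then show "\<exists>p::real poly. degree p \<le> 3 \<and> (\<forall>x\<in>I. trunc_pow n x = poly p x)"
    proof cases
      case 1
      then show ?thesis
        by (intro exI[of _ 0]) (auto simp: trunc_pow_def max_def m)
    next
      case 2
      then show ?thesis
        using assms by (intro exI[of _ "monom 1 n"]) (auto simp: trunc_pow_def max_def poly_monom degree_monom_eq)
    qed
  qed simp
  ultimately show ?thesis by (simp add: C1_splines_def)
qed

section \<open>Hermite cubics: regularity, symmetry, refinement\<close>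

lemma hermite_cases:
  obtains "x \<le> -1" | "-1 \<le> x" "x \<le> 0" | "0 \<le> x" "x \<le> (1::real)" | "1 \<le> x"
  by linarith

lemma hermite_out: "1 \<le> \<bar>x\<bar> \<Longrightarrow> hermite l x = 0"
  by (auto simp: hermite_def abs_if split: if_splits)

lemma hermite_left:
  "-1 \<le> x \<Longrightarrow> x \<le> 0 \<Longrightarrow> hermite (Suc 0) x = (x + 1)\<^sup>2 * (1 - 2 * x)"
  "-1 \<le> x \<Longrightarrow> x \<le> 0 \<Longrightarrow> hermite 2 x = (x + 1)\<^sup>2 * x"
  by (auto simp: hermite_def)

lemma hermite_right:
  "0 \<le> x \<Longrightarrow> x \<le> 1 \<Longrightarrow> hermite (Suc 0) x = (1 - x)\<^sup>2 * (1 + 2 * x)"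
  "0 \<le> x \<Longrightarrow> x \<le> 1 \<Longrightarrow> hermite 2 x = (1 - x)\<^sup>2 * x"
  by (auto simp: hermite_def)

text \<open>The coefficients at a knot are the jumps of the second and third derivative there,
  divided by 2 and 6. Regularity is thus inherited from truncated powers, and no pieces have to be
  matched at -1, 0, 1.\<close>

lemma hermite_trunc_pow:
  "hermite (Suc 0) x = 3 * trunc_pow 2 (x + 1) - 2 * trunc_pow 3 (x + 1) + 4 * trunc_pow 3 x
     - 3 * trunc_pow 2 (x - 1) - 2 * trunc_pow 3 (x - 1)" (is ?th1)
  "hermite 2 x = trunc_pow 3 (x + 1) - trunc_pow 2 (x + 1) - 4 * trunc_pow 2 x
     - trunc_pow 3 (x - 1) - trunc_pow 2 (x - 1)" (is ?th2)
proof -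
  show "?th1" "?th2"
    by (cases x rule: hermite_cases;
        simp add: hermite_out hermite_left hermite_right trunc_pow_pos trunc_pow_neg abs_if;
        simp add: power2_eq_square power3_eq_cube algebra_simps)+
qed

lemma hermite_C1_splines:
  assumes "l \<in> {1, 2}"
  shows "hermite l \<in> C1_splines"
proof -
  have t: "(\<lambda>x. trunc_pow n (x + a)) \<in> C1_splines" if "n \<in> {2, 3}" for n a
    using C1_splines_affine[OF trunc_pow_C1_splines[OF that], of 1 a] by simp
  let ?t = "\<lambda>n a x. trunc_pow n (x + a)"
  have "hermite (Suc 0) = 3 *\<^sub>R ?t 2 1 - 2 *\<^sub>R ?t 3 1 + 4 *\<^sub>R ?t 3 0 - 3 *\<^sub>R ?t 2 (-1) - 2 *\<^sub>R ?t 3 (-1)"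
    by (simp add: fun_eq_iff hermite_trunc_pow(1))
  moreover have "hermite 2 = ?t 3 1 - ?t 2 1 - 4 *\<^sub>R ?t 2 0 - ?t 3 (-1) - ?t 2 (-1)"
    by (simp add: fun_eq_iff hermite_trunc_pow(2))
  moreover have "3 *\<^sub>R ?t 2 1 - 2 *\<^sub>R ?t 3 1 + 4 *\<^sub>R ?t 3 0 - 3 *\<^sub>R ?t 2 (-1) - 2 *\<^sub>R ?t 3 (-1) \<in> C1_splines"
    "?t 3 1 - ?t 2 1 - 4 *\<^sub>R ?t 2 0 - ?t 3 (-1) - ?t 2 (-1) \<in> C1_splines"
    by (intro subspaceD[OF subspace_C1_splines] t; simp)+
  ultimately show ?thesis using assms by auto
qed

lemma C1_splines_continuous: "f \<in> C1_splines \<Longrightarrow> continuous_on UNIV f"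
  by (simp add: C1_splines_def C1_differentiable_imp_continuous_on)

lemma hermite_continuous: "l \<in> {1, 2} \<Longrightarrow> continuous_on UNIV (hermite l)"
  using C1_splines_continuous hermite_C1_splines by blast

lemma hermite_reflect: "hermite (Suc 0) (- x) = hermite (Suc 0) x" "hermite 2 (- x) = - hermite 2 x"
proof -
  show "hermite (Suc 0) (- x) = hermite (Suc 0) x" "hermite 2 (- x) = - hermite 2 x"
    by (cases x rule: hermite_cases; simp add: hermite_out hermite_left hermite_right abs_if;
        simp add: power2_eq_square algebra_simps)+
qed

text \<open>Both sides are C^1 cubic splines with knots at multiples of 1/2, hence determined by
  values and slopes at these knots. The coefficients are the values of the left side at -1/2, 0, 1/2
  and half its slopes, the half coming from the inner factor 2.\<close>

lemma hermite_refine: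
  "hermite (Suc 0) x = hermite (Suc 0) (2 * x) + hermite (Suc 0) (2 * x - 1) / 2 + hermite (Suc 0) (2 * x + 1) / 2
     - 3 / 4 * hermite 2 (2 * x - 1) + 3 / 4 * hermite 2 (2 * x + 1)" (is ?th1)
  "hermite 2 x = hermite 2 (2 * x) / 2 + hermite (Suc 0) (2 * x - 1) / 8 - hermite (Suc 0) (2 * x + 1) / 8
     - hermite 2 (2 * x - 1) / 8 - hermite 2 (2 * x + 1) / 8" (is ?th2)
proof -
  consider "x \<le> -1" | "-1 \<le> x" "x \<le> -1/2" | "-1/2 \<le> x" "x \<le> 0" | "0 \<le> x" "x \<le> 1/2" | "1/2 \<le> x" "x \<le> 1" | "1 \<le> x"
    by linarith
  then have "?th1 \<and> ?th2"
    by cases (simp_all add: hermite_out hermite_left hermite_right abs_if, simp_all add: power2_eq_square field_simps)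
  then show ?th1 ?th2 by auto
qed

lemma hermite_CC:
  assumes "l \<in> {1, 2}"
  shows "hermite l \<in> CC"
  using hermite_continuous[OF assms] hermite_out[of _ l]
  unfolding CC_def by (auto intro!: exI[of _ 1])

lemma \<xi>_dil: "dil i (\<xi> j m) = \<xi> (i + j) m"
proof -
  have "2 powr (real_of_int i / 2) * 2 powr (real_of_int j / 2) = 2 powr (real_of_int (i + j) / 2)"
    by (simp add: powr_add[symmetric] add_divide_distrib)
  moreover have "2 powi j * (2 powi i * x) = 2 powi (i + j) * x" for x :: real
    by (simp add: power_int_add)
  ultimately show ?thesis unfolding dil_def \<xi>_def by (metis (no_types, lifting) mult.assoc)
qed

lemma \<xi>_eq_dil: "\<xi> j m = dil j (shift (- real_of_int (m div 2)) (hermite (nat (m mod 2) + 1)))"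
  by (simp add: \<xi>_def dil_def shift_def fun_eq_iff)

lemma \<xi>_index_in: "nat (m mod 2) + 1 \<in> {1, 2}"
  by (cases "even m") (auto simp: odd_iff_mod_2_eq_one)

lemma \<xi>_CC [simp]: "\<xi> j m \<in> CC"
  unfolding \<xi>_eq_dil by (intro dil_CC shift_CC hermite_CC \<xi>_index_in)

lemma C1_splines_dil:
  assumes "f \<in> C1_splines"
  shows "dil j f \<in> C1_splines"
proof -
  have "dil j f = (2 powr (real_of_int j / 2)) *\<^sub>R (\<lambda>x. f (2 powi j * x + 0))"
    by (simp add: dil_def fun_eq_iff)
  then show ?thesis
    using C1_splines_affine[OF assms, of "2 powi j" 0] subspaceD_scale[OF subspace_C1_splines] by simp
qed

lemma C1_splines_shift:
  assumes "f \<in> C1_splines"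
  shows "shift a f \<in> C1_splines"
  using C1_splines_affine[OF assms, of 1 a] by (simp add: shift_def)

lemma \<xi>_C1_splines [simp]: "\<xi> j m \<in> C1_splines"
  unfolding \<xi>_eq_dil by (intro C1_splines_dil C1_splines_shift hermite_C1_splines \<xi>_index_in)

lemma \<xi>_shift: "shift (real_of_int n / 2 powi j) (\<xi> j m) = \<xi> j (m - 2 * n)"
proof -
  have "(m - 2 * n) mod 2 = m mod 2" by presburger
  moreover have "(m - 2 * n) div 2 = m div 2 - n" by presburger
  ultimately show ?thesis
    by (simp add: shift_def \<xi>_def fun_eq_iff distrib_left diff_diff_eq2)
qed

lemma \<xi>_1_shift: "shift (real_of_int n) (\<xi> 1 m) = \<xi> 1 (m - 4 * n)"
  using \<xi>_shift[of "2 * n" 1 m] by simp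

lemma \<xi>_eq_0: "1 \<le> \<bar>2 powi j * x - real_of_int (m div 2)\<bar> \<Longrightarrow> \<xi> j m x = 0"
  by (simp add: \<xi>_def hermite_out)

lemma \<xi>_orthogonal:
  assumes "2 \<le> \<bar>m div 2 - n div 2\<bar>"
  shows "L2_inner (\<xi> j m) (\<xi> j n) = 0"
proof -
  have eq: "\<xi> j m x * \<xi> j n x = 0" for x
  proof (cases "1 \<le> \<bar>2 powi j * x - real_of_int (m div 2)\<bar>")
    case True
    then show ?thesis by (simp add: \<xi>_eq_0)
  next
    case False
    have "2 \<le> \<bar>real_of_int (m div 2) - real_of_int (n div 2)\<bar>"
      using assms by linarith
    then have "1 \<le> \<bar>2 powi j * x - real_of_int (n div 2)\<bar>" using False by linarith
    then show ?thesis by (simp add: \<xi>_eq_0)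
  qed
  then show ?thesis unfolding L2_inner_def eq by simp
qed

text \<open>Node k = \<open>m div 2\<close> is node 2k on the next grid; the index range holds both
  kinds of Hermite cubics at 2k - 1, 2k, 2k + 1. The relation is proved on scale 0 and carried over
  by \<open>dil\<close>.\<close>

lemma \<xi>_refine: "\<xi> j m \<in> span (\<xi> (j + 1) ` {4 * (m div 2) - 2..4 * (m div 2) + 3})"
proof -
  define k where "k = m div 2"
  let ?S = "\<xi> 1 ` {4 * k - 2..4 * k + 3}"
  define c where "c = 1 / 2 powr (1 / 2 :: real)"
  have c: "hermite (nat (n mod 2) + 1) (2 * x - real_of_int (n div 2)) = c * \<xi> 1 n x" for n x
    by (simp add: \<xi>_def c_def)
  have ev: "hermite (Suc 0) (2 * (x - real_of_int k) - real_of_int i) = c * \<xi> 1 (2 * (2 * k + i)) x" for x i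
    using c[of "2 * (2 * k + i)" x] by (simp add: algebra_simps)
  have od: "hermite 2 (2 * (x - real_of_int k) - real_of_int i) = c * \<xi> 1 (2 * (2 * k + i) + 1) x" for x i
  proof -
    have "(2 * (2 * k + i) + 1) mod 2 = 1" "(2 * (2 * k + i) + 1) div 2 = 2 * k + i"
      by presburger+
    then show ?thesis
      using c[of "2 * (2 * k + i) + 1" x] by (simp add: algebra_simps numeral_2_eq_2)
  qed
  have h: "hermite (Suc 0) (2 * (x - real_of_int k)) = c * \<xi> 1 (4 * k) x"
      "hermite (Suc 0) (2 * (x - real_of_int k) - 1) = c * \<xi> 1 (4 * k + 2) x"
      "hermite (Suc 0) (2 * (x - real_of_int k) + 1) = c * \<xi> 1 (4 * k - 2) x"
      "hermite 2 (2 * (x - real_of_int k)) = c * \<xi> 1 (4 * k + 1) x"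
      "hermite 2 (2 * (x - real_of_int k) - 1) = c * \<xi> 1 (4 * k + 3) x"
      "hermite 2 (2 * (x - real_of_int k) + 1) = c * \<xi> 1 (4 * k - 1) x" for x
    using ev[of x 0] ev[of x 1] ev[of x "-1"] od[of x 0] od[of x 1] od[of x "-1"] by (simp_all add: add.commute)
  have b: "\<xi> 1 n \<in> span ?S" if "4 * k - 2 \<le> n" "n \<le> 4 * k + 3" for n
    using that by (intro span_base) auto
  have "\<xi> 0 m \<in> span ?S"
  proof (cases "even m")
    case True
    have e: "\<xi> 0 m x = hermite (Suc 0) (x - real_of_int k)" for x
      using True by (simp add: \<xi>_def k_def)
    have "\<xi> 0 m = c *\<^sub>R \<xi> 1 (4 * k) + (c / 2) *\<^sub>R \<xi> 1 (4 * k + 2) + (c / 2) *\<^sub>R \<xi> 1 (4 * k - 2)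
        - (3 / 4 * c) *\<^sub>R \<xi> 1 (4 * k + 3) + (3 / 4 * c) *\<^sub>R \<xi> 1 (4 * k - 1)"
      by (rule ext, unfold e, subst hermite_refine(1), unfold h) simp
    also have "\<dots> \<in> span ?S"
      by (intro span_add span_diff span_scale b) auto
    finally show ?thesis .
  next
    case False
    have e: "\<xi> 0 m x = hermite 2 (x - real_of_int k)" for x
      using False by (simp add: \<xi>_def k_def odd_iff_mod_2_eq_one numeral_2_eq_2)
    have "\<xi> 0 m = (c / 2) *\<^sub>R \<xi> 1 (4 * k + 1) + (c / 8) *\<^sub>R \<xi> 1 (4 * k + 2) - (c / 8) *\<^sub>R \<xi> 1 (4 * k - 2)
        - (c / 8) *\<^sub>R \<xi> 1 (4 * k + 3) - (c / 8) *\<^sub>R \<xi> 1 (4 * k - 1)"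
      by (rule ext, unfold e, subst hermite_refine(2), unfold h) simp
    also have "\<dots> \<in> span ?S"
      by (intro span_add span_diff span_scale b) auto
    finally show ?thesis .
  qed
  then have "dil j (\<xi> 0 m) \<in> span (dil j ` ?S)"
    by (rule span_linear_image[OF dil_linear])
  then show ?thesis
    by (simp add: \<xi>_dil image_image k_def)
qed

section \<open>Reproduction of cubics and vanishing moments\<close>

lemma hermite_0 [simp]: "hermite (Suc 0) 0 = 1" "hermite 2 0 = 0"
  by (simp_all add: hermite_def)

lemma hermite_2_deriv_0: "(hermite 2 has_real_derivative 1) (at 0)"
proof -
  \<comment> \<open>Near 0 both branches of \<open>hermite 2\<close> are this single
    expression.\<close>
  have "((\<lambda>x. x - 2 * (x * \<bar>x\<bar>) + x ^ 3) has_real_derivative 1) (at 0)"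
  proof -
    have "((\<lambda>x::real. x * \<bar>x\<bar>) has_real_derivative 0) (at 0)"
      by (subst CARAT_DERIV) (auto intro!: exI[of _ "\<lambda>x. \<bar>x\<bar>"] continuous_intros)
    then show ?thesis
      using DERIV_add[OF DERIV_diff[OF DERIV_ident DERIV_cmult[of _ 0 _ _ 2]] DERIV_pow[of 3]] by fastforce
  qed
  then show ?thesis
    by (rule has_field_derivative_transform_within_open[of _ _ _ "{-1<..<1}"])
       (auto simp: hermite_def abs_if power2_eq_square power3_eq_cube algebra_simps)
qed

text \<open>Hermite interpolation of endpoint values and slopes is exact on cubics.\<close>

lemma hermite_reproduces_cubic:
  assumes "degree p < 4" and x: "real_of_int n \<le> x" "x \<le> real_of_int n + 1"
  shows "poly p x =
    poly p (of_int n) * hermite (Suc 0) (x - of_int n) + poly (pderiv p) (of_int n) * hermite 2 (x - of_int n) +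
    (poly p (of_int (n + 1)) * hermite (Suc 0) (x - of_int (n + 1)) +
     poly (pderiv p) (of_int (n + 1)) * hermite 2 (x - of_int (n + 1)))"
proof -
  define t where "t = x - real_of_int n"
  have t: "0 \<le> t" "t \<le> 1" using x by (auto simp: t_def)
  have h: "hermite (Suc 0) (x - of_int n) = (1 - t)\<^sup>2 * (1 + 2 * t)" "hermite 2 (x - of_int n) = (1 - t)\<^sup>2 * t"
    "hermite (Suc 0) (x - of_int (n + 1)) = t\<^sup>2 * (3 - 2 * t)" "hermite 2 (x - of_int (n + 1)) = t\<^sup>2 * (t - 1)"
    using hermite_right[of t] hermite_left[of "t - 1"] t by (simp_all add: t_def algebra_simps)
  obtain a b c d where p: "p = [:a, b, c, d:]"
  proof -
    have "p = [:coeff p 0, coeff p 1, coeff p 2, coeff p 3:]"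
      using assms(1)
      by (intro poly_eqI) (auto simp: coeff_pCons coeff_eq_0 numeral_eq_Suc split: nat.split)
    then show ?thesis using that by blast
  qed
  have x_eq: "x = real_of_int n + t" by (simp add: t_def)
  show ?thesis unfolding h unfolding x_eq p
    by (simp add: pderiv_pCons power2_eq_square algebra_simps)
qed

text \<open>On the support of \<open>f\<close> the polynomial equals a finite combination of the
  \<open>\<xi> 1 m\<close>, namely its Hermite interpolant on the grid of step 1/2.\<close>

lemma moments_vanish:
  assumes f: "f \<in> CC" and orth: "\<And>m. L2_inner f (\<xi> 1 m) = 0" and p: "degree p < 4"
  shows "has_bochner_integral lebesgue (\<lambda>x. poly p x * f x) 0"
proof -
  \<comment> \<open>Rescales the grid of step 1/2 to the integers.\<close>
  define q where "q = pcompose p [:0, 1/2:]"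
  have q: "degree q < 4" and pq: "poly p x = poly q (2 * x)" for x
    using p by (simp_all add: q_def poly_pcompose degree_pcompose)
  obtain R where R: "\<And>x. R < \<bar>x\<bar> \<Longrightarrow> f x = 0"
    using f by (auto simp: CC_def)
  \<comment> \<open>Large enough that both nodes next to \<open>2 * x\<close> are in range whenever
    \<open>f x\<close> can be nonzero.\<close>
  define N where "N = \<lceil>2 * \<bar>R\<bar>\<rceil> + 2"
  define s where "s = 2 powr (1 / 2 :: real)"
  define F where "F = (\<Sum>k\<in>{-N..N}. (poly q (of_int k) / s) *\<^sub>R \<xi> 1 (2 * k) + (poly (pderiv q) (of_int k) / s) *\<^sub>R \<xi> 1 (2 * k + 1))"
  have s: "s \<noteq> 0" by (simp add: s_def)
  have xi: "\<xi> 1 (2 * k) x / s = hermite (Suc 0) (2 * x - of_int k)" "\<xi> 1 (2 * k + 1) x / s = hermite 2 (2 * x - of_int k)" for k x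
  proof -
    have "(2 * k + 1) mod 2 = 1" "(2 * k + 1) div 2 = k" by presburger+
    then show "\<xi> 1 (2 * k) x / s = hermite (Suc 0) (2 * x - of_int k)" "\<xi> 1 (2 * k + 1) x / s = hermite 2 (2 * x - of_int k)"
      by (simp_all add: \<xi>_def s_def numeral_2_eq_2)
  qed
  let ?G = "\<lambda>x k. poly q (of_int k) * hermite (Suc 0) (2 * x - of_int k) + poly (pderiv q) (of_int k) * hermite 2 (2 * x - of_int k)"
  have F: "F x = (\<Sum>k\<in>{-N..N}. ?G x k)" for x
    by (simp add: F_def sum_fun_apply xi[symmetric])
  have "poly p x * f x = f x * F x" for x
  proof (cases "\<bar>x\<bar> \<le> R")
    case True
    define n where "n = \<lfloor>2 * x\<rfloor>"
    have n: "of_int n \<le> 2 * x" "2 * x \<le> of_int n + 1"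
      by (auto simp: n_def)
    have "(\<Sum>k\<in>{-N..N}. ?G x k) = (\<Sum>k\<in>{n, n + 1}. ?G x k)"
    proof (rule sum.mono_neutral_right)
      have "- real_of_int N \<le> of_int n" "of_int n + 1 \<le> real_of_int N"
        using True n unfolding N_def by linarith+
      then show "{n, n + 1} \<subseteq> {-N..N}" by auto
      show "\<forall>k\<in>{-N..N} - {n, n + 1}. ?G x k = 0"
      proof
        fix k assume "k \<in> {-N..N} - {n, n + 1}"
        then have "k \<le> n - 1 \<or> n + 2 \<le> k" by auto
        then have "of_int k \<le> real_of_int n - 1 \<or> of_int n + 2 \<le> real_of_int k" by linarith
        then have "1 \<le> \<bar>2 * x - of_int k\<bar>" using n by linarith
        then show "?G x k = 0" by (simp add: hermite_out)
      qed
    qed simp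
    also have "\<dots> = poly p x"
      using hermite_reproduces_cubic[OF q n] by (simp add: pq)
    finally show ?thesis by (simp add: F)
  qed (use R in auto)
  then have eq: "(\<lambda>x. poly p x * f x) = (\<lambda>x. f x * F x)" by (simp add: fun_eq_iff)
  have F_CC: "F \<in> CC"
    unfolding F_def by (intro CC_sum) auto
  have "L2_inner f F = 0"
    unfolding F_def using f orth
    by (subst L2_inner_sum_right) (auto simp: CC_L2 L2_inner_add_right)
  moreover have "integrable lebesgue (\<lambda>x. f x * F x)"
    using f F_CC by (intro L2_mult_integrable CC_L2)
  ultimately show ?thesis
    unfolding eq by (metis L2_inner_def has_bochner_integral_integrable)
qed

section \<open>Density of splines\<close>

text \<open>Needs only 2<a,b> \<le> <a,a> + <b,b>: the squared norm of the sum is at most twice the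
  sum of the squared norms, which stays below \<epsilon>^2.\<close>

lemma L2_norm_triangle_half:
  assumes a: "a \<in> L2" and b: "b \<in> L2" and "L2_norm a < \<epsilon> / 2" "L2_norm b < \<epsilon> / 2"
  shows "L2_norm (a + b) < \<epsilon>"
proof -
  have nn: "0 \<le> L2_norm a" "0 \<le> L2_norm b" by (simp_all add: L2_norm_def)
  have sq: "L2_inner a a < (\<epsilon> / 2)\<^sup>2" "L2_inner b b < (\<epsilon> / 2)\<^sup>2"
    using assms(3,4) nn by (simp_all add: L2_norm_power2[symmetric] power_strict_mono)
  have "0 \<le> L2_inner (a - b) (a - b)" by simp
  then have "2 * L2_inner a b \<le> L2_inner a a + L2_inner b b"
    using a b by (simp add: L2_inner_diff_left L2_inner_diff_right L2_inner_commute[of b a])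
  moreover have "L2_inner (a + b) (a + b) = L2_inner a a + 2 * L2_inner a b + L2_inner b b"
    using a b by (simp add: L2_inner_add_left L2_inner_add_right L2_inner_commute[of b a])
  ultimately have "L2_inner (a + b) (a + b) < \<epsilon>\<^sup>2"
    using sq by (simp add: power_divide)
  then have "sqrt (L2_inner (a + b) (a + b)) < sqrt (\<epsilon>\<^sup>2)"
    by (rule real_sqrt_less_mono)
  moreover have "0 < \<epsilon>" using nn assms(3) by linarith
  ultimately show ?thesis by (simp add: L2_norm_def)
qed

definition L2_approximable :: "(real \<Rightarrow> real) set \<Rightarrow> (real \<Rightarrow> real) \<Rightarrow> bool" where
  "L2_approximable S f \<longleftrightarrow> (\<forall>\<epsilon>>0. \<exists>g\<in>S. L2_norm (f - g) < \<epsilon>)"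

lemma L2_approximable_trans:
  assumes "L2_approximable R f" "\<And>g. g \<in> R \<Longrightarrow> L2_approximable S g" "f \<in> L2" "R \<subseteq> L2" "S \<subseteq> L2"
  shows "L2_approximable S f"
  unfolding L2_approximable_def
proof (intro allI impI)
  fix \<epsilon> :: real assume \<epsilon>: "\<epsilon> > 0"
  obtain g where g: "g \<in> R" "L2_norm (f - g) < \<epsilon> / 2"
    using assms(1) \<epsilon> unfolding L2_approximable_def by (meson half_gt_zero)
  obtain h where h: "h \<in> S" "L2_norm (g - h) < \<epsilon> / 2"
    using assms(2)[OF g(1)] \<epsilon> unfolding L2_approximable_def by (meson half_gt_zero)
  have "L2_norm ((f - g) + (g - h)) < \<epsilon>"
    using g h assms by (intro L2_norm_triangle_half L2_diff) auto
  then show "\<exists>g\<in>S. L2_norm (f - g) < \<epsilon>" using h by (auto simp: algebra_simps)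
qed

text \<open>Dominated convergence applied to the squared errors. Each density step then only has to
  supply a sequence converging almost everywhere with one square-integrable bound on the
  errors.\<close>

lemma L2_approximable_dominated:
  assumes S: "\<And>n. F n \<in> S" and f: "f \<in> borel_measurable lebesgue"
    and F: "\<And>n. F n \<in> borel_measurable lebesgue"
    and lim: "AE x in lebesgue. (\<lambda>n. F n x) \<longlonglongrightarrow> f x"
    and bound: "\<And>n x. \<bar>f x - F n x\<bar> \<le> w x" and w: "w \<in> L2"
  shows "L2_approximable S f"
proof -
  have "(\<lambda>n. LINT x|lebesgue. (f x - F n x)\<^sup>2) \<longlonglongrightarrow> (LINT x|(lebesgue :: real measure). 0)"
  proof (rule integral_dominated_convergence)
    show "integrable lebesgue (\<lambda>x. (w x)\<^sup>2)" using w by (simp add: L2_def)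
    show "(\<lambda>x. (f x - F n x)\<^sup>2) \<in> borel_measurable lebesgue" for n
      using f F[of n] by measurable
    show "AE x in lebesgue. (\<lambda>n. (f x - F n x)\<^sup>2) \<longlonglongrightarrow> 0"
      using lim
    proof eventually_elim
      case (elim x)
      then show ?case by (intro tendsto_eq_intros) (rule tendsto_const elim refl | simp)+
    qed
    show "AE x in lebesgue. norm ((f x - F n x)\<^sup>2) \<le> (w x)\<^sup>2" for n
      using bound[of _ n] by (intro AE_I2) (simp add: abs_le_square_iff[symmetric] order_trans[OF bound abs_ge_self])
  qed simp
  then have lim0: "(\<lambda>n. L2_norm (f - F n)) \<longlonglongrightarrow> 0"
    unfolding L2_norm_def L2_inner_def
    using tendsto_real_sqrt[of "\<lambda>n. LINT x|lebesgue. (f x - F n x)\<^sup>2" 0] by (simp add: power2_eq_square)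
  show ?thesis
    unfolding L2_approximable_def
  proof (intro allI impI)
    fix \<epsilon> :: real assume "\<epsilon> > 0"
    then have "eventually (\<lambda>n. L2_norm (f - F n) < \<epsilon>) sequentially"
      using lim0 by (rule order_tendstoD(2)[rotated])
    then obtain n where "L2_norm (f - F n) < \<epsilon>"
      by (auto simp: eventually_sequentially)
    then show "\<exists>g\<in>S. L2_norm (f - g) < \<epsilon>" using S by blast
  qed
qed

section \<open>Truncation and approximation by continuous functions\<close>

definition clip :: "real \<Rightarrow> real \<Rightarrow> real" where
  "clip M y = max (- M) (min M y)"

lemma clip_bound: "0 \<le> M \<Longrightarrow> \<bar>clip M y\<bar> \<le> M" "0 \<le> M \<Longrightarrow> \<bar>clip M y\<bar> \<le> \<bar>y\<bar>"
  by (auto simp: clip_def)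

lemma clip_eq: "\<bar>y\<bar> \<le> M \<Longrightarrow> clip M y = y"
  by (auto simp: clip_def)

lemma clip_tendsto: "(f \<longlongrightarrow> l) F \<Longrightarrow> ((\<lambda>x. clip M (f x)) \<longlongrightarrow> clip M l) F"
  unfolding clip_def by (intro tendsto_intros)

lemma indicator_interval_L2: "(\<lambda>x. c * indicator {-R..R} x) \<in> L2" for c R :: real
proof -
  have "integrable lebesgue (indicator {-R..R} :: real \<Rightarrow> real)"
    by (rule integrable_real_indicator) (auto simp: emeasure_lborel_Icc_eq)
  moreover have "(\<lambda>x. (c * indicator {-R..R} x)\<^sup>2) = (\<lambda>x. c\<^sup>2 * indicator {-R..R} x :: real)"
    by (auto simp: fun_eq_iff indicator_def)
  moreover have "(\<lambda>x. c * indicator {-R..R} x :: real) \<in> borel_measurable lebesgue"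
    by (intro borel_measurable_times borel_measurable_const borel_measurable_indicator) auto
  ultimately show ?thesis by (simp add: L2_def)
qed

definition bdd_cpt :: "(real \<Rightarrow> real) set" where
  "bdd_cpt = {f \<in> borel_measurable lebesgue. \<exists>R\<ge>0. (\<forall>x. \<bar>f x\<bar> \<le> R * indicator {-R..R} x)}"

lemma bdd_cpt_L2: "bdd_cpt \<subseteq> L2"
proof
  fix f assume "f \<in> bdd_cpt"
  then obtain R where f: "f \<in> borel_measurable lebesgue" and R: "\<And>x. \<bar>f x\<bar> \<le> R * indicator {-R..R} x"
    by (auto simp: bdd_cpt_def)
  have "integrable lebesgue (\<lambda>x. (f x)\<^sup>2)"
  proof (rule Bochner_Integration.integrable_bound)
    show "integrable lebesgue (\<lambda>x. (R * indicator {-R..R} x)\<^sup>2)"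
      using indicator_interval_L2[of R R] by (simp add: L2_def)
    show "AE x in lebesgue. norm ((f x)\<^sup>2) \<le> norm ((R * indicator {-R..R} x)\<^sup>2)"
      using R by (intro AE_I2) (simp add: abs_le_square_iff[symmetric] order_trans[OF R abs_ge_self])
  qed (use f in measurable)
  then show "f \<in> L2" using f by (simp add: L2_def)
qed

lemma L2_approximable_bdd_cpt:
  assumes f: "f \<in> L2"
  shows "L2_approximable bdd_cpt f"
proof (rule L2_approximable_dominated[where F = "\<lambda>n x. clip (real n) (f x) * indicator {- real n..real n} x" and w = "\<lambda>x. \<bar>f x\<bar>"])
  have m: "f \<in> borel_measurable lebesgue" using f by (simp add: L2_def)
  show F: "(\<lambda>x. clip (real n) (f x) * indicator {- real n..real n} x) \<in> borel_measurable lebesgue" for n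
  proof (intro borel_measurable_times borel_measurable_indicator)
    show "(\<lambda>x. clip (real n) (f x)) \<in> borel_measurable lebesgue"
      unfolding clip_def using m by measurable
  qed auto
  show "(\<lambda>x. clip (real n) (f x) * indicator {- real n..real n} x) \<in> bdd_cpt" for n
    unfolding bdd_cpt_def using F[of n] clip_bound(1)[of "real n"]
    by (auto simp: indicator_def intro!: exI[of _ "real n"])
  show "AE x in lebesgue. (\<lambda>n. clip (real n) (f x) * indicator {- real n..real n} x) \<longlonglongrightarrow> f x"
  proof (rule AE_I2)
    fix x
    obtain N where N: "\<bar>x\<bar> \<le> real N" "\<bar>f x\<bar> \<le> real N"
      using real_arch_simple[of "max \<bar>x\<bar> \<bar>f x\<bar>"] by auto
    have "clip (real n) (f x) * indicator {- real n..real n} x = f x" if "n \<ge> N" for n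
    proof -
      have "\<bar>x\<bar> \<le> real n" "\<bar>f x\<bar> \<le> real n" using N that by (meson of_nat_le_iff order_trans)+
      then show ?thesis by (simp add: clip_eq indicator_def abs_le_iff minus_le_iff)
    qed
    then show "(\<lambda>n. clip (real n) (f x) * indicator {- real n..real n} x) \<longlonglongrightarrow> f x"
      by (intro tendsto_eventually) (auto simp: eventually_sequentially)
  qed
  show "(\<lambda>x. \<bar>f x\<bar>) \<in> L2" using f by (auto simp: L2_def)
  show "\<bar>f x - clip (real n) (f x) * indicator {- real n..real n} x\<bar> \<le> \<bar>f x\<bar>" for n x
    by (auto simp: clip_def indicator_def)
qed (use f in \<open>simp add: L2_def\<close>)

text \<open>A measurable function is an almost everywhere limit of continuous ones. Clipping these
  at the bound \<open>R\<close> of \<open>f\<close> and multiplying by the trapezoidal cutoff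
  \<open>\<kappa>\<close> keeps continuity and the limit, and adds compact support and a dominating
  function.\<close>

lemma CC_approximates_bdd_cpt:
  assumes f: "f \<in> bdd_cpt"
  shows "L2_approximable CC f"
proof -
  obtain R where m: "f \<in> borel_measurable lebesgue" and R: "0 \<le> R" "\<And>x. \<bar>f x\<bar> \<le> R * indicator {-R..R} x"
    using f by (auto simp: bdd_cpt_def)
  have "f measurable_on UNIV"
    using m by (simp add: measurable_on_UNIV lebesgue_measurable_imp_measurable_on)
  then obtain N g where N: "negligible N" and g: "\<And>n. continuous_on UNIV (g n)"
      and lim: "\<And>x. x \<notin> N \<Longrightarrow> (\<lambda>n. g n x) \<longlonglongrightarrow> f x"
    by (auto simp: measurable_on_def)
  define \<kappa> where "\<kappa> x = max 0 (min 1 (R + 1 - \<bar>x\<bar>))" for x :: real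
  have \<kappa>: "0 \<le> \<kappa> x" "\<kappa> x \<le> 1" "\<bar>x\<bar> \<le> R \<Longrightarrow> \<kappa> x = 1" "R + 1 < \<bar>x\<bar> \<Longrightarrow> \<kappa> x = 0" for x
    by (auto simp: \<kappa>_def)
  have f0: "f x = 0" if "R < \<bar>x\<bar>" for x
  proof -
    have "x \<notin> {-R..R}" using that by auto
    then show ?thesis using R(2)[of x] by simp
  qed
  have fR: "\<bar>f x\<bar> \<le> R" for x
    using R(1) R(2)[of x] by (cases "x \<in> {-R..R}") auto
  show ?thesis
  proof (rule L2_approximable_dominated[where F = "\<lambda>n x. clip R (g n x) * \<kappa> x" and w = "\<lambda>x. (2 * R) * indicator {-(R + 1)..R + 1} x"])
    have cont: "continuous_on UNIV (\<lambda>x. clip R (g n x) * \<kappa> x)" for n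
      unfolding clip_def \<kappa>_def by (intro continuous_intros g)
    then show CC: "(\<lambda>x. clip R (g n x) * \<kappa> x) \<in> CC" for n
      unfolding CC_def using \<kappa>(4) by (auto intro!: exI[of _ "R + 1"])
    then show "(\<lambda>x. clip R (g n x) * \<kappa> x) \<in> borel_measurable lebesgue" for n
      using CC_L2 L2_measurable by blast
    show "AE x in lebesgue. (\<lambda>n. clip R (g n x) * \<kappa> x) \<longlonglongrightarrow> f x"
    proof (rule AE_I')
      show "N \<in> null_sets lebesgue" using N by (simp add: negligible_iff_null_sets)
      have "(\<lambda>n. clip R (g n x) * \<kappa> x) \<longlonglongrightarrow> f x" if "x \<notin> N" for x
      proof -
        have "(\<lambda>n. clip R (g n x) * \<kappa> x) \<longlonglongrightarrow> clip R (f x) * \<kappa> x"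
          by (intro tendsto_intros clip_tendsto lim that)
        moreover have "clip R (f x) * \<kappa> x = f x"
          using f0[of x] fR[of x] \<kappa>(3)[of x] by (cases "\<bar>x\<bar> \<le> R") (auto simp: clip_eq)
        ultimately show ?thesis by simp
      qed
      then show "{x \<in> space lebesgue. \<not> (\<lambda>n. clip R (g n x) * \<kappa> x) \<longlonglongrightarrow> f x} \<subseteq> N" by auto
    qed
    show "\<bar>f x - clip R (g n x) * \<kappa> x\<bar> \<le> 2 * R * indicator {- (R + 1)..R + 1} x" for n x
    proof (cases "\<bar>x\<bar> \<le> R + 1")
      case True
      have "\<bar>clip R (g n x) * \<kappa> x\<bar> \<le> R * 1"
        unfolding abs_mult using clip_bound(1)[OF R(1)] \<kappa>(1,2)[of x] R(1) by (intro mult_mono) auto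
      then show ?thesis using True fR[of x] by (simp add: indicator_def abs_le_iff)
    next
      case False
      then show ?thesis using f0[of x] \<kappa>(4)[of x] R(1) by (simp add: indicator_def)
    qed
    show "(\<lambda>x. (2 * R) * indicator {-(R + 1)..R + 1} x) \<in> L2" by (rule indicator_interval_L2)
  qed (rule m)
qed

section \<open>Quasi-interpolation by Hermite cubics\<close>

text \<open>Makes the quasi-interpolant a convex combination of two adjacent samples at every
  point.\<close>

lemma hermite_partition:
  assumes "0 \<le> t" "t \<le> 1"
  shows "hermite (Suc 0) t + hermite (Suc 0) (t - 1) = 1" "0 \<le> hermite (Suc 0) t" "0 \<le> hermite (Suc 0) (t - 1)"
  using assms by (simp_all add: hermite_right hermite_left) (simp_all add: power2_eq_square algebra_simps)

text \<open>The approximant \<open>s j\<close> takes samples of \<open>h\<close> with all slopes set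
  to 0, so no derivative of \<open>h\<close> enters. As a local average of adjacent samples it
  converges by continuity and obeys the bound of \<open>h\<close>.\<close>

lemma splines_approximate_CC:
  assumes h: "h \<in> CC"
  shows "L2_approximable (\<Union>j::nat. span (range (\<xi> (int j)))) h"
proof -
  obtain R where R: "\<And>x. R < \<bar>x\<bar> \<Longrightarrow> h x = 0" and R0: "0 \<le> R"
  proof -
    obtain a where "\<And>x. a < \<bar>x\<bar> \<Longrightarrow> h x = 0" using h by (auto simp: CC_def)
    then show ?thesis by (intro that[of "max a 0"]) auto
  qed
  have "compact (h ` {-R..R})"
    by (intro compact_continuous_image CC_continuous h) auto
  then obtain M where "\<forall>y\<in>h ` {-R..R}. norm y \<le> M"
    using compact_imp_bounded bounded_iff by metis
  then have M: "\<bar>h x\<bar> \<le> M" if "\<bar>x\<bar> \<le> R" for x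
    using that by (auto simp: abs_le_iff)
  have M0: "0 \<le> M" using M[of 0] R0 by auto
  have hM: "\<bar>h x\<bar> \<le> M" for x using M[of x] R[of x] M0 by (cases "\<bar>x\<bar> \<le> R") auto
  \<comment> \<open>Nodes beyond \<open>N j\<close> lie outside the support of \<open>h\<close>, so
    the finite sum misses no nonzero term.\<close>
  define N where "N j = \<lceil>2 ^ j * (R + 1)\<rceil>" for j :: nat
  define s where "s j x = (\<Sum>k\<in>{-N j..N j}. h (of_int k / 2 ^ j) * hermite (Suc 0) (2 ^ j * x - of_int k))" for j x
  have s_eq: "s j x = h (of_int n / 2 ^ j) * hermite (Suc 0) (2 ^ j * x - of_int n) +
      h (of_int (n + 1) / 2 ^ j) * hermite (Suc 0) (2 ^ j * x - of_int (n + 1))"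
    if n: "of_int n \<le> 2 ^ j * x" "2 ^ j * x \<le> of_int n + 1" for j n x
  proof -
    let ?g = "\<lambda>k. h (of_int k / 2 ^ j) * hermite (Suc 0) (2 ^ j * x - of_int k)"
    have out: "?g k = 0" if "k \<notin> {-N j..N j}" for k
    proof -
      have "real_of_int (N j) < \<bar>real_of_int k\<bar>" using that by auto
      moreover have "2 ^ j * R \<le> real_of_int (N j)"
        unfolding N_def using R0 by (intro order_trans[OF _ le_of_int_ceiling]) (simp add: mult_left_mono)
      ultimately have "R < \<bar>of_int k / 2 ^ j\<bar>"
        by (simp add: less_divide_eq mult.commute)
      then show ?thesis using R by simp
    qed
    have far: "?g k = 0" if "k \<notin> {n, n + 1}" for k
    proof -
      have "k \<le> n - 1 \<or> n + 2 \<le> k" using that by auto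
      then have "of_int k \<le> real_of_int n - 1 \<or> of_int n + 2 \<le> real_of_int k" by linarith
      then have "1 \<le> \<bar>2 ^ j * x - of_int k\<bar>" using n by linarith
      then show ?thesis by (simp add: hermite_out)
    qed
    have "s j x = sum ?g ({-N j..N j} \<inter> {n, n + 1})"
      unfolding s_def using far by (intro sum.mono_neutral_right) auto
    also have "\<dots> = sum ?g {n, n + 1}"
    proof (rule sum.mono_neutral_left)
      show "\<forall>k\<in>{n, n + 1} - {-N j..N j} \<inter> {n, n + 1}. ?g k = 0" using out by blast
    qed auto
    finally show ?thesis by simp
  qed
  have s_dev: "\<bar>h x - s j x\<bar> \<le> max \<bar>h x - h (of_int n / 2 ^ j)\<bar> \<bar>h x - h (of_int (n + 1) / 2 ^ j)\<bar>"
    if n: "of_int n \<le> 2 ^ j * x" "2 ^ j * x \<le> of_int n + 1" for j n x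
  proof -
    define t where "t = 2 ^ j * x - of_int n"
    define p where "p = hermite (Suc 0) t"
    define q where "q = hermite (Suc 0) (t - 1)"
    have pq: "p + q = 1" "0 \<le> p" "0 \<le> q"
      using hermite_partition[of t] n by (auto simp: p_def q_def t_def)
    let ?A = "h (of_int n / 2 ^ j)" and ?B = "h (of_int (n + 1) / 2 ^ j)"
    let ?m = "max \<bar>h x - ?A\<bar> \<bar>h x - ?B\<bar>"
    have "s j x = ?A * p + ?B * q"
      using s_eq[OF n] by (simp add: p_def q_def t_def algebra_simps)
    then have "h x - s j x = h x * (p + q) - (?A * p + ?B * q)"
      unfolding pq(1) by simp
    also have "\<dots> = (h x - ?A) * p + (h x - ?B) * q"
      by (simp add: algebra_simps)
    finally have "\<bar>h x - s j x\<bar> = \<bar>(h x - ?A) * p + (h x - ?B) * q\<bar>" by simp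
    also have "\<dots> \<le> \<bar>h x - ?A\<bar> * p + \<bar>h x - ?B\<bar> * q"
      using pq by (intro order_trans[OF abs_triangle_ineq]) (simp add: abs_mult)
    also have "\<dots> \<le> ?m * p + ?m * q"
      using pq by (intro add_mono mult_right_mono) auto
    also have "\<dots> = ?m * (p + q)" by (simp only: distrib_left)
    also have "\<dots> = ?m" unfolding pq(1) by simp
    finally show ?thesis .
  qed
  have fl: "of_int \<lfloor>2 ^ j * x\<rfloor> \<le> 2 ^ j * x" "2 ^ j * x \<le> of_int \<lfloor>2 ^ j * x\<rfloor> + 1" for j :: nat and x :: real
    by auto
  have close: "\<bar>of_int n / 2 ^ j - x\<bar> \<le> 1 / 2 ^ j" if "\<bar>of_int n - 2 ^ j * x\<bar> \<le> 1" for n j and x :: real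
    using that by (simp add: field_simps abs_le_iff)
  have span: "s j \<in> span (range (\<xi> (int j)))" for j
  proof -
    have "hermite (Suc 0) (2 ^ j * x - of_int k) = \<xi> (int j) (2 * k) x / 2 powr (real j / 2)" for x k
      by (simp add: \<xi>_def)
    then have "s j = (\<Sum>k\<in>{-N j..N j}. (h (of_int k / 2 ^ j) / 2 powr (real j / 2)) *\<^sub>R \<xi> (int j) (2 * k))"
      by (simp add: fun_eq_iff s_def sum_fun_apply)
    also have "\<dots> \<in> span (range (\<xi> (int j)))"
      by (intro span_sum span_scale span_base) auto
    finally show ?thesis .
  qed
  have s_CC: "s j \<in> CC" for j
  proof -
    have "range (\<xi> (int j)) \<subseteq> CC" by auto
    then show ?thesis using span_subset_CC span[of j] by blast
  qed
  show ?thesis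
  proof (rule L2_approximable_dominated[where F = s and w = "\<lambda>x. (2 * M) * indicator {-(R + 1)..R + 1} x"])
    show "s j \<in> (\<Union>j::nat. span (range (\<xi> (int j))))" for j using span by blast
    show "h \<in> borel_measurable lebesgue" "s j \<in> borel_measurable lebesgue" for j
      using h s_CC CC_L2 L2_measurable by blast+
    show "(\<lambda>x. (2 * M) * indicator {-(R + 1)..R + 1} x) \<in> L2" by (rule indicator_interval_L2)
    show "AE x in lebesgue. (\<lambda>j. s j x) \<longlonglongrightarrow> h x"
    proof (rule AE_I2, rule LIMSEQ_I)
      fix x \<epsilon> :: real assume \<epsilon>: "0 < \<epsilon>"
      have "isCont h x"
        using CC_continuous[OF h, of UNIV] by (simp add: continuous_on_eq_continuous_at)
      then obtain \<delta> where \<delta>: "\<delta> > 0" "\<And>y. \<bar>y - x\<bar> < \<delta> \<Longrightarrow> \<bar>h y - h x\<bar> < \<epsilon>"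
        using \<epsilon> unfolding continuous_at_eps_delta dist_real_def by metis
      obtain J where J: "(1 / 2) ^ J < \<delta>"
        using real_arch_pow_inv[OF \<delta>(1), of "1 / 2"] by auto
      have "norm (s j x - h x) < \<epsilon>" if "j \<ge> J" for j
      proof -
        have "(1 / 2 :: real) ^ j \<le> (1 / 2) ^ J" using that by (intro power_decreasing) auto
        then have d: "1 / 2 ^ j < \<delta>" using J by (simp add: power_one_over)
        let ?n = "\<lfloor>2 ^ j * x\<rfloor>"
        have "\<bar>of_int ?n / 2 ^ j - x\<bar> < \<delta>" "\<bar>of_int (?n + 1) / 2 ^ j - x\<bar> < \<delta>"
          using close[of ?n j x] close[of "?n + 1" j x] fl[of j x] d by auto
        from this[THEN \<delta>(2)] show ?thesis
          using s_dev[OF fl, of x j] unfolding real_norm_def by linarith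
      qed
      then show "\<exists>no. \<forall>n\<ge>no. norm (s n x - h x) < \<epsilon>" by blast
    qed
    show "\<bar>h x - s j x\<bar> \<le> 2 * M * indicator {- (R + 1)..R + 1} x" for j x
    proof (cases "\<bar>x\<bar> \<le> R + 1")
      case True
      have "\<bar>h x - s j x\<bar> \<le> 2 * M"
        using s_dev[OF fl, of x j] hM[of x] hM[of "of_int \<lfloor>2 ^ j * x\<rfloor> / 2 ^ j"] hM[of "of_int (\<lfloor>2 ^ j * x\<rfloor> + 1) / 2 ^ j"]
        by (auto simp: abs_le_iff max_def split: if_splits)
      then show ?thesis using True by (simp add: indicator_def abs_le_iff)
    next
      case False
      \<comment> \<open>Both nodes next to \<open>x\<close> are within distance 1, so outside the
        window of radius R + 1 both samples vanish.\<close>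
      let ?n = "\<lfloor>2 ^ j * x\<rfloor>"
      have "1 / 2 ^ j \<le> (1 :: real)" by simp
      then have "\<bar>of_int ?n / 2 ^ j - x\<bar> \<le> 1" "\<bar>of_int (?n + 1) / 2 ^ j - x\<bar> \<le> 1"
        using close[of ?n j x] close[of "?n + 1" j x] fl[of j x] by linarith+
      then have "R < \<bar>of_int ?n / 2 ^ j\<bar>" "R < \<bar>of_int (?n + 1) / 2 ^ j\<bar>"
        using False by linarith+
      then have "h (of_int ?n / 2 ^ j) = 0" "h (of_int (?n + 1) / 2 ^ j) = 0" "h x = 0"
        using R False by auto
      then show ?thesis using s_dev[OF fl, of x j] M0 by (simp add: indicator_def)
    qed
  qed
qed

lemma splines_dense:
  assumes "f \<in> L2"
  shows "L2_approximable (\<Union>j::nat. span (range (\<xi> (int j)))) f"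
proof -
  let ?S = "\<Union>j::nat. span (range (\<xi> (int j)))"
  have "range (\<xi> (int j)) \<subseteq> L2" for j
    using CC_subset_L2 by auto
  then have S: "?S \<subseteq> L2" using span_subset_L2 by blast
  have "L2_approximable ?S g" if "g \<in> bdd_cpt" for g
    by (rule L2_approximable_trans[OF CC_approximates_bdd_cpt[OF that] splines_approximate_CC _ CC_subset_L2 S])
       (use that bdd_cpt_L2 in auto)
  then show ?thesis
    by (rule L2_approximable_trans[OF L2_approximable_bdd_cpt[OF assms] _ assms bdd_cpt_L2 S])
qed

section \<open>Orthonormal systems\<close>

definition orthonormal_on :: "'i set \<Rightarrow> ('i \<Rightarrow> real \<Rightarrow> real) \<Rightarrow> bool" where
  "orthonormal_on I e \<longleftrightarrow> (\<forall>i\<in>I. e i \<in> L2) \<and> (\<forall>i\<in>I. \<forall>j\<in>I. L2_inner (e i) (e j) = of_bool (i = j))"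

definition fourier_sum :: "'i set \<Rightarrow> ('i \<Rightarrow> real \<Rightarrow> real) \<Rightarrow> (real \<Rightarrow> real) \<Rightarrow> real \<Rightarrow> real" where
  "fourier_sum I e f = (\<Sum>i\<in>I. L2_inner f (e i) *\<^sub>R e i)"

lemma orthonormal_on_L2: "orthonormal_on I e \<Longrightarrow> i \<in> I \<Longrightarrow> e i \<in> L2"
  by (simp add: orthonormal_on_def)

lemma orthonormal_on_inner: "orthonormal_on I e \<Longrightarrow> i \<in> I \<Longrightarrow> j \<in> I \<Longrightarrow> L2_inner (e i) (e j) = of_bool (i = j)"
  by (simp add: orthonormal_on_def)

lemma fourier_sum_span: "fourier_sum I e f \<in> span (e ` I)"
  unfolding fourier_sum_def by (intro span_sum span_scale span_base) auto

lemma fourier_sum_L2: "orthonormal_on I e \<Longrightarrow> fourier_sum I e f \<in> L2"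
  unfolding fourier_sum_def by (intro L2_sum L2_scale orthonormal_on_L2)

lemma inner_fourier_sum:
  assumes "orthonormal_on I e" "g \<in> L2"
  shows "L2_inner g (fourier_sum I e f) = (\<Sum>i\<in>I. L2_inner f (e i) * L2_inner g (e i))"
  unfolding fourier_sum_def using assms
  by (subst L2_inner_sum_right) (auto simp: orthonormal_on_L2)

lemma inner_fourier_sum_basis:
  assumes "orthonormal_on I e" "finite I" "k \<in> I"
  shows "L2_inner (fourier_sum I e f) (e k) = L2_inner f (e k)"
proof -
  have "L2_inner (fourier_sum I e f) (e k) = (\<Sum>i\<in>I. L2_inner f (e i) * L2_inner (e k) (e i))"
    using assms by (simp add: L2_inner_commute[of "fourier_sum I e f"] inner_fourier_sum orthonormal_on_L2)
  also have "\<dots> = (\<Sum>i\<in>I. if i = k then L2_inner f (e i) else 0)"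
    using assms by (intro sum.cong) (auto simp: orthonormal_on_inner)
  finally show ?thesis using assms by simp
qed

lemma fourier_sum_residual_basis:
  assumes "orthonormal_on I e" "finite I" "k \<in> I" "f \<in> L2"
  shows "L2_inner (f - fourier_sum I e f) (e k) = 0"
  using assms by (simp add: L2_inner_diff_left fourier_sum_L2 orthonormal_on_L2 inner_fourier_sum_basis)

lemma fourier_sum_residual_span:
  assumes "orthonormal_on I e" "finite I" "f \<in> L2" "g \<in> span (e ` I)"
  shows "L2_inner (f - fourier_sum I e f) g = 0"
  using assms
  by (intro L2_inner_span_right[of g "e ` I"])
     (auto simp: fourier_sum_residual_basis fourier_sum_L2 orthonormal_on_L2)

text \<open>One residual is orthogonal to the span, so only the other has to be expanded.
  Orthogonality of residuals is thereby traded for an identity between Fourier coefficients.\<close>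

lemma inner_residuals:
  assumes "orthonormal_on I e" "finite I" "f \<in> L2" "g \<in> L2"
  shows "L2_inner (f - fourier_sum I e f) (g - fourier_sum I e g) =
    L2_inner f g - (\<Sum>i\<in>I. L2_inner f (e i) * L2_inner g (e i))"
proof -
  have "L2_inner (f - fourier_sum I e f) (g - fourier_sum I e g) = L2_inner (f - fourier_sum I e f) g"
    using assms by (simp add: L2_inner_diff_right fourier_sum_L2 fourier_sum_residual_span fourier_sum_span)
  also have "\<dots> = L2_inner f g - (\<Sum>i\<in>I. L2_inner f (e i) * L2_inner g (e i))"
    using assms
    by (simp add: L2_inner_diff_left fourier_sum_L2 L2_inner_commute[of "fourier_sum I e f"] inner_fourier_sum)
  finally show ?thesis .
qed

text \<open>The difference lies in the span and is orthogonal to it; continuity makes it zero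
  everywhere and not just almost everywhere.\<close>

lemma fourier_sum_eq:
  assumes "orthonormal_on I e" "finite I" "f \<in> span (e ` I)" "e ` I \<subseteq> CC"
  shows "fourier_sum I e f = f"
proof -
  have sp: "f - fourier_sum I e f \<in> span (e ` I)"
    using assms fourier_sum_span by (intro span_diff)
  then have "f - fourier_sum I e f \<in> CC"
    using span_subset_CC assms(4) by blast
  moreover have "f \<in> L2" using assms span_subset_CC CC_L2 by blast
  ultimately have "f - fourier_sum I e f = 0"
    using fourier_sum_residual_span[OF assms(1,2) _ sp] by (intro CC_inner_eq_0) auto
  then show ?thesis by simp
qed

lemma orthonormal_on_independent:
  assumes "orthonormal_on I e" "finite I"
  shows "independent (e ` I)" "inj_on e I"
proof -
  show inj: "inj_on e I"
  proof (rule inj_onI)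
    fix i j assume ij: "i \<in> I" "j \<in> I" "e i = e j"
    have "of_bool (i = j) = L2_inner (e i) (e i)"
      using ij orthonormal_on_inner[OF assms(1), of i j] by simp
    also have "\<dots> = 1"
      using ij orthonormal_on_inner[OF assms(1), of i i] by simp
    finally show "i = j" by (simp split: if_splits)
  qed
  show "independent (e ` I)"
    unfolding independent_explicit_finite_subsets
  proof (intro allI impI ballI)
    fix S u v assume S: "S \<subseteq> e ` I" "finite S" "(\<Sum>v\<in>S. u v *\<^sub>R v) = 0" "v \<in> S"
    obtain J where J: "J \<subseteq> I" "S = e ` J" using S by (meson subset_imageE)
    then obtain k where k: "k \<in> J" "v = e k" using S by auto
    have fin: "finite J" using assms J finite_subset by blast
    have "0 = L2_inner (\<Sum>v\<in>S. u v *\<^sub>R v) (e k)" using S by simp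
    also have "\<dots> = L2_inner (\<Sum>i\<in>J. u (e i) *\<^sub>R e i) (e k)"
      unfolding J using inj J by (subst sum.reindex) (auto intro: inj_on_subset)
    also have "\<dots> = (\<Sum>i\<in>J. u (e i) * L2_inner (e i) (e k))"
      using J k assms by (subst L2_inner_sum_left) (auto simp: subset_iff orthonormal_on_L2)
    also have "\<dots> = (\<Sum>i\<in>J. if i = k then u (e i) else 0)"
      using J k assms by (intro sum.cong) (auto simp: subset_iff orthonormal_on_inner)
    also have "\<dots> = u v" using k fin by simp
    finally show "u v = 0" by simp
  qed
qed

lemma shift_fourier_sum:
  "shift a (fourier_sum I e f) = (\<Sum>i\<in>I. L2_inner f (e i) *\<^sub>R shift a (e i))"
  unfolding fourier_sum_def by (simp add: shift_def fun_eq_iff sum_fun_apply)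

lemma L2_inner_disjoint:
  assumes "\<And>x. f x = 0 \<or> g x = 0"
  shows "L2_inner f g = 0"
proof -
  have "f x * g x = 0" for x using assms by simp
  then show ?thesis by (simp only: L2_inner_def) simp
qed

section \<open>Auxiliary facts: one-sided vanishing, projections, spans\<close>

text \<open>A nonzero derivative would make \<open>f\<close> differ from \<open>f a\<close> on both
  sides of \<open>a\<close>.\<close>

lemma deriv_zero_of_vanishing:
  fixes f :: "real \<Rightarrow> real"
  assumes "(f has_real_derivative D) (at a)" "(\<forall>x\<le>a. f x = 0) \<or> (\<forall>x\<ge>a. f x = 0)"
  shows "D = 0"
proof (rule ccontr)
  assume "D \<noteq> 0"
  then obtain d where d: "d > 0" "(\<forall>h>0. h < d \<longrightarrow> f (a - h) \<noteq> f a \<and> f (a + h) \<noteq> f a)"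
  proof (cases "D > 0")
    case True
    obtain d e where "d > 0" "\<forall>h>0. h < d \<longrightarrow> f (a - h) < f a" "e > 0" "\<forall>h>0. h < e \<longrightarrow> f a < f (a + h)"
      using DERIV_pos_inc_left[OF assms(1) True] DERIV_pos_inc_right[OF assms(1) True] by blast
    then show ?thesis by (intro that[of "min d e"]) auto
  next
    case False
    then have "D < 0" using \<open>D \<noteq> 0\<close> by simp
    then obtain d e where "d > 0" "\<forall>h>0. h < d \<longrightarrow> f (a - h) > f a" "e > 0" "\<forall>h>0. h < e \<longrightarrow> f a > f (a + h)"
      using DERIV_neg_dec_left[OF assms(1)] DERIV_neg_dec_right[OF assms(1)] by blast
    then show ?thesis by (intro that[of "min d e"]) auto
  qed
  then have "f (a - d/2) \<noteq> f a" "f (a + d/2) \<noteq> f a" by auto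
  then show False using assms(2) d(1) by auto
qed

lemma C1_splines_deriv:
  assumes "f \<in> C1_splines"
  obtains D where "(f has_real_derivative D) (at a)"
  using assms unfolding C1_splines_def C1_differentiable_on_def
  by (auto simp: has_real_derivative_iff_has_vector_derivative)

lemma restrict01_L2: "f \<in> L2 \<Longrightarrow> restrict01 f \<in> L2"
proof -
  assume f: "f \<in> L2"
  have meas: "restrict01 f \<in> borel_measurable lebesgue"
    unfolding restrict01_def using L2_measurable[OF f]
    by (intro borel_measurable_times borel_measurable_indicator) auto
  have "integrable lebesgue (\<lambda>x. (restrict01 f x)\<^sup>2)"
  proof (rule Bochner_Integration.integrable_bound)
    show "integrable lebesgue (\<lambda>x. (f x)\<^sup>2)" using f by (simp add: L2_def)
    show "(\<lambda>x. (restrict01 f x)\<^sup>2) \<in> borel_measurable lebesgue"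
      using meas by measurable
    show "AE x in lebesgue. norm ((restrict01 f x)\<^sup>2) \<le> norm ((f x)\<^sup>2)"
      by (auto simp: restrict01_def indicator_def)
  qed
  then show ?thesis using meas by (simp add: L2_def)
qed

text \<open>Induction in the manner of Gram-Schmidt: a new vector \<open>a\<close> enters through
  its part \<open>b\<close> orthogonal to the old span. \<open>G\<close> may be linearly dependent,
  since independence is not known beforehand for the families projected on later.\<close>

lemma projection_exists:
  assumes "finite G" "G \<subseteq> CC" "f \<in> CC"
  shows "\<exists>g\<in>span G. \<forall>h\<in>span G. L2_inner (f - g) h = 0"
proof -
  have "\<forall>f\<in>CC. \<exists>g\<in>span G. \<forall>h\<in>G. L2_inner (f - g) h = 0"
    using assms(1,2)
  proof (induction G rule: finite_induct)
    case (insert a G)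
    have sub: "span G \<subseteq> CC" "a \<in> CC" using insert.prems span_subset_CC by auto
    then obtain p where p: "p \<in> span G" "\<And>h. h \<in> G \<Longrightarrow> L2_inner (a - p) h = 0"
      using insert by (metis insert_subset)
    define b where "b = a - p"
    have b: "b \<in> CC" using sub p by (auto simp: b_def)
    have p_ins: "p \<in> span (insert a G)" and b_ins: "b \<in> span (insert a G)"
      using p span_mono[of G "insert a G"] by (auto simp: b_def intro!: span_diff intro: span_base)
    show ?case
    proof
      fix f assume f: "f \<in> CC"
      then obtain g where g: "g \<in> span G" "\<And>h. h \<in> G \<Longrightarrow> L2_inner (f - g) h = 0"
        using insert by (metis insert_subset)
      define c where "c = L2_inner (f - g) b / L2_inner b b"
      have L: "f \<in> L2" "g \<in> L2" "b \<in> L2" "p \<in> L2" using f g b p sub CC_L2 by auto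
      have fg: "L2_inner (f - (g + c *\<^sub>R b)) h = L2_inner (f - g) h - c * L2_inner b h" if "h \<in> L2" for h
        using L that by (simp add: L2_inner_diff_left L2_inner_add_left)
      have 1: "L2_inner (f - (g + c *\<^sub>R b)) h = 0" if "h \<in> G" for h
        using that g p insert.prems by (subst fg) (auto simp: b_def CC_L2 subset_iff)
      have 2: "L2_inner (f - (g + c *\<^sub>R b)) b = 0"
      proof (cases "L2_inner b b = 0")
        \<comment> \<open>Here \<open>a\<close> already lies in the span of \<open>G\<close>; the
          coefficient \<open>c\<close> is a division by 0, that is 0, and \<open>b\<close> vanishes
          anyway.\<close>
        case True
        then have "b = 0" using b by (rule CC_inner_eq_0[rotated])
        then show ?thesis by simp
      next
        case False
        then show ?thesis unfolding fg[OF L(3)] by (simp add: c_def)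
      qed
      have 3: "L2_inner (f - (g + c *\<^sub>R b)) p = 0"
        using 1 p L insert.prems
        by (intro L2_inner_span_right[of p G]) (auto simp: CC_L2 subset_iff)
      have "L2_inner (f - (g + c *\<^sub>R b)) (b + p) = 0"
        using 2 3 L by (simp add: L2_inner_add_right)
      then have "L2_inner (f - (g + c *\<^sub>R b)) a = 0" by (simp add: b_def)
      moreover have "g + c *\<^sub>R b \<in> span (insert a G)"
        using g span_mono[of G "insert a G"] b_ins by (intro span_add span_scale) auto
      ultimately show "\<exists>g\<in>span (insert a G). \<forall>h\<in>insert a G. L2_inner (f - g) h = 0"
        using 1 by blast
    qed
  qed (auto intro: span_zero)
  then obtain g where g: "g \<in> span G" "\<And>h. h \<in> G \<Longrightarrow> L2_inner (f - g) h = 0"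
    using assms(3) by blast
  have "g \<in> CC" using g span_subset_CC[OF assms(2)] by blast
  then have "f - g \<in> L2" using assms(3) by (intro L2_diff CC_L2)
  then have "\<forall>h\<in>span G. L2_inner (f - g) h = 0"
    using g(2) subset_trans[OF assms(2) CC_subset_L2] by (metis L2_inner_span_right)
  then show ?thesis using g by blast
qed

lemma span_eqI: "(\<And>x. x \<in> A \<Longrightarrow> x \<in> span B) \<Longrightarrow> (\<And>x. x \<in> B \<Longrightarrow> x \<in> span A) \<Longrightarrow> span A = span B"
  by (meson span_minimal subset_antisym subset_iff subspace_span)

lemma span_scaled_image:
  assumes "c \<noteq> 0"
  shows "span ((\<lambda>i. c *\<^sub>R F i) ` I) = span (F ` I)"
proof (rule span_eqI)
  fix x assume "x \<in> F ` I"
  then obtain i where i: "i \<in> I" "x = F i" by auto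
  then have "inverse c *\<^sub>R (c *\<^sub>R F i) \<in> span ((\<lambda>i. c *\<^sub>R F i) ` I)"
    by (intro span_scale span_base) auto
  then show "x \<in> span ((\<lambda>i. c *\<^sub>R F i) ` I)" using i assms by simp
qed (auto intro: span_scale span_base)

section \<open>Index arithmetic of dilates and translates\<close>

lemma dilates_eq:
  assumes "l \<in> {1..6}"
  shows "dilates r g j (6 * k + int l) = dil j (shift (- real_of_int (if l \<le> r then k else k + 1)) (g l))"
  unfolding dilates_index[OF assms] dil_def shift_def by (auto simp: fun_eq_iff)

lemma index_cases:
  obtains k l where "m = 6 * k + int l" "l \<in> {1..6}"
proof
  show "m = 6 * ((m - 1) div 6) + int (nat ((m - 1) mod 6) + 1)"
    using div_mult_mod_eq[of "m - 1" 6] by simp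
  show "nat ((m - 1) mod 6) + 1 \<in> {1..6}"
    using pos_mod_bound[of 6 "m - 1"] by auto
qed

lemma dilates_dil: "dil i (dilates r g j m) = dilates r g (i + j) m"
  by (rule index_cases[of m]) (simp add: dilates_eq dil_dil)

text \<open>Translation by \<open>n\<close> is translation by 2^j n in the dilated variable, and
  each unit there moves the index by 6. For \<open>j\<close> nonnegative 2^j n is an
  integer.\<close>

lemma dilates_T:
  assumes "0 \<le> j"
  shows "shift (- real_of_int n) (dilates r g j m) = dilates r g j (m + 6 * 2 ^ nat j * n)"
proof -
  obtain k l where m: "m = 6 * k + int l" "l \<in> {1..6}" by (rule index_cases)
  have e: "m + 6 * 2 ^ nat j * n = 6 * (k + 2 ^ nat j * n) + int l"
    by (simp add: m algebra_simps)
  have p: "2 powi j = (2 :: real) ^ nat j"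
    using assms by (simp add: power_int_def)
  have i: "(if l \<le> r then k + 2 ^ nat j * n else k + 2 ^ nat j * n + 1) = (if l \<le> r then k else k + 1) + 2 ^ nat j * n"
    by simp
  have "- real_of_int n + - real_of_int a / 2 powi j = - real_of_int (a + 2 ^ nat j * n) / 2 powi j" for a
    unfolding p by (simp add: field_simps)
  then show ?thesis
    unfolding e dilates_eq[OF m(2)] unfolding m(1) dilates_eq[OF m(2)] dil_shift i shift_shift by simp
qed

lemma supp_bounded_diameter:
  assumes "\<And>x. r < \<bar>x - c\<bar> \<Longrightarrow> f x = 0" "0 \<le> r"
  shows "bounded (supp f) \<and> diameter (supp f) \<le> 2 * r"
proof -
  have "{x. f x \<noteq> 0} \<subseteq> cball c r"
    using assms(1) by (force simp: dist_real_def abs_minus_commute not_less[symmetric])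
  then have s: "supp f \<subseteq> cball c r"
    unfolding supp_def by (intro closure_minimal) auto
  then have "diameter (supp f) \<le> diameter (cball c r)"
    by (intro diameter_subset) auto
  then show ?thesis using s assms(2) bounded_subset[OF bounded_cball s] by simp
qed

section \<open>Scaling functions\<close>

locale scaling_system =
  fixes \<phi> :: "nat \<Rightarrow> real \<Rightarrow> real"
  assumes gen: "scaling_generators \<phi>"
begin

text \<open>Translation to the right, opposite in sign to \<open>shift\<close>, so that indices grow
  with \<open>n\<close>.\<close>

abbreviation T :: "int \<Rightarrow> (real \<Rightarrow> real) \<Rightarrow> real \<Rightarrow> real" where
  "T n \<equiv> shift (- real_of_int n)"

section \<open>The generators \<phi>_1, ..., \<phi>_4 and the space W\<close>

text \<open>About the point 1/2 the first function is even and the second is odd.\<close>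

lemma \<xi>_inner_12_13: "L2_inner (\<xi> 1 2) (\<xi> 1 3) = 0"
proof -
  let ?h = "\<lambda>x. \<xi> 1 2 x * \<xi> 1 3 x"
  have [simp]: "(3::int) div 2 = 1" "(3::int) mod 2 = 1" by simp_all
  have "?h (1 - x) = - ?h x" for x
    using hermite_reflect[of "2 * x - 1"] by (simp add: \<xi>_def numeral_2_eq_2[symmetric] algebra_simps)
  then have "(LINT x|lebesgue. ?h x) = - (LINT x|lebesgue. ?h x)"
    using lebesgue_integral_real_affine[of "-1" ?h 1] by simp
  then show ?thesis by (simp add: L2_inner_def)
qed

lemma \<xi>_norm_nonzero: "L2_norm (\<xi> 1 2) \<noteq> 0" "L2_norm (\<xi> 1 3) \<noteq> 0"
proof -
  have [simp]: "(3::int) div 2 = 1" "(3::int) mod 2 = 1" by simp_all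
  have "\<xi> 1 2 (1/2) \<noteq> 0" by (simp add: \<xi>_def)
  then show "L2_norm (\<xi> 1 2) \<noteq> 0" using CC_norm_eq_0[OF \<xi>_CC, of 1 2] by auto
  have "\<xi> 1 3 (3/4) \<noteq> 0" by (simp add: \<xi>_def hermite_def)
  then show "L2_norm (\<xi> 1 3) \<noteq> 0" using CC_norm_eq_0[OF \<xi>_CC, of 1 3] by auto
qed

lemma \<phi>_12: "\<phi> (Suc 0) = L2_normalize (\<xi> 1 2)" "\<phi> 2 = L2_normalize (\<xi> 1 3)"
  using gen by (auto simp: scaling_generators_def)

lemma \<A>\<^sub>0_span: "\<A>\<^sub>0 = span {\<phi> 1, \<phi> 2}"
proof
  have "\<xi> 1 2 \<in> span {\<phi> 1}" "\<xi> 1 3 \<in> span {\<phi> 2}"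
    using span_normalize \<xi>_norm_nonzero by (auto simp: \<phi>_12)
  then have "\<xi> 1 2 \<in> span {\<phi> 1, \<phi> 2}" "\<xi> 1 3 \<in> span {\<phi> 1, \<phi> 2}"
    using span_mono[of "{\<phi> 1}" "{\<phi> 1, \<phi> 2}"] span_mono[of "{\<phi> 2}" "{\<phi> 1, \<phi> 2}"] by auto
  then show "\<A>\<^sub>0 \<subseteq> span {\<phi> 1, \<phi> 2}"
    unfolding \<A>\<^sub>0_def by (intro span_minimal) auto
  have "\<phi> (Suc 0) \<in> \<A>\<^sub>0" "\<phi> 2 \<in> \<A>\<^sub>0"
    unfolding \<phi>_12 L2_normalize_def \<A>\<^sub>0_def by (auto intro: span_scale span_base)
  then show "span {\<phi> 1, \<phi> 2} \<subseteq> \<A>\<^sub>0"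
    unfolding \<A>\<^sub>0_def by (intro span_minimal) auto
qed

lemma \<A>\<^sub>1_CC: "\<A>\<^sub>1 \<subseteq> CC"
  unfolding \<A>\<^sub>1_def by (intro span_subset_CC) auto

lemma \<A>\<^sub>1_C1_splines: "\<A>\<^sub>1 \<subseteq> C1_splines"
  unfolding \<A>\<^sub>1_def by (intro span_minimal subspace_C1_splines) auto

lemma \<A>\<^sub>1_eq_0:
  assumes "f \<in> \<A>\<^sub>1" "x \<le> 0 \<or> 1 \<le> x"
  shows "f x = 0"
proof -
  have "\<A>\<^sub>1 \<subseteq> {f. f x = 0}"
    unfolding \<A>\<^sub>1_def
  proof (rule span_minimal)
    show "\<xi> 2 ` {2..7} \<subseteq> {f. f x = 0}"
    proof clarify
      fix m :: int assume "m \<in> {2..7}"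
      then have "1 \<le> m div 2" "m div 2 \<le> 3" by auto
      then have "1 \<le> real_of_int (m div 2)" "real_of_int (m div 2) \<le> 3" by linarith+
      then show "\<xi> 2 m x = 0"
        using assms(2) by (intro \<xi>_eq_0) (auto simp: power_int_def)
    qed
  qed (auto intro: subspaceI)
  then show ?thesis using assms by auto
qed

lemma \<A>\<^sub>0_subset_\<A>\<^sub>1: "\<A>\<^sub>0 \<subseteq> \<A>\<^sub>1"
proof -
  have "\<xi> 1 2 \<in> \<A>\<^sub>1" "\<xi> 1 3 \<in> \<A>\<^sub>1"
    using \<xi>_refine[of 1 2] \<xi>_refine[of 1 3] by (auto simp: \<A>\<^sub>1_def)
  then show ?thesis
    unfolding \<A>\<^sub>0_def \<A>\<^sub>1_def by (intro span_minimal) auto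
qed

text \<open>Names the space whose existence \<open>scaling_generators\<close> asserts; its spanning
  condition determines it.\<close>

definition W :: "(real \<Rightarrow> real) set" where "W = span {\<phi> 3, \<phi> 4}"

lemma W_props:
  shows "W \<subseteq> \<A>\<^sub>1 \<ominus> \<A>\<^sub>0"
    and "\<forall>i\<in>{3, 4}. \<forall>j\<in>{3, 4}. L2_inner (\<phi> i) (\<phi> j) = of_bool (i = j)"
    and "\<And>u v. u \<in> \<C>\<^sub>0 \<Longrightarrow> v \<in> \<C>\<^sub>1 \<Longrightarrow> L2_inner (u - ortho_proj W u) (v - ortho_proj W v) = 0"
  using gen by (auto simp: scaling_generators_def orthonormal_basis_of_def W_def)

lemma \<phi>_\<A>\<^sub>1: "l \<in> {1..4} \<Longrightarrow> \<phi> l \<in> \<A>\<^sub>1"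
proof -
  assume "l \<in> {1..4}"
  then consider "l = 1" | "l = 2" | "l \<in> {3, 4}" by fastforce
  then show ?thesis
  proof cases
    case 3
    then have "\<phi> l \<in> W" unfolding W_def by (auto intro: span_base)
    then show ?thesis using W_props(1) by (auto simp: ortho_in_def)
  qed (use \<A>\<^sub>0_subset_\<A>\<^sub>1 in \<open>auto simp: \<A>\<^sub>0_span intro: span_base\<close>)
qed

lemma \<phi>_CC_14: "l \<in> {1..4} \<Longrightarrow> \<phi> l \<in> CC"
  using \<phi>_\<A>\<^sub>1 \<A>\<^sub>1_CC by blast

lemma \<phi>_eq_0_14: "l \<in> {1..4} \<Longrightarrow> x \<le> 0 \<or> 1 \<le> x \<Longrightarrow> \<phi> l x = 0"
  using \<A>\<^sub>1_eq_0 \<phi>_\<A>\<^sub>1 by blast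

lemma orthonormal_14: "orthonormal_on {1..4} \<phi>"
proof -
  have s: "{1..4::nat} = {1, 2, 3, 4}" by auto
  have 0: "L2_inner (\<phi> i) (\<phi> j) = 0" if "i \<in> {3, 4}" "j \<in> {1, 2}" for i j
  proof -
    have "\<phi> i \<in> W" "\<phi> j \<in> \<A>\<^sub>0" using that by (auto simp: W_def \<A>\<^sub>0_span intro: span_base)
    then show ?thesis using W_props(1) by (auto simp: ortho_in_def)
  qed
  have 1: "L2_inner (\<phi> i) (\<phi> j) = of_bool (i = j)" if "i \<in> {1, 2}" "j \<in> {1, 2}" for i j
    using that L2_normalize_inner_self[OF \<xi>_norm_nonzero(1)] L2_normalize_inner_self[OF \<xi>_norm_nonzero(2)]
      \<xi>_inner_12_13 L2_inner_commute[of "\<xi> 1 3" "\<xi> 1 2"]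
    by (auto simp: \<phi>_12) (auto simp: L2_normalize_def)
  have "L2_inner (\<phi> i) (\<phi> j) = of_bool (i = j)" if "i \<in> {1..4}" "j \<in> {1..4}" for i j
  proof -
    have "i \<in> {1, 2} \<or> i \<in> {3, 4}" "j \<in> {1, 2} \<or> j \<in> {3, 4}"
      using that unfolding s by auto
    then consider "i \<in> {1, 2}" "j \<in> {1, 2}" | "i \<in> {1, 2}" "j \<in> {3, 4}" | "i \<in> {3, 4}" "j \<in> {1, 2}" | "i \<in> {3, 4}" "j \<in> {3, 4}"
      by blast
    then show ?thesis
    proof cases
      case 2
      then show ?thesis using 0[of j i] L2_inner_commute[of "\<phi> i"] by auto
    qed (use 0 1 W_props(2) in auto)
  qed
  then show ?thesis
    unfolding orthonormal_on_def using \<phi>_CC_14 CC_L2 by blast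
qed

lemma orthonormal_34: "orthonormal_on {3, 4} \<phi>" and orthonormal_12: "orthonormal_on {1, 2} \<phi>"
  using orthonormal_14 by (auto simp: orthonormal_on_def)

text \<open>The description has a unique solution: two candidates differ by an element of
  \<open>W\<close> orthogonal to \<open>W\<close>, which is continuous and hence zero.\<close>

lemma ortho_proj_W:
  assumes "f \<in> L2"
  shows "ortho_proj W f = fourier_sum {3, 4} \<phi> f"
  unfolding ortho_proj_def
proof (rule the_equality)
  have W: "W = span (\<phi> ` {3, 4})" by (simp add: W_def)
  show *: "fourier_sum {3, 4} \<phi> f \<in> W \<and> (\<forall>w\<in>W. L2_inner (f - fourier_sum {3, 4} \<phi> f) w = 0)"
    unfolding W using assms by (intro conjI ballI fourier_sum_span fourier_sum_residual_span orthonormal_34) auto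
  fix g assume g: "g \<in> W \<and> (\<forall>w\<in>W. L2_inner (f - g) w = 0)"
  let ?h = "fourier_sum {3, 4} \<phi> f"
  have WCC: "W \<subseteq> CC" using W_props(1) \<A>\<^sub>1_CC by (auto simp: ortho_in_def)
  have hg: "?h - g \<in> W" using g * by (auto simp: W_def intro: span_diff)
  then have 0: "L2_inner (f - g) (?h - g) = 0" "L2_inner (f - ?h) (?h - g) = 0" using g * by auto
  have L: "g \<in> L2" "?h \<in> L2" using g * WCC CC_L2 by auto
  have "L2_inner ((f - g) - (f - ?h)) (?h - g) = 0"
    using 0 L assms by (subst L2_inner_diff_left) auto
  moreover have "(f - g) - (f - ?h) = ?h - g" by simp
  ultimately have "?h - g = 0" using hg WCC by (intro CC_inner_eq_0) auto
  then show "g = ?h" by simp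
qed

text \<open>This is the defining property of \<open>W\<close>, stripped of the projections.\<close>

lemma key_orthogonality:
  assumes a: "a \<in> {0, 1}" and b: "b \<in> {0, 1}"
  shows "(\<Sum>j=1..4. L2_inner (\<xi> 1 a) (\<phi> j) * L2_inner (\<xi> 1 b) (shift 1 (\<phi> j))) = 0"
proof -
  define u where "u = restrict01 (\<xi> 1 a)"
  \<comment> \<open>\<open>\<xi> 1 (4 + b)\<close> is the translate of \<open>\<xi> 1 b\<close> by
    1, so its coefficients against \<open>\<phi> j\<close> are those of \<open>\<xi> 1 b\<close>
    against \<open>shift 1 (\<phi> j)\<close>.\<close>
  define v where "v = restrict01 (\<xi> 1 (4 + b))"
  have L: "u \<in> L2" "v \<in> L2" by (simp_all add: u_def v_def restrict01_L2 CC_L2)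
  have s: "{1..4::nat} = {1, 2} \<union> {3, 4}" by auto
  have sum4: "fourier_sum {1..4} \<phi> f = fourier_sum {1, 2} \<phi> f + fourier_sum {3, 4} \<phi> f" for f
    unfolding fourier_sum_def s by (subst sum.union_disjoint) auto
  have F12_\<A>\<^sub>0: "fourier_sum {1, 2} \<phi> f \<in> \<A>\<^sub>0" for f
    using fourier_sum_span[of "{1, 2}" \<phi> f] by (simp add: \<A>\<^sub>0_span)
  have F12_L2: "fourier_sum {1, 2} \<phi> f \<in> L2" for f
    by (rule fourier_sum_L2[OF orthonormal_12])
  have ort: "L2_inner (f - fourier_sum {1, 2} \<phi> f) g = 0" if "f \<in> L2" "g \<in> \<A>\<^sub>0" for f g
    using that by (intro fourier_sum_residual_span orthonormal_12) (auto simp: \<A>\<^sub>0_span)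
  \<comment> \<open>Passing to \<open>\<C>\<^sub>0\<close> or \<open>\<C>\<^sub>1\<close> removes
    the components along \<phi>_1, \<phi>_2, and the complement of \<open>W\<close> those along
    \<phi>_3, \<phi>_4.\<close>
  have proj: "f - fourier_sum {1, 2} \<phi> f - ortho_proj W (f - fourier_sum {1, 2} \<phi> f) = f - fourier_sum {1..4} \<phi> f"
    if "f \<in> L2" for f
  proof -
    have "L2_inner (f - fourier_sum {1, 2} \<phi> f) (\<phi> i) = L2_inner f (\<phi> i)" if i: "i \<in> {3, 4}" for i
    proof -
      have "\<phi> i \<in> W" using i by (auto simp: W_def intro: span_base)
      then have "L2_inner (\<phi> i) (fourier_sum {1, 2} \<phi> f) = 0"
        using W_props(1) F12_\<A>\<^sub>0 by (auto simp: ortho_in_def)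
      then show ?thesis
        using \<open>f \<in> L2\<close> F12_L2 orthonormal_on_L2[OF orthonormal_34 i]
        by (simp add: L2_inner_diff_left L2_inner_commute[of "fourier_sum {1, 2} \<phi> f"] del: One_nat_def)
    qed
    then have "fourier_sum {3, 4} \<phi> (f - fourier_sum {1, 2} \<phi> f) = fourier_sum {3, 4} \<phi> f"
      unfolding fourier_sum_def[of "{3, 4}"] by (intro sum.cong) auto
    then show ?thesis
      unfolding ortho_proj_W[OF L2_diff[OF that F12_L2]] sum4 by simp
  qed
  have "u - fourier_sum {1, 2} \<phi> u \<in> \<C>\<^sub>0"
  proof -
    have "u \<in> \<B>\<^sub>0" using a unfolding \<B>\<^sub>0_def u_def by (intro span_base) auto
    moreover have "fourier_sum {1, 2} \<phi> u \<in> \<B>\<^sub>0" using F12_\<A>\<^sub>0 unfolding \<B>\<^sub>0_def by (intro span_base) auto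
    ultimately show ?thesis
      using L ort unfolding \<C>\<^sub>0_def ortho_in_def by (auto simp: \<B>\<^sub>0_def intro: span_diff)
  qed
  moreover have "v - fourier_sum {1, 2} \<phi> v \<in> \<C>\<^sub>1"
  proof -
    have "v \<in> \<B>\<^sub>1" using b unfolding \<B>\<^sub>1_def v_def by (intro span_base) auto
    moreover have "fourier_sum {1, 2} \<phi> v \<in> \<B>\<^sub>1" using F12_\<A>\<^sub>0 unfolding \<B>\<^sub>1_def by (intro span_base) auto
    ultimately show ?thesis
      using L ort unfolding \<C>\<^sub>1_def ortho_in_def by (auto simp: \<B>\<^sub>1_def intro: span_diff)
  qed
  ultimately have "L2_inner (u - fourier_sum {1..4} \<phi> u) (v - fourier_sum {1..4} \<phi> v) = 0"
    using W_props(3)[of "u - fourier_sum {1, 2} \<phi> u" "v - fourier_sum {1, 2} \<phi> v"]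
    unfolding proj[OF L(1)] proj[OF L(2)] by blast
  then have "L2_inner u v = (\<Sum>i=1..4. L2_inner u (\<phi> i) * L2_inner v (\<phi> i))"
    using inner_residuals[OF orthonormal_14 _ L] by simp
  \<comment> \<open>\<open>u\<close> lives on [0, 1/2] and \<open>v\<close> on [1/2, 1].\<close>
  moreover have "L2_inner u v = 0"
  proof (rule L2_inner_disjoint)
    fix x
    have "a div 2 = 0" "(4 + b) div 2 = 2" using a b by auto
    then have "\<xi> 1 a x = 0 \<or> \<xi> 1 (4 + b) x = 0"
      using \<xi>_eq_0[of 1 x a] \<xi>_eq_0[of 1 x "4 + b"] by (cases "x \<le> 1/2") auto
    then show "u x = 0 \<or> v x = 0" by (auto simp: u_def v_def restrict01_def)
  qed
  moreover have "L2_inner (restrict01 f) (\<phi> j) = L2_inner f (\<phi> j)" if "j \<in> {1..4}" for f j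
  proof -
    have "restrict01 f x * \<phi> j x = f x * \<phi> j x" for x
      using \<phi>_eq_0_14[OF that, of x]
      by (cases "x \<le> 0 \<or> 1 \<le> x") (auto simp: restrict01_def indicator_def)
    then show ?thesis by (simp only: L2_inner_def)
  qed
  moreover have "L2_inner (\<xi> 1 (4 + b)) (\<phi> j) = L2_inner (\<xi> 1 b) (shift 1 (\<phi> j))" for j
    using \<xi>_1_shift[of "-1" b] L2_inner_shift_right[of "\<xi> 1 b" 1 "\<phi> j"] by (simp add: add.commute)
  ultimately show ?thesis by (simp add: u_def v_def)
qed

section \<open>Residuals of \<xi>_{1,0}, \<xi>_{1,1} and the generators \<phi>_5, \<phi>_6\<close>

text \<open>For \<open>a = 0\<close> this is g_5; for \<open>a = 1\<close> it is g_6 before the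
  components along \<phi>_5 and its translate are removed.\<close>

definition hermite_residual :: "int \<Rightarrow> real \<Rightarrow> real" where
  "hermite_residual a = remove_components 4 \<phi> (\<xi> 1 a)"

lemma inner_T: "L2_inner (T m f) (T n g) = L2_inner (T (m - n) f) g"
  using L2_inner_shift_right[of "T m f" "- real_of_int n" g] by simp

lemma inner_T_right: "L2_inner f (T n g) = L2_inner (T (- n) f) g"
  using L2_inner_shift_right[of f "- real_of_int n" g] by simp

lemma inner_T_left: "L2_inner (T n f) g = L2_inner f (T (- n) g)"
  using L2_inner_shift_right[of f "real_of_int n" g] by simp

lemma hermite_residual_eq: "hermite_residual a = \<xi> 1 a - fourier_sum {1..4} \<phi> (\<xi> 1 a) - fourier_sum {1..4} (\<lambda>j. T (-1) (\<phi> j)) (\<xi> 1 a)"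
  by (simp add: hermite_residual_def remove_components_def fourier_sum_def)

lemma inner_T\<phi>_14:
  assumes "i \<in> {1..4}" "j \<in> {1..4}"
  shows "L2_inner (T m (\<phi> i)) (T n (\<phi> j)) = of_bool (m = n \<and> i = j)"
proof (cases "m = n")
  case True
  then show ?thesis using orthonormal_on_inner[OF orthonormal_14 assms] by (simp add: inner_T)
next
  case False
  have "L2_inner (T m (\<phi> i)) (T n (\<phi> j)) = 0"
  proof (rule L2_inner_disjoint, rule ccontr)
    fix x assume "\<not> (T m (\<phi> i) x = 0 \<or> T n (\<phi> j) x = 0)"
    then have "0 < x - m" "x - m < 1" "0 < x - n" "x - n < 1"
      using \<phi>_eq_0_14[OF assms(1), of "x - m"] \<phi>_eq_0_14[OF assms(2), of "x - n"]
      by (auto simp: shift_def not_le[symmetric])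
    then show False using False by linarith
  qed
  then show ?thesis using False by simp
qed

lemma orthonormal_T_14: "orthonormal_on {1..4} (\<lambda>j. T n (\<phi> j))"
  unfolding orthonormal_on_def using inner_T\<phi>_14[of _ _ n n] \<phi>_CC_14 by (auto simp: CC_L2)

lemma \<xi>_T\<phi>_0:
  assumes "a \<in> {0, 1}" "j \<in> {1..4}" "n \<noteq> 0" "n \<noteq> -1"
  shows "L2_inner (\<xi> 1 a) (T n (\<phi> j)) = 0"
proof (rule L2_inner_disjoint, rule ccontr)
  fix x assume *: "\<not> (\<xi> 1 a x = 0 \<or> T n (\<phi> j) x = 0)"
  have "a div 2 = 0" using assms by auto
  then have "\<bar>2 * x\<bar> < 1" using * \<xi>_eq_0[of 1 x a] by (auto simp: not_le[symmetric])
  moreover have "0 < x - n" "x - n < 1"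
    using * \<phi>_eq_0_14[OF assms(2), of "x - n"] by (auto simp: shift_def not_le[symmetric])
  ultimately show False using assms(3,4) by linarith
qed

lemma fourier_CC: "(\<And>i. i \<in> I \<Longrightarrow> e i \<in> CC) \<Longrightarrow> fourier_sum I e f \<in> CC"
  unfolding fourier_sum_def by (intro CC_sum CC_scale)

lemma hermite_residual_CC: "hermite_residual a \<in> CC"
  unfolding hermite_residual_eq using \<phi>_CC_14 by (intro CC_diff fourier_CC) auto

text \<open>\<open>\<xi> 1 a\<close> lives on [-1/2, 1/2] and meets only the translates with
  \<open>n\<close> equal to 0 or -1. Both of these families were removed, and they are orthogonal to
  each other.\<close>

lemma hermite_residual_T\<phi>:
  assumes a: "a \<in> {0, 1}" and j: "j \<in> {1..4}"
  shows "L2_inner (hermite_residual a) (T n (\<phi> j)) = 0"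
proof -
  have F: "L2_inner (fourier_sum {1..4} (\<lambda>j. T m (\<phi> j)) (\<xi> 1 a)) (T n (\<phi> j)) =
    (if m = n then L2_inner (\<xi> 1 a) (T n (\<phi> j)) else 0)" for m
  proof (cases "m = n")
    case True
    then show ?thesis using inner_fourier_sum_basis[OF orthonormal_T_14 _ j, of n] by simp
  next
    case False
    have "L2_inner (T n (\<phi> j)) (fourier_sum {1..4} (\<lambda>j. T m (\<phi> j)) (\<xi> 1 a)) = 0"
      using False j \<phi>_CC_14 by (subst inner_fourier_sum[OF orthonormal_T_14]) (auto simp: CC_L2 inner_T\<phi>_14 simp del: of_nat_numeral intro!: sum.neutral)
    then show ?thesis using False by (simp add: L2_inner_commute)
  qed
  have L: "fourier_sum {1..4} (\<lambda>j. T m (\<phi> j)) (\<xi> 1 a) \<in> L2" for m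
    by (rule fourier_sum_L2[OF orthonormal_T_14])
  have e: "hermite_residual a = \<xi> 1 a - fourier_sum {1..4} (\<lambda>j. T 0 (\<phi> j)) (\<xi> 1 a) - fourier_sum {1..4} (\<lambda>j. T (-1) (\<phi> j)) (\<xi> 1 a)"
    by (simp add: hermite_residual_eq)
  have "L2_inner (hermite_residual a) (T n (\<phi> j)) = L2_inner (\<xi> 1 a) (T n (\<phi> j))
      - (if 0 = n then L2_inner (\<xi> 1 a) (T n (\<phi> j)) else 0)
      - (if -1 = n then L2_inner (\<xi> 1 a) (T n (\<phi> j)) else 0)"
    unfolding e using L[of 0] L[of "-1"] \<phi>_CC_14[OF j] F[of 0] F[of "-1"]
    by (simp only: L2_inner_diff_left L2_diff CC_L2 \<xi>_CC shift_CC)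
  also have "\<dots> = 0" using \<xi>_T\<phi>_0[OF a j, of n] by auto
  finally show ?thesis .
qed

text \<open>Expanding one residual at a time leaves the coefficient sums of
  \<open>key_orthogonality\<close>: the part removed on [0,1] matters only for the translate by 1,
  the part on [-1,0] only for the translate by -1. All else vanishes by supports.\<close>

lemma hermite_residual_T_hermite_residual:
  assumes a: "a \<in> {0, 1}" and b: "b \<in> {0, 1}" and n: "n \<noteq> 0"
  shows "L2_inner (hermite_residual a) (T n (hermite_residual b)) = 0"
proof -
  have perp: "L2_inner (hermite_residual a) (T m (fourier_sum {1..4} (\<lambda>j. T k (\<phi> j)) f)) = 0" for m k f
  proof -
    have "L2_inner (hermite_residual a) (T (m + k) (\<phi> j)) = 0" if "j \<in> {1..4}" for j
      using hermite_residual_T\<phi>[OF a that] by blast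
    then show ?thesis
      unfolding shift_fourier_sum using \<phi>_CC_14 hermite_residual_CC
      by (subst L2_inner_sum_right) (auto simp: CC_L2 add.commute)
  qed
  have L: "T m (fourier_sum {1..4} (\<lambda>j. T k (\<phi> j)) f) \<in> L2" for m k f
    using \<phi>_CC_14 by (intro CC_L2 shift_CC fourier_CC) auto
  have Tdiff: "T n (f - g) = T n f - T n g" for f g
    using linear_diff[OF shift_linear] .
  have "L2_inner (hermite_residual a) (T n (hermite_residual b)) = L2_inner (hermite_residual a) (T n (\<xi> 1 b))"
    unfolding hermite_residual_eq[of b] Tdiff
    using perp[of n 0] perp[of n "-1"] L[of n 0] L[of n "-1"] hermite_residual_CC
    by (simp add: L2_inner_diff_right CC_L2)
  also have "\<dots> = L2_inner (\<xi> 1 a) (T n (\<xi> 1 b))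
      - L2_inner (fourier_sum {1..4} \<phi> (\<xi> 1 a)) (T n (\<xi> 1 b))
      - L2_inner (fourier_sum {1..4} (\<lambda>j. T (-1) (\<phi> j)) (\<xi> 1 a)) (T n (\<xi> 1 b))"
    unfolding hermite_residual_eq[of a] using L[of 0 0] L[of 0 "-1"] by (simp add: L2_inner_diff_left CC_L2)
  also have "L2_inner (\<xi> 1 a) (T n (\<xi> 1 b)) = 0"
  proof -
    have "T n (\<xi> 1 b) = \<xi> 1 (b + 4 * n)"
      using \<xi>_1_shift[of "- n" b] by simp
    moreover have "2 \<le> \<bar>a div 2 - (b + 4 * n) div 2\<bar>"
      using a b n by auto
    ultimately show ?thesis by (simp add: \<xi>_orthogonal)
  qed
  also have "L2_inner (fourier_sum {1..4} \<phi> (\<xi> 1 a)) (T n (\<xi> 1 b)) = 0"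
  proof -
    have "L2_inner (fourier_sum {1..4} \<phi> (\<xi> 1 a)) (T n (\<xi> 1 b)) =
        (\<Sum>j=1..4. L2_inner (\<xi> 1 a) (\<phi> j) * L2_inner (\<xi> 1 b) (T (- n) (\<phi> j)))"
      by (subst L2_inner_commute, subst inner_fourier_sum[OF orthonormal_14])
         (simp_all only: CC_L2 shift_CC \<xi>_CC inner_T_left[of n])
    also have "\<dots> = 0"
    proof (cases "n = 1")
      case True
      then show ?thesis using key_orthogonality[OF a b] by simp
    next
      case False
      then show ?thesis using n b by (intro sum.neutral ballI) (subst \<xi>_T\<phi>_0, auto)
    qed
    finally show ?thesis .
  qed
  also have "L2_inner (fourier_sum {1..4} (\<lambda>j. T (-1) (\<phi> j)) (\<xi> 1 a)) (T n (\<xi> 1 b)) = 0"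
  proof -
    have "L2_inner (fourier_sum {1..4} (\<lambda>j. T (-1) (\<phi> j)) (\<xi> 1 a)) (T n (\<xi> 1 b)) =
        (\<Sum>j=1..4. L2_inner (\<xi> 1 a) (T (-1) (\<phi> j)) * L2_inner (\<xi> 1 b) (T (- n - 1) (\<phi> j)))"
      by (subst L2_inner_commute, subst inner_fourier_sum[OF orthonormal_T_14])
         (simp_all add: CC_L2 inner_T_left[of n "\<xi> 1 b"] add.commute)
    also have "\<dots> = 0"
    proof (cases "n = -1")
      case True
      \<comment> \<open>On the left the two residuals change roles, hence the exchange of
        \<open>a\<close> and \<open>b\<close>.\<close>
      then show ?thesis using key_orthogonality[OF b a] by (simp add: mult.commute)
    next
      case False
      then show ?thesis using n b by (intro sum.neutral ballI) (subst \<xi>_T\<phi>_0, auto)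
    qed
    finally show ?thesis .
  qed
  finally show ?thesis by simp
qed

lemma hermite_residual_at_0: "a \<in> {0, 1} \<Longrightarrow> hermite_residual a 0 = \<xi> 1 a 0"
  unfolding hermite_residual_eq fourier_sum_def
  by (simp add: sum_fun_apply shift_def \<phi>_eq_0_14 sum.neutral)

lemma \<xi>_at_0: "\<xi> 1 0 0 \<noteq> 0" "\<xi> 1 1 0 = 0"
  by (simp_all add: \<xi>_def numeral_2_eq_2[symmetric])

lemma hermite_residual_0_nonzero: "L2_norm (hermite_residual 0) \<noteq> 0"
  using CC_norm_eq_0[OF hermite_residual_CC, of 0] hermite_residual_at_0[of 0] \<xi>_at_0 by auto

text \<open>Otherwise \<open>\<xi> 1 1\<close> would be the sum of a C^1 function vanishing for x
  \<le> 0 and one vanishing for x \<ge> 0. Both have slope 0 at the origin, whereas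
  \<open>\<xi> 1 1\<close> has slope 2 sqrt 2 there; its value 0 would give no
  contradiction.\<close>

lemma hermite_residual_1_nonzero: "hermite_residual 1 \<noteq> 0"
proof
  assume 0: "hermite_residual 1 = 0"
  have e: "\<xi> 1 1 = fourier_sum {1..4} \<phi> (\<xi> 1 1) + fourier_sum {1..4} (\<lambda>j. T (-1) (\<phi> j)) (\<xi> 1 1)" (is "_ = ?P + ?Q")
    using 0 unfolding hermite_residual_eq diff_diff_eq by (simp only: right_minus_eq)
  have PQ: "?P \<in> C1_splines" "?Q \<in> C1_splines"
    unfolding fourier_sum_def using \<phi>_\<A>\<^sub>1 \<A>\<^sub>1_C1_splines
    by (auto intro!: subspaceD_sum[OF subspace_C1_splines] subspaceD_scale[OF subspace_C1_splines] C1_splines_shift)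
  obtain D D' where D: "(?P has_real_derivative D) (at 0)" "(?Q has_real_derivative D') (at 0)"
    using C1_splines_deriv PQ by meson
  have "D = 0"
    by (rule deriv_zero_of_vanishing[OF D(1)])
       (auto simp: fourier_sum_def sum_fun_apply \<phi>_eq_0_14 intro!: disjI1 sum.neutral)
  moreover have "D' = 0"
    by (rule deriv_zero_of_vanishing[OF D(2)])
       (auto simp: fourier_sum_def sum_fun_apply \<phi>_eq_0_14 shift_def intro!: disjI2 sum.neutral)
  ultimately have "(\<xi> 1 1 has_real_derivative 0) (at 0)"
    using DERIV_add[OF D] by (subst e) (simp add: plus_fun_def)
  moreover have "(\<xi> 1 1 has_real_derivative 2 powr (1/2) * (1 * 2)) (at 0)"
  proof -
    have "((\<lambda>x. hermite 2 (2 * x)) has_real_derivative 1 * 2) (at 0)"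
      by (rule DERIV_chain'[where g = "hermite 2" and f = "\<lambda>x. 2 * x"])
         (auto intro!: derivative_eq_intros hermite_2_deriv_0)
    then show ?thesis
      using DERIV_cmult by (auto simp: \<xi>_def numeral_2_eq_2[symmetric])
  qed
  ultimately have "2 powr (1/2) * (1 * 2) = (0::real)"
    using DERIV_unique by blast
  then show False by simp
qed

lemma \<phi>_5: "\<phi> 5 = L2_normalize (hermite_residual 0)"
  using gen by (simp add: scaling_generators_def hermite_residual_def)

lemma sum_1_5: "sum f {1..5::nat} = sum f {1..4} + f 5"
proof -
  have "{1..5::nat} = insert 5 {1..4}" by auto
  then show ?thesis by (simp add: add.commute)
qed

text \<open>The component along the translate of \<phi>_5 is zero by orthogonality of the residuals
  to their translates, so forming \<phi>_6 is plain Gram-Schmidt against \<phi>_5.\<close>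

lemma remove_components_5: "remove_components 5 \<phi> (\<xi> 1 1) = hermite_residual 1 - L2_inner (\<xi> 1 1) (\<phi> 5) *\<^sub>R \<phi> 5"
proof -
  have L: "fourier_sum {1..4} \<phi> (\<xi> 1 1) \<in> L2" "fourier_sum {1..4} (\<lambda>j. T (-1) (\<phi> j)) (\<xi> 1 1) \<in> L2"
    using fourier_sum_L2[OF orthonormal_14] fourier_sum_L2[OF orthonormal_T_14[of "-1"]] by auto
  have perp: "L2_inner (T k (\<phi> j)) (T (-1) (hermite_residual 0)) = 0" if "j \<in> {1..4}" for j k
    using hermite_residual_T\<phi>[OF _ that, of 0 "k + 1"] inner_T[of k "\<phi> j" "-1" "hermite_residual 0"] by (simp add: L2_inner_commute add.commute)
  have perp': "L2_inner (fourier_sum {1..4} (\<lambda>j. T k (\<phi> j)) f) (T (-1) (hermite_residual 0)) = 0" for k f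
    unfolding fourier_sum_def using perp[of _ k] \<phi>_CC_14 hermite_residual_CC
    by (subst L2_inner_sum_left) (auto simp: CC_L2)
  have "L2_inner (\<xi> 1 1) (T (-1) (hermite_residual 0)) = L2_inner (hermite_residual 1) (T (-1) (hermite_residual 0))"
    unfolding hermite_residual_eq[of 1] using L perp'[of 0] perp'[of "-1"] hermite_residual_CC
    by (simp add: L2_inner_diff_left CC_L2)
  also have "\<dots> = 0" by (rule hermite_residual_T_hermite_residual) auto
  finally have "L2_inner (\<xi> 1 1) (T (-1) (\<phi> 5)) = 0"
    by (simp add: \<phi>_5 L2_normalize_def linear_scale[OF shift_linear])
  then show ?thesis
    by (simp add: remove_components_def hermite_residual_def sum_1_5 algebra_simps del: One_nat_def)
qed

lemma inner_\<xi>_\<phi>_5: "L2_inner (\<xi> 1 1) (\<phi> 5) = L2_inner (hermite_residual 1) (\<phi> 5)"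
proof -
  have L: "fourier_sum {1..4} \<phi> (\<xi> 1 1) \<in> L2" "fourier_sum {1..4} (\<lambda>j. T (-1) (\<phi> j)) (\<xi> 1 1) \<in> L2"
    using fourier_sum_L2[OF orthonormal_14] fourier_sum_L2[OF orthonormal_T_14[of "-1"]] by auto
  have "L2_inner (fourier_sum {1..4} (\<lambda>j. T k (\<phi> j)) f) (hermite_residual 0) = 0" for k f
    unfolding fourier_sum_def using hermite_residual_T\<phi>[of 0 _ k] \<phi>_CC_14 hermite_residual_CC
    by (subst L2_inner_sum_left) (auto simp: CC_L2 L2_inner_commute[of _ "hermite_residual 0"])
  from this[of 0] this[of "-1"] have "L2_inner (hermite_residual 1) (hermite_residual 0) = L2_inner (\<xi> 1 1) (hermite_residual 0)"
    unfolding hermite_residual_eq[of 1] using L hermite_residual_CC by (simp add: L2_inner_diff_left CC_L2)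
  then show ?thesis by (simp add: \<phi>_5 L2_normalize_def)
qed

definition g6 where "g6 = hermite_residual 1 - L2_inner (hermite_residual 1) (\<phi> 5) *\<^sub>R \<phi> 5"

lemma \<phi>_6: "\<phi> 6 = L2_normalize g6"
  using gen remove_components_5 by (simp add: scaling_generators_def g6_def inner_\<xi>_\<phi>_5)

lemma \<phi>_5_CC: "\<phi> 5 \<in> CC"
  unfolding \<phi>_5 L2_normalize_def using hermite_residual_CC by simp

text \<open>Evaluation at 0 separates the residuals: that of \<xi>_{1,1} vanishes there and that of
  \<xi>_{1,0} does not, so the first could be a multiple of the second only by being zero.\<close>

lemma g6_nonzero: "L2_norm g6 \<noteq> 0"
proof
  assume "L2_norm g6 = 0"
  then have "g6 = 0" by (rule CC_norm_eq_0[rotated]) (simp add: g6_def hermite_residual_CC \<phi>_5_CC)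
  then have e: "hermite_residual 1 = (L2_inner (hermite_residual 1) (\<phi> 5) / L2_norm (hermite_residual 0)) *\<^sub>R hermite_residual 0"
    by (simp add: g6_def \<phi>_5 L2_normalize_def divide_inverse)
  then have "hermite_residual 1 0 = (L2_inner (hermite_residual 1) (\<phi> 5) / L2_norm (hermite_residual 0)) * hermite_residual 0 0"
    by (metis scaleR_fun_apply real_scaleR_def)
  then have "L2_inner (hermite_residual 1) (\<phi> 5) / L2_norm (hermite_residual 0) = 0"
    using hermite_residual_at_0 \<xi>_at_0 by simp
  then have "hermite_residual 1 = 0" by (subst e) (simp only: scaleR_zero_left)
  then show False using hermite_residual_1_nonzero by simp
qed

lemma \<phi>_56_span: "l \<in> {5, 6} \<Longrightarrow> \<phi> l \<in> span {hermite_residual 0, hermite_residual 1}"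
proof -
  have 5: "\<phi> 5 \<in> span {hermite_residual 0, hermite_residual 1}"
    unfolding \<phi>_5 L2_normalize_def by (auto intro: span_scale span_base)
  moreover have "\<phi> 6 \<in> span {hermite_residual 0, hermite_residual 1}"
    unfolding \<phi>_6 L2_normalize_def g6_def by (auto intro!: span_scale span_diff 5 intro: span_base)
  ultimately show "l \<in> {5, 6} \<Longrightarrow> \<phi> l \<in> span {hermite_residual 0, hermite_residual 1}" by auto
qed

lemma \<phi>_CC: "l \<in> {1..6} \<Longrightarrow> \<phi> l \<in> CC"
proof -
  assume "l \<in> {1..6}"
  then have "l \<in> {1..4} \<or> l \<in> {5, 6}" by auto
  then show ?thesis
    using \<phi>_CC_14 \<phi>_56_span span_subset_CC[of "{hermite_residual 0, hermite_residual 1}"] hermite_residual_CC by blast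
qed

lemma inner_T\<phi>_14_56:
  assumes "i \<in> {1..4}" "j \<in> {5, 6}"
  shows "L2_inner (T m (\<phi> i)) (T n (\<phi> j)) = 0"
proof -
  have "L2_inner (T (m - n) (\<phi> i)) (\<phi> j) = 0"
  proof (rule L2_inner_span_right[OF \<phi>_56_span[OF assms(2)]])
    fix s assume "s \<in> {hermite_residual 0, hermite_residual 1}"
    then show "L2_inner (T (m - n) (\<phi> i)) s = 0"
      using hermite_residual_T\<phi>[of _ i "m - n"] assms(1) by (subst L2_inner_commute) blast
  qed (use assms(1) \<phi>_CC_14 hermite_residual_CC in \<open>auto simp: CC_L2\<close>)
  then show ?thesis by (simp add: inner_T)
qed

lemma inner_T\<phi>_56:
  assumes i: "i \<in> {5, 6}" and j: "j \<in> {5, 6}"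
  shows "L2_inner (T m (\<phi> i)) (T n (\<phi> j)) = of_bool (m = n \<and> i = j)"
proof (cases "m = n")
  case True
  have 55: "L2_inner (\<phi> 5) (\<phi> 5) = 1" and 66: "L2_inner (\<phi> 6) (\<phi> 6) = 1"
    unfolding \<phi>_5 \<phi>_6 by (intro L2_normalize_inner_self hermite_residual_0_nonzero g6_nonzero)+
  have "L2_inner g6 (\<phi> 5) = 0"
    unfolding g6_def using 55 \<phi>_5_CC hermite_residual_CC by (simp add: L2_inner_diff_left CC_L2)
  then have "L2_inner (\<phi> 6) (\<phi> 5) = 0" by (simp add: \<phi>_6 L2_normalize_def)
  then show ?thesis using True i j 55 66 by (auto simp: inner_T L2_inner_commute)
next
  case False
  have "L2_inner (\<phi> i) (T (n - m) (\<phi> j)) = 0"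
  proof (rule L2_inner_span)
    show "\<phi> i \<in> span {hermite_residual 0, hermite_residual 1}" using \<phi>_56_span i by blast
    show "T (n - m) (\<phi> j) \<in> span (T (n - m) ` {hermite_residual 0, hermite_residual 1})"
      using \<phi>_56_span j by (intro span_linear_image shift_linear) blast
    show "L2_inner s t = 0" if st: "s \<in> {hermite_residual 0, hermite_residual 1}" "t \<in> T (n - m) ` {hermite_residual 0, hermite_residual 1}" for s t
    proof -
      obtain a b where "s = hermite_residual a" "t = T (n - m) (hermite_residual b)" "a \<in> {0, 1}" "b \<in> {0, 1}"
        using st by blast
      then show ?thesis using False hermite_residual_T_hermite_residual[of a b "n - m"] by simp
    qed
  qed (use hermite_residual_CC in \<open>auto simp: CC_L2\<close>)
  then show ?thesis using False by (simp add: inner_T_left)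
qed

lemma inner_T\<phi>:
  assumes "i \<in> {1..6}" "j \<in> {1..6}"
  shows "L2_inner (T m (\<phi> i)) (T n (\<phi> j)) = of_bool (m = n \<and> i = j)"
proof -
  have "i \<in> {1..4} \<or> i \<in> {5, 6}" "j \<in> {1..4} \<or> j \<in> {5, 6}" using assms by auto
  then show ?thesis
    using inner_T\<phi>_14[of i j m n] inner_T\<phi>_56[of i j m n] inner_T\<phi>_14_56[of i j m n] inner_T\<phi>_14_56[of j i n m]
    by (auto simp: L2_inner_commute[of "T m (\<phi> i)"])
qed

section \<open>Scaling functions as an orthonormal system on each scale\<close>

abbreviation E :: "int \<Rightarrow> int \<Rightarrow> real \<Rightarrow> real" where
  "E \<equiv> scaling_fn \<phi>"

text \<open>
  The index ranges record supports: \<open>E 1 k\<close> with \<open>k \<in> {12 * n + 1..12 * n + 10}\<close> is supported in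
  $[n, n+1]$, with \<open>k \<in> {12 * n - 11..12 * n + 10}\<close> in $[n-1, n+1]$; the indices \<open>12 * n - 1\<close>
  and \<open>12 * n\<close> belong to the two functions centred at \<open>n\<close>.
\<close>

abbreviation V :: "int set \<Rightarrow> (real \<Rightarrow> real) set" where
  "V K \<equiv> span (E 1 ` K)"

lemma E_idx: "l \<in> {1..6} \<Longrightarrow> E j (6 * k + int l) = dil j (T (if l \<le> 4 then k else k + 1) (\<phi> l))"
  unfolding scaling_fn_def by (rule dilates_eq)

lemma E_dil: "dil i (E j k) = E (i + j) k"
  unfolding scaling_fn_def by (rule dilates_dil)

lemma E_T0: "T n (E 0 k) = E 0 (k + 6 * n)"
  unfolding scaling_fn_def by (subst dilates_T) auto

lemma E_T1: "T n (E 1 k) = E 1 (k + 12 * n)"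
  unfolding scaling_fn_def by (subst dilates_T) auto

lemma E_CC [simp]: "E j k \<in> CC"
  by (rule index_cases[of k]) (auto simp: E_idx intro!: dil_CC shift_CC \<phi>_CC)

lemma E_inner: "L2_inner (E j k) (E j k') = of_bool (k = k')"
proof -
  obtain n l where k: "k = 6 * n + int l" "l \<in> {1..6}" by (rule index_cases)
  obtain n' l' where k': "k' = 6 * n' + int l'" "l' \<in> {1..6}" by (rule index_cases)
  have "k = k' \<longleftrightarrow> n = n' \<and> l = l'"
    using k k' by (auto; presburger)
  then show ?thesis
    unfolding k(1) k'(1) E_idx[OF k(2)] E_idx[OF k'(2)] dil_isometry inner_T\<phi>[OF k(2) k'(2)]
    by auto
qed

lemma E_orthonormal: "orthonormal_on K (E j)"
  by (simp add: orthonormal_on_def CC_L2 E_inner)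

lemma \<phi>_eq_E: "\<phi> l = E 0 (int l)" if "l \<in> {1..4}"
  using that E_idx[of l 0 0] by auto

lemma \<phi>_eq_E': "\<phi> l = E 0 (int l - 6)" if "l \<in> {5, 6}"
  using that E_idx[of l 0 "-1"] by auto

lemma V_CC: "V K \<subseteq> CC"
  by (intro span_subset_CC) auto

lemma V_mono: "K \<subseteq> L \<Longrightarrow> V K \<subseteq> V L"
  by (intro span_mono image_mono)

lemma V_E: "k \<in> K \<Longrightarrow> E 1 k \<in> V K"
  by (intro span_base) auto

lemma V_T: "f \<in> V {a..b} \<Longrightarrow> T n f \<in> V {a + 12 * n..b + 12 * n}"
proof -
  assume "f \<in> V {a..b}"
  then have "T n f \<in> span (T n ` E 1 ` {a..b})"
    by (rule span_linear_image[OF shift_linear])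
  also have "T n ` E 1 ` {a..b} \<subseteq> E 1 ` {a + 12 * n..b + 12 * n}"
    by (auto simp: E_T1)
  then have "span (T n ` E 1 ` {a..b}) \<subseteq> V {a + 12 * n..b + 12 * n}"
    by (rule span_mono)
  finally show ?thesis .
qed

lemma V_disjoint:
  assumes "f \<in> V K" "g \<in> V L" "K \<inter> L = {}"
  shows "L2_inner f g = 0"
  using assms by (intro L2_inner_span[of f "E 1 ` K" g "E 1 ` L"]) (auto simp: CC_L2 E_inner)

lemma span_E0_dil:
  assumes "f \<in> span (E 0 ` {a..b})"
  shows "dil 1 (T n f) \<in> V {a + 6 * n..b + 6 * n}"
proof -
  have "dil 1 (T n f) \<in> span (dil 1 ` T n ` E 0 ` {a..b})"
    by (intro span_linear_image dil_linear shift_linear assms)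
  also have "dil 1 ` T n ` E 0 ` {a..b} \<subseteq> E 1 ` {a + 6 * n..b + 6 * n}"
    by (auto simp: E_T0 E_dil)
  then have "span (dil 1 ` T n ` E 0 ` {a..b}) \<subseteq> V {a + 6 * n..b + 6 * n}"
    by (rule span_mono)
  finally show ?thesis .
qed

section \<open>Hermite cubics in terms of scaling functions, and nestedness\<close>

lemma \<xi>_12_13_span: "\<xi> 1 2 \<in> span (E 0 ` {1..2})" "\<xi> 1 3 \<in> span (E 0 ` {1..2})"
proof -
  have e: "E 0 ` {1..2} = {\<phi> (Suc 0), \<phi> 2}"
  proof -
    have "{1..2::int} = {1, 2}" by auto
    then show ?thesis using \<phi>_eq_E[of 1] \<phi>_eq_E[of 2] by simp
  qed
  have "\<xi> 1 2 \<in> \<A>\<^sub>0" "\<xi> 1 3 \<in> \<A>\<^sub>0" unfolding \<A>\<^sub>0_def by (auto intro: span_base)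
  then show "\<xi> 1 2 \<in> span (E 0 ` {1..2})" "\<xi> 1 3 \<in> span (E 0 ` {1..2})"
    unfolding e \<A>\<^sub>0_span by auto
qed

text \<open>The formulas defining \<phi>_5 and \<phi>_6 solved for the Hermite cubics. The window
  consists of \<phi>_1, ..., \<phi>_4 moved one unit to the left (-5 to -2), of \<phi>_5, \<phi>_6
  (-1 and 0) and of \<phi>_1, ..., \<phi>_4 (1 to 4).\<close>

lemma \<xi>_01_span: "a \<in> {0, 1} \<Longrightarrow> \<xi> 1 a \<in> span (E 0 ` {-5..4})"
proof -
  let ?S = "span (E 0 ` {-5..4})"
  have 14: "\<phi> l \<in> ?S" "T (-1) (\<phi> l) \<in> ?S" if "l \<in> {1..4}" for l
    using that by (auto simp: \<phi>_eq_E E_T0[of "-1", simplified] intro!: span_base)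
  have F: "fourier_sum {1..4} \<phi> (\<xi> 1 a) \<in> ?S" "fourier_sum {1..4} (\<lambda>j. T (-1) (\<phi> j)) (\<xi> 1 a) \<in> ?S" for a
    unfolding fourier_sum_def by (intro span_sum span_scale 14; simp)+
  have 5: "\<phi> 5 \<in> ?S" and 6: "\<phi> 6 \<in> ?S"
    by (auto simp: \<phi>_eq_E' intro!: span_base)
  have y0: "hermite_residual 0 \<in> ?S"
    using span_normalize[OF hermite_residual_0_nonzero] span_minimal[of "{\<phi> 5}" ?S] 5 by (auto simp: \<phi>_5)
  have "g6 \<in> ?S"
    using span_normalize[OF g6_nonzero] span_minimal[of "{\<phi> 6}" ?S] 6 by (auto simp: \<phi>_6)
  then have "g6 + L2_inner (hermite_residual 1) (\<phi> 5) *\<^sub>R \<phi> 5 \<in> ?S"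
    by (intro span_add span_scale 5)
  then have y1: "hermite_residual 1 \<in> ?S" by (simp add: g6_def)
  have "hermite_residual a + fourier_sum {1..4} (\<lambda>j. T (-1) (\<phi> j)) (\<xi> 1 a) + fourier_sum {1..4} \<phi> (\<xi> 1 a) \<in> ?S"
    if "a \<in> {0, 1}"
    using that y0 y1 by (intro span_add F) auto
  then show "a \<in> {0, 1} \<Longrightarrow> \<xi> 1 a \<in> ?S" by (simp add: hermite_residual_eq)
qed

lemma \<xi>_1_span: "\<xi> 1 m \<in> span (range (E 0))"
proof -
  have base: "\<xi> 1 a \<in> span (range (E 0))" if "a \<in> {0..3}" for a
  proof -
    have "a \<in> {0, 1} \<or> a = 2 \<or> a = 3" using that by auto
    then show ?thesis
      using \<xi>_01_span[of a] \<xi>_12_13_span span_mono[of "E 0 ` _" "range (E 0)"] by blast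
  qed
  have "T (m div 4) (\<xi> 1 (m mod 4)) \<in> span (T (m div 4) ` range (E 0))"
    by (intro span_linear_image shift_linear base) auto
  moreover have "T (m div 4) ` range (E 0) \<subseteq> range (E 0)"
    by (auto simp: E_T0)
  ultimately have "T (m div 4) (\<xi> 1 (m mod 4)) \<in> span (range (E 0))"
    using span_mono by blast
  moreover have "T (m div 4) (\<xi> 1 (m mod 4)) = \<xi> 1 m"
    using \<xi>_1_shift[of "- (m div 4)" "m mod 4"] by simp
  ultimately show ?thesis by simp
qed

text \<open>Sorted by the node (m div 2) / 4: inside (0,1), at 0, at -1/4. This covers
  \<open>\<A>\<^sub>1\<close> and the refinements of \<open>\<xi> 1 0\<close> and
  \<open>\<xi> 1 1\<close>.\<close>

lemma \<xi>_2_V: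
  "m \<in> {2..7} \<Longrightarrow> \<xi> 2 m \<in> V {1..10}" (is "_ \<Longrightarrow> ?A")
  "m \<in> {0, 1} \<Longrightarrow> \<xi> 2 m \<in> V {-5..4}" (is "_ \<Longrightarrow> ?B")
  "m \<in> {-2, -1} \<Longrightarrow> \<xi> 2 m \<in> V {-11..-2}" (is "_ \<Longrightarrow> ?C")
proof -
  have 23: "\<xi> 2 a \<in> V {1..2}" if "a \<in> {2, 3}" for a
    using that span_E0_dil[OF \<xi>_12_13_span(1), of 0] span_E0_dil[OF \<xi>_12_13_span(2), of 0] by (auto simp: \<xi>_dil)
  have 67: "\<xi> 2 a \<in> V {7..8}" if "a \<in> {6, 7}" for a
  proof -
    have "T 1 (\<xi> 1 2) = \<xi> 1 6" "T 1 (\<xi> 1 3) = \<xi> 1 7"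
      using \<xi>_1_shift[of "-1" 2] \<xi>_1_shift[of "-1" 3] by simp_all
    then show ?thesis
      using that span_E0_dil[OF \<xi>_12_13_span(1), of 1] span_E0_dil[OF \<xi>_12_13_span(2), of 1] by (auto simp: \<xi>_dil)
  qed
  have 45: "\<xi> 2 a \<in> V {1..10}" if "a \<in> {4, 5}" for a
  proof -
    have "T 1 (\<xi> 1 (a - 4)) = \<xi> 1 a"
      using \<xi>_1_shift[of "-1" "a - 4"] by simp
    then show ?thesis
      using that span_E0_dil[OF \<xi>_01_span[of "a - 4"], of 1] by (auto simp: \<xi>_dil)
  qed
  show ?A if "m \<in> {2..7}"
  proof -
    have "m \<in> {2, 3} \<or> m \<in> {4, 5} \<or> m \<in> {6, 7}" using that by auto
    then show ?thesis
      using 23[of m] 45[of m] 67[of m] V_mono[of "{1..2}" "{1..10}"] V_mono[of "{7..8}" "{1..10}"] by auto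
  qed
  show ?B if "m \<in> {0, 1}"
    using span_E0_dil[OF \<xi>_01_span[OF that], of 0] by (simp add: \<xi>_dil)
  show ?C if "m \<in> {-2, -1}"
  proof -
    have "T (-1) (\<xi> 2 (m + 8)) = \<xi> 2 m"
      using \<xi>_shift[of 4 2 "m + 8"] by simp
    moreover have "\<xi> 2 (m + 8) \<in> V {1..10}"
      using 67[of "m + 8"] that V_mono[of "{7..8}" "{1..10}"] by auto
    ultimately show ?thesis
      using V_T[of "\<xi> 2 (m + 8)" 1 10 "-1"] by simp
  qed
qed

lemma \<phi>_14_V: "l \<in> {1..4} \<Longrightarrow> \<phi> l \<in> V {1..10}"
proof -
  have "\<A>\<^sub>1 \<subseteq> V {1..10}"
    unfolding \<A>\<^sub>1_def using \<xi>_2_V(1) by (intro span_minimal) auto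
  then show "l \<in> {1..4} \<Longrightarrow> \<phi> l \<in> V {1..10}" using \<phi>_\<A>\<^sub>1 by blast
qed

lemma \<phi>_56_V: "l \<in> {5, 6} \<Longrightarrow> \<phi> l \<in> V {-11..10}"
proof -
  have m: "V {1..10} \<subseteq> V {-11..10}" "V {-5..4} \<subseteq> V {-11..10}" "V {-11..-2} \<subseteq> V {-11..10}"
    by (intro V_mono; auto)+
  have \<xi>2: "\<xi> 2 n \<in> V {-11..10}" if "n \<in> {-2..3}" for n
  proof -
    have "n \<in> {2..7} \<or> n \<in> {0, 1} \<or> n \<in> {-2, -1}" using that by auto
    then show ?thesis using \<xi>_2_V[of n] m by blast
  qed
  have \<xi>1: "\<xi> 1 a \<in> V {-11..10}" if "a \<in> {0, 1}" for a
  proof -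
    have "a div 2 = 0" using that by auto
    then have "\<xi> 1 a \<in> span (\<xi> 2 ` {-2..3})" using \<xi>_refine[of 1 a] by simp
    also have "\<dots> \<subseteq> V {-11..10}" using \<xi>2 by (intro span_minimal) auto
    finally show ?thesis .
  qed
  have "T (-1) (\<phi> j) \<in> V {-11..-2}" if "j \<in> {1..4}" for j
    using V_T[OF \<phi>_14_V[OF that], of "-1"] by simp
  then have 14: "\<phi> j \<in> V {-11..10}" "T (-1) (\<phi> j) \<in> V {-11..10}" if "j \<in> {1..4}" for j
    using that \<phi>_14_V m by blast+
  have "hermite_residual a \<in> V {-11..10}" if "a \<in> {0, 1}" for a
    unfolding hermite_residual_eq fourier_sum_def by (intro span_diff span_sum span_scale 14 \<xi>1 that)
  then have "span {hermite_residual 0, hermite_residual 1} \<subseteq> V {-11..10}" by (intro span_minimal) auto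
  then show "l \<in> {5, 6} \<Longrightarrow> \<phi> l \<in> V {-11..10}" using \<phi>_56_span by blast
qed

lemma E0_V_14: "l \<in> {1..4} \<Longrightarrow> E 0 (6 * n + int l) \<in> V {1 + 12 * n..10 + 12 * n}"
  using V_T[OF \<phi>_14_V, of l n] by (simp add: E_idx)

lemma E0_V_56: "l \<in> {5, 6} \<Longrightarrow> E 0 (6 * n + int l) \<in> V {1 + 12 * n..22 + 12 * n}"
proof -
  assume l: "l \<in> {5, 6}"
  then have "E 0 (6 * n + int l) = T (n + 1) (\<phi> l)"
    using E_idx[of l 0 n] by auto
  then show ?thesis using V_T[OF \<phi>_56_V[OF l], of "n + 1"] by (simp add: algebra_simps)
qed

lemma E0_V: "E 0 k \<in> V UNIV"
proof -
  obtain n l where k: "k = 6 * n + int l" "l \<in> {1..6}" by (rule index_cases)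
  then have "l \<in> {1..4} \<or> l \<in> {5, 6}" by auto
  then show ?thesis
    unfolding k(1) using E0_V_14[of l n] E0_V_56[of l n] V_mono[OF subset_UNIV] by blast
qed

lemma E_step: "E j k \<in> span (range (E (j + 1)))"
proof -
  have "dil j (E 0 k) \<in> span (dil j ` E 1 ` UNIV)"
    by (intro span_linear_image dil_linear E0_V)
  moreover have "dil j ` E 1 ` UNIV = range (E (j + 1))"
    by (simp add: image_image E_dil)
  ultimately show ?thesis by (simp add: E_dil)
qed

lemma E_nested: "i \<le> j \<Longrightarrow> span (range (E i)) \<subseteq> span (range (E j))"
proof (induction j rule: int_ge_induct)
  case (step j)
  have "span (range (E j)) \<subseteq> span (range (E (j + 1)))"
    using E_step by (intro span_minimal) auto
  then show ?case using step by blast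
qed simp

lemma \<xi>_span: "\<xi> j m \<in> span (range (E (j - 1)))"
proof -
  have "dil (j - 1) (\<xi> 1 m) \<in> span (dil (j - 1) ` range (E 0))"
    by (intro span_linear_image dil_linear \<xi>_1_span)
  then show ?thesis by (simp add: \<xi>_dil image_image E_dil)
qed

lemma \<phi>_eq_0: "l \<in> {1..6} \<Longrightarrow> 1 < \<bar>x\<bar> \<Longrightarrow> \<phi> l x = 0"
proof -
  assume l: "l \<in> {1..6}" and x: "1 < \<bar>x\<bar>"
  let ?Z = "{f :: real \<Rightarrow> real. f x = 0}"
  have Z: "subspace ?Z" by (auto intro: subspaceI)
  have "hermite_residual a \<in> ?Z" if "a \<in> {0, 1}" for a
  proof -
    have "a div 2 = 0" using that by auto
    then have "\<xi> 1 a \<in> ?Z" using x \<xi>_eq_0[of 1 x a] by auto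
    moreover have "\<phi> j \<in> ?Z" "T (-1) (\<phi> j) \<in> ?Z" if "j \<in> {1..4}" for j
      using x \<phi>_eq_0_14[OF that, of x] \<phi>_eq_0_14[OF that, of "x + 1"] by (auto simp: shift_def abs_if split: if_splits)
    ultimately show ?thesis
      unfolding hermite_residual_eq fourier_sum_def by (intro subspaceD[OF Z])
  qed
  then have "span {hermite_residual 0, hermite_residual 1} \<subseteq> ?Z" by (intro span_minimal Z) auto
  moreover have "l \<in> {1..4} \<or> l \<in> {5, 6}" using l by auto
  ultimately show ?thesis
    using \<phi>_56_span[of l] \<phi>_eq_0_14[of l x] x by (auto simp: abs_if split: if_splits)
qed

lemma E_C1_splines: "E j k \<in> C1_splines"
proof -
  have T\<phi>: "\<phi> l \<in> C1_splines" if "l \<in> {1..4}" for l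
    using that \<phi>_\<A>\<^sub>1 \<A>\<^sub>1_C1_splines by blast
  have "hermite_residual a \<in> C1_splines" for a
    unfolding hermite_residual_eq fourier_sum_def
    by (intro subspaceD[OF subspace_C1_splines] C1_splines_shift T\<phi> \<xi>_C1_splines)
  then have "span {hermite_residual 0, hermite_residual 1} \<subseteq> C1_splines"
    by (intro span_minimal subspace_C1_splines) auto
  then have "\<phi> l \<in> C1_splines" if "l \<in> {1..6}" for l
    using T\<phi>[of l] \<phi>_56_span[of l] that by force
  then show ?thesis
    by (rule_tac index_cases[of k]) (simp add: E_idx C1_splines_dil C1_splines_shift)
qed

section \<open>Projection onto the functions of scale 1 supported in [0,1]\<close>

lemma fourier_sum_V: "fourier_sum K (E 1) f \<in> V K"
  by (rule fourier_sum_span)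

lemma fourier_sum_E1_eq: "finite K \<Longrightarrow> f \<in> V K \<Longrightarrow> fourier_sum K (E 1) f = f"
  by (rule fourier_sum_eq[OF E_orthonormal]) auto

lemma fourier_residual_V:
  assumes "finite K" "J \<subseteq> K" "f \<in> V K"
  shows "f - fourier_sum J (E 1) f \<in> V (K - J)"
proof -
  have "fourier_sum K (E 1) f = fourier_sum (K - J) (E 1) f + fourier_sum J (E 1) f"
    unfolding fourier_sum_def using assms by (simp add: sum.subset_diff)
  then have "f - fourier_sum J (E 1) f = fourier_sum (K - J) (E 1) f"
    using fourier_sum_E1_eq[OF assms(1,3)] by (simp add: diff_eq_eq)
  then show ?thesis by (simp add: fourier_sum_V)
qed

text \<open>Orthogonal projection onto \<open>V {1..10}\<close>. It takes the place of restriction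
  to [0,1], which would in general lose continuity and leave the spans.\<close>

definition proj01 :: "(real \<Rightarrow> real) \<Rightarrow> real \<Rightarrow> real" where
  "proj01 f = fourier_sum {1..10} (E 1) f"

abbreviation u :: "int \<Rightarrow> real \<Rightarrow> real" where
  "u k \<equiv> proj01 (E 0 k)"

lemma proj01_V: "proj01 f \<in> V {1..10}"
  unfolding proj01_def by (rule fourier_sum_V)

lemma proj01_CC: "proj01 f \<in> CC"
  using proj01_V V_CC by blast

lemma inner_proj01:
  assumes "f \<in> L2" "s \<in> V {1..10}"
  shows "L2_inner (proj01 f) s = L2_inner f s"
proof -
  have "L2_inner (f - proj01 f) s = 0"
    unfolding proj01_def using assms by (intro fourier_sum_residual_span E_orthonormal) auto
  moreover have "s \<in> L2" using assms V_CC CC_L2 by blast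
  ultimately show ?thesis using assms(1) proj01_CC[of f] by (simp add: L2_inner_diff_left CC_L2)
qed

lemma inner_proj01':
  assumes "f \<in> L2" "s \<in> V {1..10}"
  shows "L2_inner s (proj01 f) = L2_inner s f"
  using inner_proj01[OF assms] by (simp add: L2_inner_commute)

text \<open>The two index windows overlap exactly in 1..10, so the inner product is carried by the
  components with these indices.\<close>

lemma inner_proj01_proj01:
  assumes f: "f \<in> V {-11..10}" and g: "g \<in> V {1..22}"
  shows "L2_inner (proj01 f) (proj01 g) = L2_inner f g"
proof -
  have "L2_inner (f - proj01 f) g = 0"
    unfolding proj01_def by (rule V_disjoint[OF fourier_residual_V[OF _ _ f] g]) auto
  moreover have "f \<in> L2" "g \<in> L2" using f g V_CC CC_L2 by auto
  ultimately show ?thesis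
    using proj01_CC[of f] by (simp add: inner_proj01' proj01_V L2_inner_diff_left CC_L2)
qed

section \<open>Boundary residuals and the wavelet spaces in terms of scale 1\<close>

text \<open>Up to the factor \<open>c2\<close> this is h_1 for \<open>k = -1\<close> and h_2 for
  \<open>k = 0\<close>.\<close>

definition r :: "int \<Rightarrow> real \<Rightarrow> real" where
  "r k = E 1 k - L2_inner (E 1 k) (E 0 (-1)) *\<^sub>R E 0 (-1) - L2_inner (E 1 k) (E 0 0) *\<^sub>R E 0 0"

lemma E0_m1_0_V: "E 0 (-1) \<in> V {-11..10}" "E 0 0 \<in> V {-11..10}"
  using E0_V_56[of 5 "-1"] E0_V_56[of 6 "-1"] by simp_all

text \<open>The indices -1 and 0 lie in the middle of the window of \<open>E 0 (-1)\<close> and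
  \<open>E 0 0\<close> and in no other window.\<close>

lemma E1_perp_E0:
  assumes "k \<in> {-1, 0}" "m \<notin> {-1, 0}"
  shows "L2_inner (E 1 k) (E 0 m) = 0"
proof -
  obtain n l where m: "m = 6 * n + int l" "l \<in> {1..6}" by (rule index_cases)
  have k: "E 1 k \<in> V {k}" by (intro V_E) auto
  show ?thesis
  proof (cases "l \<in> {1..4}")
    case True
    have "k \<notin> {1 + 12 * n..10 + 12 * n}" using assms(1) by (auto; presburger)
    then show ?thesis unfolding m(1) by (intro V_disjoint[OF k E0_V_14[OF True]]) auto
  next
    case False
    then have l: "l \<in> {5, 6}" using m by auto
    then have "n \<noteq> -1" using assms(2) m by auto
    then have "k \<notin> {1 + 12 * n..22 + 12 * n}" using assms(1) by auto
    then show ?thesis unfolding m(1) by (intro V_disjoint[OF k E0_V_56[OF l]]) auto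
  qed
qed

lemma r_CC: "r k \<in> CC"
  unfolding r_def by (intro CC_diff CC_scale E_CC)

lemma r_perp_E0:
  assumes "k \<in> {-1, 0}"
  shows "L2_inner (r k) (E 0 m) = 0"
proof -
  have "L2_inner (r k) (E 0 m) = L2_inner (E 1 k) (E 0 m)
      - L2_inner (E 1 k) (E 0 (-1)) * of_bool (-1 = m) - L2_inner (E 1 k) (E 0 0) * of_bool (0 = m)"
    unfolding r_def by (simp add: L2_inner_diff_left CC_L2 E_inner)
  then show ?thesis using E1_perp_E0[OF assms, of m] by (cases "m = -1"; cases "m = 0") auto
qed

lemma T_r: "T n (r k) = E 1 (k + 12 * n) - L2_inner (E 1 k) (E 0 (-1)) *\<^sub>R E 0 (-1 + 6 * n) - L2_inner (E 1 k) (E 0 0) *\<^sub>R E 0 (6 * n)"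
  unfolding r_def using E_T0[of n 0]
  by (simp add: linear_diff[OF shift_linear] linear_scale[OF shift_linear] E_T0 E_T1)

lemma r_V: "k \<in> {-1, 0} \<Longrightarrow> r k \<in> V {-11..10}"
  unfolding r_def by (intro span_diff span_scale E0_m1_0_V V_E) auto

text \<open>Against functions orthogonal to scale 0 a boundary residual acts like a single function
  of scale 1. Many orthogonality relations with \<psi>_3, \<psi>_4 then reduce to locating one
  index.\<close>

lemma inner_T_r:
  assumes "f \<in> L2" "\<And>m. L2_inner f (E 0 m) = 0"
  shows "L2_inner f (T n (r k)) = L2_inner f (E 1 (k + 12 * n))"
  unfolding T_r using assms by (simp add: L2_inner_diff_right CC_L2)

lemma \<phi>_image: "\<phi> ` {1..6} \<union> {shift (-1) (\<phi> 5), shift (-1) (\<phi> 6)} = E 0 ` {-1..6}"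
proof -
  have 1: "{1..6::nat} = {1, 2, 3, 4, 5, 6}" by auto
  have 2: "{-1..6::int} = {-1, 0, 1, 2, 3, 4, 5, 6}" by auto
  have "E 0 5 = shift (-1) (\<phi> 5)" "E 0 6 = shift (-1) (\<phi> 6)" "E 0 (-1) = \<phi> 5" "E 0 0 = \<phi> 6"
    using E_idx[of 5 0 0] E_idx[of 6 0 0] \<phi>_eq_E'[of 5] \<phi>_eq_E'[of 6] by simp_all
  moreover have "E 0 1 = \<phi> 1" "E 0 2 = \<phi> 2" "E 0 3 = \<phi> 3" "E 0 4 = \<phi> 4"
    using \<phi>_eq_E[of 1] \<phi>_eq_E[of 2] \<phi>_eq_E[of 3] \<phi>_eq_E[of 4] by simp_all
  ultimately show ?thesis unfolding 1 2 by auto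
qed

text \<open>The normalisation that \<open>dil 1\<close> carries and \<open>dil2\<close> does
  not.\<close>

definition c2 :: real where "c2 = 1 / 2 powr (1 / 2)"

lemma c2_nonzero: "c2 \<noteq> 0" by (simp add: c2_def)

lemma dil2_eq: "dil2 f = c2 *\<^sub>R dil 1 f" "(\<lambda>x. f (2 * x - 1)) = c2 *\<^sub>R dil 1 (T 1 f)"
  by (simp_all add: dil2_def dil_def c2_def shift_def fun_eq_iff)

text \<open>At argument 2x the first four generators have indices 1 to 4, at 2x - 1 they have
  indices 7 to 10. The built-in unit shift puts \<phi>_5, \<phi>_6 at 2x - 1 on indices 5 and
  6.\<close>

lemma inner_wavelet_space_eq: "inner_wavelet_space \<phi> = V {1..10} \<ominus> E 0 ` {-1..6}"
proof -
  have E: "E 1 (int l) = dil 1 (\<phi> l)" "E 1 (6 + int l) = dil 1 (T 1 (\<phi> l))" if "l \<in> {1..4}" for l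
    using that E_idx[of l 1 0] E_idx[of l 1 1] by auto
  have E': "E 1 (int l) = dil 1 (T 1 (\<phi> l))" if "l \<in> {5, 6}" for l
    using that E_idx[of l 1 0] by auto
  have "(\<lambda>k. dil2 (\<phi> k)) ` {1..4} = (\<lambda>i. c2 *\<^sub>R E 1 i) ` int ` {1..4}"
    unfolding image_image using E by (intro image_cong) (auto simp: dil2_eq)
  moreover have "(\<lambda>k x. \<phi> k (2 * x - 1)) ` {1..4} = (\<lambda>i. c2 *\<^sub>R E 1 i) ` (\<lambda>l. 6 + int l) ` {1..4}"
    unfolding image_image using E by (intro image_cong) (auto simp: dil2_eq)
  moreover have "(\<lambda>k x. \<phi> k (2 * x - 1)) ` {5, 6} = (\<lambda>i. c2 *\<^sub>R E 1 i) ` int ` {5, 6}"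
    unfolding image_image using E' by (intro image_cong) (auto simp: dil2_eq)
  moreover have "{1..6::nat} = {1..4} \<union> {5, 6}" by auto
  ultimately have "(\<lambda>k. dil2 (\<phi> k)) ` {1..4} \<union> (\<lambda>k x. \<phi> k (2 * x - 1)) ` {1..6} =
      (\<lambda>i. c2 *\<^sub>R E 1 i) ` (int ` {1..4} \<union> (\<lambda>l. 6 + int l) ` {1..4} \<union> int ` {5, 6})"
    by (simp only: image_Un Un_ac)
  also have "int ` {1..4} \<union> (\<lambda>l. 6 + int l) ` {1..4} \<union> int ` {5, 6} = {1..10}"
  proof -
    have "{1..4::nat} = {1, 2, 3, 4}" "{1..10::int} = {1, 2, 3, 4, 5, 6, 7, 8, 9, 10}"
      by auto presburger
    then show ?thesis by auto
  qed
  finally show ?thesis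
    unfolding inner_wavelet_space_def \<phi>_image by (simp only: span_scaled_image[OF c2_nonzero])
qed

lemma boundary_part_eq: "boundary_part \<phi> 1 = c2 *\<^sub>R r (-1)" "boundary_part \<phi> 2 = c2 *\<^sub>R r 0"
proof -
  have E: "dil 1 (\<phi> 5) = E 1 (-1)" "dil 1 (\<phi> 6) = E 1 0" "\<phi> 5 = E 0 (-1)" "\<phi> 6 = E 0 0"
    using E_idx[of 5 1 "-1"] E_idx[of 6 1 "-1"] \<phi>_eq_E'[of 5] \<phi>_eq_E'[of 6] by simp_all
  have "(1::nat) + 4 = 5" "(2::nat) + 4 = 6" by simp_all
  then show "boundary_part \<phi> 1 = c2 *\<^sub>R r (-1)" "boundary_part \<phi> 2 = c2 *\<^sub>R r 0"
    unfolding boundary_part_def r_def dil2_eq using E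
    by (simp_all add: scaleR_diff_right del: One_nat_def)
qed

lemma E0_supp: "bounded (supp (E 0 k)) \<and> diameter (supp (E 0 k)) \<le> 2"
proof -
  obtain n l where k: "k = 6 * n + int l" "l \<in> {1..6}" by (rule index_cases)
  let ?n = "if l \<le> 4 then n else n + 1"
  have "E 0 k x = 0" if "1 < \<bar>x - of_int ?n\<bar>" for x
    using \<phi>_eq_0[OF k(2) that] unfolding k(1) E_idx[OF k(2)] by (simp add: shift_def)
  then show ?thesis using supp_bounded_diameter[of 1 "of_int ?n" "E 0 k"] by simp
qed

lemma E1_eq_0:
  assumes k: "k \<in> {-11..10}" and x: "1 < \<bar>x\<bar>"
  shows "E 1 k x = 0"
proof -
  obtain n l where kl: "k = 6 * n + int l" "l \<in> {1..6}" by (rule index_cases)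
  show ?thesis
  proof (cases "l \<in> {1..4}")
    case True
    then have "-2 \<le> n" "n \<le> 1" using k kl by auto
    then have "-2 \<le> real_of_int n" "real_of_int n \<le> 1" by linarith+
    then have "2 * x - of_int n \<le> 0 \<or> 1 \<le> 2 * x - of_int n" using x by linarith
    then have "\<phi> l (2 * x - of_int n) = 0" by (rule \<phi>_eq_0_14[OF True])
    then show ?thesis using True unfolding kl(1) E_idx[OF kl(2)] by (simp add: dil_def shift_def)
  next
    case False
    then have "-2 \<le> n" "n \<le> 0" using k kl by auto
    then have "-2 \<le> real_of_int n" "real_of_int n \<le> 0" by linarith+
    then have "1 < \<bar>2 * x - of_int (n + 1)\<bar>" using x by simp
    then have "\<phi> l (2 * x - of_int (n + 1)) = 0" by (rule \<phi>_eq_0[OF kl(2)])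
    then show ?thesis using False kl(2) unfolding kl(1) E_idx[OF kl(2)] by (simp add: dil_def shift_def algebra_simps)
  qed
qed

end

section \<open>Wavelets\<close>

locale wavelet_generating_system = scaling_system +
  fixes \<psi> :: "nat \<Rightarrow> real \<Rightarrow> real"
  assumes wgen: "wavelet_generators \<phi> \<psi>"
begin

section \<open>Inner wavelets and the decomposition of \<open>V {1..10}\<close>\<close>

lemma \<psi>_12_span: "span {\<psi> 1, \<psi> 2} = V {1..10} \<ominus> E 0 ` {-1..6}"
  and \<psi>_12_inner: "i \<in> {1, 2} \<Longrightarrow> j \<in> {1, 2} \<Longrightarrow> L2_inner (\<psi> i) (\<psi> j) = of_bool (i = j)"
  using wgen unfolding wavelet_generators_def orthonormal_basis_of_def inner_wavelet_space_eq by auto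

lemma \<psi>_56_span: "span {\<psi> 5, \<psi> 6} = outer_wavelet_space \<phi> \<psi>"
  and \<psi>_56_inner: "i \<in> {5, 6} \<Longrightarrow> j \<in> {5, 6} \<Longrightarrow> L2_inner (\<psi> i) (\<psi> j) = of_bool (i = j)"
  using wgen unfolding wavelet_generators_def orthonormal_basis_of_def by auto

lemma \<psi>_12_V: "l \<in> {1, 2} \<Longrightarrow> \<psi> l \<in> V {1..10}"
proof -
  assume "l \<in> {1, 2}"
  then have "\<psi> l \<in> span {\<psi> 1, \<psi> 2}" by (auto intro: span_base)
  then show ?thesis unfolding \<psi>_12_span by (simp add: ortho_in_def)
qed

lemma \<psi>_12_perp_E0:
  assumes "i \<in> {1, 2}"
  shows "L2_inner (\<psi> i) (E 0 m) = 0"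
proof (cases "m \<in> {-1..6}")
  case True
  have "\<psi> i \<in> span {\<psi> 1, \<psi> 2}" using assms by (auto intro: span_base)
  then show ?thesis using True unfolding \<psi>_12_span by (auto simp: ortho_in_def)
next
  case False
  obtain n l where m: "m = 6 * n + int l" "l \<in> {1..6}" by (rule index_cases)
  show ?thesis
  proof (cases "l \<in> {1..4}")
    case True
    then have "n \<noteq> 0" using False m by auto
    then have "{1..10} \<inter> {1 + 12 * n..10 + 12 * n} = {}" by auto
    then show ?thesis unfolding m(1) by (rule V_disjoint[OF \<psi>_12_V[OF assms] E0_V_14[OF True]])
  next
    case l: False
    then have l: "l \<in> {5, 6}" using m by auto
    then have "n \<noteq> 0" "n \<noteq> -1" using False m by auto
    then have "{1..10} \<inter> {1 + 12 * n..22 + 12 * n} = {}" by auto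
    then show ?thesis unfolding m(1) by (rule V_disjoint[OF \<psi>_12_V[OF assms] E0_V_56[OF l]])
  qed
qed

text \<open>What remains of \<open>f\<close> after projection onto \<open>span G\<close> is
  orthogonal to \<open>G\<close>, hence to the eight functions \<open>E 0 k\<close>, and so is an
  inner wavelet. \<open>G\<close> only has to detect these orthogonality relations.\<close>

lemma V_decomposition:
  assumes "finite G" "G \<subseteq> V {1..10}" "f \<in> V {1..10}"
    and G: "\<And>h k. h \<in> V {1..10} \<Longrightarrow> (\<And>g. g \<in> G \<Longrightarrow> L2_inner h g = 0) \<Longrightarrow> k \<in> {-1..6} \<Longrightarrow> L2_inner h (E 0 k) = 0"
  shows "f \<in> span (G \<union> {\<psi> 1, \<psi> 2})"
proof -
  obtain g where g: "g \<in> span G" "\<And>h. h \<in> span G \<Longrightarrow> L2_inner (f - g) h = 0"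
    using projection_exists[OF assms(1), of f] assms V_CC by blast
  have "span G \<subseteq> V {1..10}" using assms(2) by (simp add: span_minimal)
  then have "f - g \<in> V {1..10}" using g assms by (intro span_diff) auto
  moreover have "L2_inner (f - g) (E 0 k) = 0" if "k \<in> {-1..6}" for k
    using G[of "f - g" k] g calculation that span_base by blast
  ultimately have "f - g \<in> span {\<psi> 1, \<psi> 2}"
    unfolding \<psi>_12_span by (auto simp: ortho_in_def)
  then have "f - g \<in> span (G \<union> {\<psi> 1, \<psi> 2})" "g \<in> span (G \<union> {\<psi> 1, \<psi> 2})"
    using g span_mono[of "{\<psi> 1, \<psi> 2}" "G \<union> {\<psi> 1, \<psi> 2}"] span_mono[of G "G \<union> {\<psi> 1, \<psi> 2}"] by auto
  then show ?thesis using span_add by fastforce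
qed

lemma E0_14_V: "k \<in> {1..4} \<Longrightarrow> E 0 k \<in> V {1..10}"
  using E0_V_14[of "nat k" 0] by (auto simp: Suc_le_eq)

lemma inner_u: "h \<in> V {1..10} \<Longrightarrow> L2_inner h (u k) = L2_inner h (E 0 k)"
  by (rule inner_proj01') (auto simp: CC_L2)

text \<open>The four outer \<open>E 0 k\<close> are not confined to [0,1]; on
  \<open>V {1..10}\<close> their projections \<open>u k\<close> represent the same
  functionals.\<close>

lemma V_decomposition_u:
  assumes "f \<in> V {1..10}"
  shows "f \<in> span (E 0 ` {1..4} \<union> u ` {-1, 0, 5, 6} \<union> {\<psi> 1, \<psi> 2})"
proof (rule V_decomposition)
  fix h k assume h: "h \<in> V {1..10}" "\<And>g. g \<in> E 0 ` {1..4} \<union> u ` {-1, 0, 5, 6} \<Longrightarrow> L2_inner h g = 0" and k: "k \<in> {-1..6::int}"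
  have "k \<in> {1..4} \<or> k \<in> {-1, 0, 5, 6}" using k by auto
  then show "L2_inner h (E 0 k) = 0"
    using h(2)[of "E 0 k"] h(2)[of "u k"] inner_u[OF h(1), of k] by auto
qed (use assms E0_14_V proj01_V in auto)

text \<open>A dependence would put the ten-dimensional space \<open>V {1..10}\<close> into the span of nine functions.\<close>

lemma E0_independent_on_V:
  assumes perp: "\<And>h. h \<in> V {1..10} \<Longrightarrow> L2_inner (a *\<^sub>R E 0 (-1) + b *\<^sub>R E 0 0) h = 0"
  shows "a = 0 \<and> b = 0"
proof (rule ccontr)
  assume ab: "\<not> (a = 0 \<and> b = 0)"
  \<comment> \<open>The relation makes one of the two functionals redundant and \<open>k0\<close> is
    the one kept: for \<open>a = 0\<close> it annihilates \<open>E 0 0\<close>, otherwise it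
    expresses \<open>E 0 (-1)\<close> through \<open>E 0 0\<close>.\<close>
  define k0 :: int where "k0 = (if a = 0 then -1 else 0)"
  define G where "G = E 0 ` {1..4} \<union> u ` {k0, 5, 6}"
  have eq: "a * L2_inner h (E 0 (-1)) + b * L2_inner h (E 0 0) = 0" if "h \<in> V {1..10}" for h
  proof -
    have "h \<in> L2" using that V_CC CC_L2 by blast
    then show ?thesis
      using perp[OF that] by (simp add: L2_inner_commute[of _ h] L2_inner_add_right CC_L2)
  qed
  have "f \<in> span (G \<union> {\<psi> 1, \<psi> 2})" if "f \<in> V {1..10}" for f
  proof (rule V_decomposition)
    fix h k assume h: "h \<in> V {1..10}" "\<And>g. g \<in> G \<Longrightarrow> L2_inner h g = 0" and k: "k \<in> {-1..6::int}"
    have k0: "L2_inner h (E 0 k0) = 0"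
      using h(2)[of "u k0"] inner_u[OF h(1), of k0] by (auto simp: G_def)
    then have "L2_inner h (E 0 (-1)) = 0" "L2_inner h (E 0 0) = 0"
      using eq[OF h(1)] ab by (auto simp: k0_def split: if_splits)
    moreover have "k \<in> {1..4} \<or> k \<in> {5, 6} \<or> k = -1 \<or> k = 0" using k by auto
    ultimately show "L2_inner h (E 0 k) = 0"
      using h(2)[of "E 0 k"] h(2)[of "u k"] inner_u[OF h(1), of k] by (auto simp: G_def)
  qed (use that E0_14_V proj01_V in \<open>auto simp: G_def\<close>)
  then have "E 1 ` {1..10} \<subseteq> span (G \<union> {\<psi> 1, \<psi> 2})"
    using V_E by blast
  moreover have ind: "independent (E 1 ` {1..10})" "inj_on (E 1) {1..10}"
    using orthonormal_on_independent[OF E_orthonormal, of "{1..10}" 1] by auto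
  moreover have fin: "finite (G \<union> {\<psi> 1, \<psi> 2})" by (simp add: G_def)
  ultimately have "card (E 1 ` {1..10}) \<le> card (G \<union> {\<psi> 1, \<psi> 2})"
    using independent_span_bound[OF fin] by blast
  moreover have "card (E 1 ` {1..10}) = 10" using ind by (simp add: card_image)
  \<comment> \<open>4 + 3 + 2.\<close>
  moreover have "card (G \<union> {\<psi> 1, \<psi> 2}) \<le> 9"
  proof -
    have "card (E 0 ` {1..4}) \<le> 4" using card_image_le[of "{1..4::int}" "E 0"] by simp
    moreover have "card (u ` {k0, 5, 6}) \<le> 3"
      using card_image_le[of "{k0, 5, 6}" u] card_insert_le_m1[of 3 "{5, 6}" k0] by simp
    moreover have "card {\<psi> 1, \<psi> 2} \<le> 2" by (simp add: card_insert_le_m1)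
    ultimately show ?thesis
      unfolding G_def using card_Un_le[of "E 0 ` {1..4} \<union> u ` {k0, 5, 6}" "{\<psi> 1, \<psi> 2}"]
        card_Un_le[of "E 0 ` {1..4}" "u ` {k0, 5, 6}"] by linarith
  qed
  ultimately show False by simp
qed

section \<open>Boundary wavelets\<close>

text \<open>A dependence puts a combination \<open>v\<close> of \<open>E 1 (-1)\<close>,
  \<open>E 1 0\<close> into the span of \<open>E 0 (-1)\<close>, \<open>E 0 0\<close>. Since
  \<open>v\<close> is orthogonal to \<open>V {1..10}\<close>, \<open>E0_independent_on_V\<close>
  gives \<open>v = 0\<close>, and orthonormality on scale 1 finishes.\<close>

lemma r_independent:
  assumes "\<alpha> *\<^sub>R r (-1) + \<beta> *\<^sub>R r 0 = 0"
  shows "\<alpha> = 0 \<and> \<beta> = 0"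
proof -
  define a where "a = \<alpha> * L2_inner (E 1 (-1)) (E 0 (-1)) + \<beta> * L2_inner (E 1 0) (E 0 (-1))"
  define b where "b = \<alpha> * L2_inner (E 1 (-1)) (E 0 0) + \<beta> * L2_inner (E 1 0) (E 0 0)"
  define v where "v = \<alpha> *\<^sub>R E 1 (-1) + \<beta> *\<^sub>R E 1 0"
  have "v - (a *\<^sub>R E 0 (-1) + b *\<^sub>R E 0 0) = \<alpha> *\<^sub>R r (-1) + \<beta> *\<^sub>R r 0"
    by (simp add: r_def a_def b_def v_def algebra_simps scaleR_add_left)
  then have e: "v = a *\<^sub>R E 0 (-1) + b *\<^sub>R E 0 0" using assms by simp
  have "v \<in> V {-1, 0}" unfolding v_def by (intro span_add span_scale V_E) auto
  then have "L2_inner v h = 0" if "h \<in> V {1..10}" for h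
    by (rule V_disjoint[OF _ that]) auto
  then have "a = 0 \<and> b = 0" using E0_independent_on_V unfolding e by blast
  then have "v = 0" using e by simp
  then have "L2_inner v (E 1 (-1)) = 0" "L2_inner v (E 1 0) = 0" by simp_all
  then show ?thesis
    by (simp add: v_def L2_inner_add_left CC_L2 E_inner)
qed

definition q4 where "q4 = c2 *\<^sub>R r 0 - L2_inner (c2 *\<^sub>R r 0) (\<psi> 3) *\<^sub>R \<psi> 3"

lemma \<psi>_34: "\<psi> 3 = L2_normalize (c2 *\<^sub>R r (-1))" "\<psi> 4 = L2_normalize q4"
  using wgen unfolding wavelet_generators_def boundary_part_eq q4_def by auto

lemma \<psi>_34_CC: "\<psi> 3 \<in> CC" "q4 \<in> CC"
proof -
  show "\<psi> 3 \<in> CC" unfolding \<psi>_34 L2_normalize_def using r_CC by simp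
  then show "q4 \<in> CC" unfolding q4_def using r_CC by simp
qed

lemma \<psi>_3_norm: "L2_norm (c2 *\<^sub>R r (-1)) \<noteq> 0"
proof
  assume "L2_norm (c2 *\<^sub>R r (-1)) = 0"
  then have "c2 *\<^sub>R r (-1) = 0" using r_CC by (intro CC_norm_eq_0) auto
  then show False using r_independent[of c2 0] c2_nonzero by simp
qed

lemma \<psi>_4_norm: "L2_norm q4 \<noteq> 0"
proof
  assume "L2_norm q4 = 0"
  then have "q4 = 0" using \<psi>_34_CC by (intro CC_norm_eq_0) auto
  moreover define d where "d = L2_inner (c2 *\<^sub>R r 0) (\<psi> 3)"
  moreover have "\<psi> 3 = (inverse (L2_norm (c2 *\<^sub>R r (-1))) * c2) *\<^sub>R r (-1)"
    by (simp add: \<psi>_34 L2_normalize_def)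
  ultimately have "(- d * (inverse (L2_norm (c2 *\<^sub>R r (-1))) * c2)) *\<^sub>R r (-1) + c2 *\<^sub>R r 0 = 0"
    unfolding q4_def by (metis (no_types, lifting) add.commute diff_conv_add_uminus mult_minus_left scaleR_minus_left scaleR_scaleR)
  then show False using r_independent c2_nonzero by blast
qed

lemma \<psi>_34_inner:
  assumes "i \<in> {3, 4}" "j \<in> {3, 4}"
  shows "L2_inner (\<psi> i) (\<psi> j) = of_bool (i = j)"
proof -
  have 33: "L2_inner (\<psi> 3) (\<psi> 3) = 1" and 44: "L2_inner (\<psi> 4) (\<psi> 4) = 1"
    unfolding \<psi>_34 by (intro L2_normalize_inner_self \<psi>_3_norm \<psi>_4_norm)+
  have "L2_inner q4 (\<psi> 3) = 0"
    unfolding q4_def using r_CC \<psi>_34_CC 33 by (simp add: L2_inner_diff_left CC_L2)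
  then have 43: "L2_inner (\<psi> 4) (\<psi> 3) = 0" by (simp add: \<psi>_34(2) L2_normalize_def)
  then have "L2_inner (\<psi> 3) (\<psi> 4) = 0" by (simp add: L2_inner_commute)
  then show ?thesis using assms 33 44 43 by auto
qed

text \<open>Lets arguments about \<psi>_3, \<psi>_4 be made for \<open>r (-1)\<close>,
  \<open>r 0\<close>, and conversely.\<close>

lemma span_r: "span {\<psi> 3, \<psi> 4} = span {r (-1), r 0}"
proof -
  have 3: "\<psi> 3 \<in> span {r (-1), r 0}"
    unfolding \<psi>_34 L2_normalize_def by (auto intro!: span_scale intro: span_base)
  then have 4: "\<psi> 4 \<in> span {r (-1), r 0}"
    unfolding \<psi>_34(2) L2_normalize_def q4_def by (auto intro!: span_scale span_diff intro: span_base)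
  have s: "x \<in> span {\<psi> 3, \<psi> 4}" if "c2 *\<^sub>R x \<in> span {\<psi> 3, \<psi> 4}" for x
    using span_scale[OF that, of "inverse c2"] c2_nonzero by simp
  have "c2 *\<^sub>R r (-1) \<in> span {\<psi> 3}"
    using span_normalize[OF \<psi>_3_norm] by (simp add: \<psi>_34)
  then have "r (-1) \<in> span {\<psi> 3, \<psi> 4}"
    using s span_mono[of "{\<psi> 3}" "{\<psi> 3, \<psi> 4}"] by blast
  moreover have "q4 \<in> span {\<psi> 4}"
    using span_normalize[OF \<psi>_4_norm] by (simp add: \<psi>_34)
  then have "q4 \<in> span {\<psi> 3, \<psi> 4}"
    using span_mono[of "{\<psi> 4}" "{\<psi> 3, \<psi> 4}"] by blast
  then have "q4 + L2_inner (c2 *\<^sub>R r 0) (\<psi> 3) *\<^sub>R \<psi> 3 \<in> span {\<psi> 3, \<psi> 4}"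
    by (intro span_add span_scale) (auto intro: span_base)
  then have "r 0 \<in> span {\<psi> 3, \<psi> 4}" using s by (simp add: q4_def)
  ultimately show ?thesis using 3 4 by (intro span_eqI) auto
qed

lemma \<psi>_34_r: "l \<in> {3, 4} \<Longrightarrow> \<psi> l \<in> span {r (-1), r 0}"
  unfolding span_r[symmetric] by (auto intro: span_base)

lemma \<psi>_34_V: "l \<in> {3, 4} \<Longrightarrow> \<psi> l \<in> V {-11..10}"
  using \<psi>_34_r span_minimal[of "{r (-1), r 0}" "V {-11..10}"] r_V by auto

section \<open>Outer wavelets and orthonormality of integer translates\<close>

lemma \<psi>_56_outer: "l \<in> {5, 6} \<Longrightarrow> \<psi> l \<in> outer_wavelet_space \<phi> \<psi>"
  unfolding \<psi>_56_span[symmetric] by (auto intro: span_base)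

lemma outer_iff: "f \<in> outer_wavelet_space \<phi> \<psi> \<longleftrightarrow> f \<in> V {-11..10} \<and>
    (\<forall>k\<in>{-7..6}. L2_inner f (E 0 k) = 0) \<and>
    (\<forall>l\<in>{1, 2}. L2_inner f (T (-1) (\<psi> l)) = 0 \<and> L2_inner f (\<psi> l) = 0) \<and> (\<forall>l\<in>{3, 4}. L2_inner f (\<psi> l) = 0)"
proof -
  have "{1..4::nat} = {1, 2, 3, 4}" by auto
  then show ?thesis unfolding outer_wavelet_space_def ortho_in_def by auto
qed

lemma outer_V: "f \<in> outer_wavelet_space \<phi> \<psi> \<Longrightarrow> f \<in> V {-11..10}"
  by (simp add: outer_iff)

text \<open>The prescribed range -7..6 consists exactly of the \<open>m\<close> for which the window
  of \<open>E 0 m\<close> meets -11..10.\<close>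

lemma outer_perp_E0:
  assumes f: "f \<in> outer_wavelet_space \<phi> \<psi>"
  shows "L2_inner f (E 0 m) = 0"
proof (cases "m \<in> {-7..6}")
  case True
  then show ?thesis using f by (simp add: outer_iff)
next
  case False
  obtain n l where m: "m = 6 * n + int l" "l \<in> {1..6}" by (rule index_cases)
  show ?thesis
  proof (cases "l \<in> {1..4}")
    case True
    then have "n \<noteq> 0" "n \<noteq> -1" using False m by auto
    then have "{-11..10} \<inter> {1 + 12 * n..10 + 12 * n} = {}" by auto
    then show ?thesis unfolding m(1) by (rule V_disjoint[OF outer_V[OF f] E0_V_14[OF True]])
  next
    case l: False
    then have l: "l \<in> {5, 6}" using m by auto
    then have "n \<noteq> 0" "n \<noteq> -1" "n \<noteq> -2" using False m by auto
    then have "{-11..10} \<inter> {1 + 12 * n..22 + 12 * n} = {}" by auto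
    then show ?thesis unfolding m(1) by (rule V_disjoint[OF outer_V[OF f] E0_V_56[OF l]])
  qed
qed

lemma \<psi>_V: "l \<in> {1..6} \<Longrightarrow> \<psi> l \<in> V {-11..10}"
proof -
  assume "l \<in> {1..6}"
  then have "l \<in> {1, 2} \<or> l \<in> {3, 4} \<or> l \<in> {5, 6}" by auto
  then show ?thesis
    using \<psi>_12_V[of l] V_mono[of "{1..10}" "{-11..10}"] \<psi>_34_V[of l] outer_V[OF \<psi>_56_outer, of l] by auto
qed

lemma \<psi>_CC: "l \<in> {1..6} \<Longrightarrow> \<psi> l \<in> CC"
  using \<psi>_V V_CC by blast

lemma \<psi>_perp_E0:
  assumes "l \<in> {1..6}"
  shows "L2_inner (\<psi> l) (E 0 m) = 0"
proof -
  have "L2_inner (E 0 m) (\<psi> l) = 0" if "l \<in> {3, 4}"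
    using r_CC by (intro L2_inner_span_right[OF \<psi>_34_r[OF that]]) (auto simp: CC_L2 L2_inner_commute[of "E 0 m"] r_perp_E0)
  moreover have "l \<in> {1, 2} \<or> l \<in> {3, 4} \<or> l \<in> {5, 6}" using assms by auto
  ultimately show ?thesis
    using \<psi>_12_perp_E0[of l] outer_perp_E0[OF \<psi>_56_outer, of l m] by (auto simp: L2_inner_commute)
qed

lemma inner_T_span_r:
  assumes f: "f \<in> L2" and g: "g \<in> span {r (-1), r 0}"
    and 0: "\<And>k. k \<in> {-1, 0} \<Longrightarrow> L2_inner f (T n (r k)) = 0"
  shows "L2_inner f (T n g) = 0"
proof (rule L2_inner_span_right[OF _ _ f])
  show "T n g \<in> span (T n ` {r (-1), r 0})"
    using g by (rule span_linear_image[OF shift_linear])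
  show "T n ` {r (-1), r 0} \<subseteq> L2" using r_CC by (auto simp: CC_L2)
qed (use 0 in auto)

lemma inner_\<psi>_12_12:
  assumes "i \<in> {1, 2}" "j \<in> {1, 2}" "n \<noteq> 0"
  shows "L2_inner (\<psi> i) (T n (\<psi> j)) = 0"
proof (rule V_disjoint[OF \<psi>_12_V[OF assms(1)] V_T[OF \<psi>_12_V[OF assms(2)]]])
  show "{1..10} \<inter> {1 + 12 * n..10 + 12 * n} = {}" using assms(3) by auto
qed

text \<open>By \<open>inner_T_r\<close> only the index \<open>k + 12 * n\<close> counts, and numbers
  congruent to -1 or 0 modulo 12 never fall into 1..10.\<close>

lemma inner_\<psi>_12_34:
  assumes i: "i \<in> {1, 2}" and j: "j \<in> {3, 4}"
  shows "L2_inner (\<psi> i) (T n (\<psi> j)) = 0"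
proof (rule inner_T_span_r[OF _ \<psi>_34_r[OF j]])
  have i6: "i \<in> {1..6}" using i by auto
  show L: "\<psi> i \<in> L2" using \<psi>_CC[OF i6] CC_L2 by blast
  fix k :: int assume k: "k \<in> {-1, 0}"
  have "k + 12 * n \<notin> {1..10}" using k by (auto; presburger)
  then have "L2_inner (\<psi> i) (E 1 (k + 12 * n)) = 0"
    by (intro V_disjoint[OF \<psi>_12_V[OF i] V_E[of _ "{k + 12 * n}"]]) auto
  then show "L2_inner (\<psi> i) (T n (r k)) = 0"
    using inner_T_r[OF L \<psi>_perp_E0[OF i6]] by simp
qed

lemma inner_\<psi>_34_34:
  assumes i: "i \<in> {3, 4}" and j: "j \<in> {3, 4}" and n: "n \<noteq> 0"
  shows "L2_inner (\<psi> i) (T n (\<psi> j)) = 0"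
proof (rule inner_T_span_r[OF _ \<psi>_34_r[OF j]])
  have i6: "i \<in> {1..6}" using i by auto
  show L: "\<psi> i \<in> L2" using \<psi>_CC[OF i6] CC_L2 by blast
  fix k :: int assume k: "k \<in> {-1, 0}"
  have "k + 12 * n \<notin> {-11..10}" using k n by auto
  then have "L2_inner (\<psi> i) (E 1 (k + 12 * n)) = 0"
    by (intro V_disjoint[OF \<psi>_34_V[OF i] V_E[of _ "{k + 12 * n}"]]) auto
  then show "L2_inner (\<psi> i) (T n (r k)) = 0"
    using inner_T_r[OF L \<psi>_perp_E0[OF i6]] by simp
qed

lemma inner_\<psi>_56_12:
  assumes i: "i \<in> {5, 6}" and j: "j \<in> {1, 2}"
  shows "L2_inner (\<psi> i) (T n (\<psi> j)) = 0"
proof (cases "n = 0 \<or> n = -1")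
  case True
  then show ?thesis using \<psi>_56_outer[OF i] j by (auto simp: outer_iff)
next
  case False
  then have "{-11..10} \<inter> {1 + 12 * n..10 + 12 * n} = {}" by auto
  then show ?thesis
    by (rule V_disjoint[OF outer_V[OF \<psi>_56_outer[OF i]] V_T[OF \<psi>_12_V[OF j]]])
qed

lemma inner_\<psi>_56_34:
  assumes i: "i \<in> {5, 6}" and j: "j \<in> {3, 4}"
  shows "L2_inner (\<psi> i) (T n (\<psi> j)) = 0"
proof (cases "n = 0")
  case True
  then show ?thesis using \<psi>_56_outer[OF i] j by (auto simp: outer_iff)
next
  case n: False
  have i6: "i \<in> {1..6}" using i by auto
  have L: "\<psi> i \<in> L2" using \<psi>_CC[OF i6] CC_L2 by blast
  show ?thesis
  proof (rule inner_T_span_r[OF L \<psi>_34_r[OF j]])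
    fix k :: int assume k: "k \<in> {-1, 0}"
    have "k + 12 * n \<notin> {-11..10}" using k n by auto
    then have "L2_inner (\<psi> i) (E 1 (k + 12 * n)) = 0"
      by (intro V_disjoint[OF outer_V[OF \<psi>_56_outer[OF i]] V_E[of _ "{k + 12 * n}"]]) auto
    then show "L2_inner (\<psi> i) (T n (r k)) = 0"
      using inner_T_r[OF L \<psi>_perp_E0[OF i6]] by simp
  qed
qed

lemma E0_56_V: "k \<in> {5, 6} \<Longrightarrow> E 0 k \<in> V {1..22}"
  using E0_V_56[of 5 0] E0_V_56[of 6 0] by auto

lemma E0_m10_V: "k \<in> {-1, 0} \<Longrightarrow> E 0 k \<in> V {-11..10}"
  using E0_m1_0_V by auto

text \<open>Projection does not alter the inner product of functions whose windows meet only in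
  1..10, so this is orthonormality on scale 0.\<close>

lemma u_perp_u:
  assumes "k \<in> {-1, 0}" "k' \<in> {5, 6}"
  shows "L2_inner (u k) (u k') = 0"
  using assms inner_proj01_proj01[OF E0_m10_V E0_56_V, of k k'] by (auto simp: E_inner)

text \<open>Together with \<open>u\<close> at -1, 0 and \<open>u\<close> at 5, 6 this spans
  \<open>V {1..10}\<close>, and the three blocks are mutually orthogonal.\<close>

definition G1 where "G1 = E 0 ` {1..4} \<union> {\<psi> 1, \<psi> 2}"

lemma G1_V: "G1 \<subseteq> V {1..10}"
  using E0_14_V \<psi>_12_V unfolding G1_def by auto

lemma u_perp_G1:
  assumes "k \<in> {-1, 0, 5, 6}" "g \<in> G1"
  shows "L2_inner g (u k) = 0"
proof -
  have "L2_inner g (u k) = L2_inner g (E 0 k)"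
    using assms G1_V by (intro inner_u) auto
  then show ?thesis
    using assms \<psi>_12_perp_E0 by (auto simp: G1_def E_inner)
qed

text \<open>
  Neighbouring functions of the outer space meet only in \<open>V {1..10}\<close>, where their parts lie in
  orthogonal subspaces.
\<close>

lemma inner_outer_neighbours:
  assumes a: "a \<in> outer_wavelet_space \<phi> \<psi>" and b: "b \<in> outer_wavelet_space \<phi> \<psi>"
  shows "L2_inner a (T 1 b) = 0"
proof -
  have aV: "a \<in> V {-11..10}" and bV: "T 1 b \<in> V {1..22}"
    using outer_V[OF a] V_T[OF outer_V[OF b], of 1] by auto
  have L: "a \<in> L2" "T 1 b \<in> L2" using aV bV V_CC CC_L2 by auto
  have a1: "L2_inner (proj01 a) g = 0" if g: "g \<in> G1" for g
  proof -
    have "L2_inner (proj01 a) g = L2_inner a g" using g G1_V L by (intro inner_proj01) auto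
    then show ?thesis using g a outer_perp_E0[OF a] by (auto simp: G1_def outer_iff)
  qed
  have a3: "L2_inner (proj01 a) (u k) = 0" if k: "k \<in> {5, 6}" for k
    using inner_proj01_proj01[OF aV E0_56_V[OF k]] outer_perp_E0[OF a] by simp
  have b1: "L2_inner g (proj01 (T 1 b)) = 0" if g: "g \<in> G1" for g
  proof -
    have "L2_inner g (proj01 (T 1 b)) = L2_inner g (T 1 b)" using g G1_V L by (intro inner_proj01') auto
    also have "\<dots> = L2_inner b (T (-1) g)"
      using inner_T_right[of g 1 b] by (simp add: L2_inner_commute)
    also have "\<dots> = 0"
      using g b outer_perp_E0[OF b] E_T0[of "-1"] by (auto simp: G1_def outer_iff)
    finally show ?thesis .
  qed
  have b2: "L2_inner (u k) (proj01 (T 1 b)) = 0" if k: "k \<in> {-1, 0}" for k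
  proof -
    have "L2_inner (u k) (proj01 (T 1 b)) = L2_inner (E 0 k) (T 1 b)"
      by (rule inner_proj01_proj01[OF E0_m10_V[OF k] bV])
    also have "\<dots> = L2_inner b (T (-1) (E 0 k))"
      using inner_T_right[of "E 0 k" 1 b] by (simp add: L2_inner_commute)
    also have "\<dots> = 0" using outer_perp_E0[OF b] E_T0[of "-1" k] by simp
    finally show ?thesis .
  qed
  have "proj01 a \<in> span ((G1 \<union> u ` {-1, 0}) \<union> u ` {5, 6})"
    using V_decomposition_u[OF proj01_V, of a] by (rule rev_subsetD) (auto intro!: span_mono simp: G1_def)
  then obtain g12 g3 where g: "g12 \<in> span (G1 \<union> u ` {-1, 0})" "g3 \<in> span (u ` {5, 6})" "proj01 a = g12 + g3"
    unfolding span_Un by auto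
  have CC: "G1 \<union> u ` {-1, 0} \<subseteq> CC" "u ` {5, 6} \<subseteq> CC"
    using G1_V V_CC proj01_CC by auto
  have gCC: "g12 \<in> CC" "g3 \<in> CC" using g CC span_subset_CC by blast+
  \<comment> \<open>The aim is \<open>g3 = 0\<close>: it is orthogonal to \<open>g12\<close> and to
    \<open>proj01 a\<close>, hence to itself.\<close>
  have "L2_inner g12 g3 = 0"
    using g(1,2)
  proof (rule L2_inner_span)
    show "L2_inner s t = 0" if "s \<in> G1 \<union> u ` {-1, 0}" "t \<in> u ` {5, 6}" for s t
      using that u_perp_u u_perp_G1 by auto
  qed (use CC CC_L2 in auto)
  moreover have "L2_inner (proj01 a) g3 = 0"
    using g(2) a3 proj01_CC CC CC_L2 by (intro L2_inner_span_right[of g3 "u ` {5, 6}"]) auto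
  ultimately have "L2_inner g3 g3 = 0"
    using g(3) gCC by (simp add: L2_inner_add_left CC_L2)
  then have "g3 = 0" using gCC by (intro CC_inner_eq_0)
  then have "proj01 a \<in> span (G1 \<union> u ` {-1, 0})" using g by simp
  \<comment> \<open>The projection of the neighbour is orthogonal to both remaining blocks.\<close>
  then have "L2_inner (proj01 (T 1 b)) (proj01 a) = 0"
  proof (rule L2_inner_span_right)
    fix s assume "s \<in> G1 \<union> u ` {-1, 0}"
    then show "L2_inner (proj01 (T 1 b)) s = 0"
      using b1 b2 by (subst L2_inner_commute) auto
  qed (use CC CC_L2 proj01_CC in auto)
  then show ?thesis using inner_proj01_proj01[OF aV bV] by (simp add: L2_inner_commute)
qed

lemma inner_\<psi>_56_56:
  assumes i: "i \<in> {5, 6}" and j: "j \<in> {5, 6}" and n: "n \<noteq> 0"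
  shows "L2_inner (\<psi> i) (T n (\<psi> j)) = 0"
proof -
  consider "n = 1" | "n = -1" | "n \<notin> {-1, 0, 1}" using n by auto
  then show ?thesis
  proof cases
    case 1
    then show ?thesis using inner_outer_neighbours \<psi>_56_outer i j by blast
  next
    case 2
    then have "L2_inner (\<psi> i) (T n (\<psi> j)) = L2_inner (\<psi> j) (T 1 (\<psi> i))"
      using inner_T_right[of "\<psi> i" "-1" "\<psi> j"] by (simp add: L2_inner_commute)
    then show ?thesis using inner_outer_neighbours \<psi>_56_outer i j by simp
  next
    case 3
    then have "{-11..10} \<inter> {-11 + 12 * n..10 + 12 * n} = {}" by auto
    then show ?thesis
      by (rule V_disjoint[OF outer_V[OF \<psi>_56_outer[OF i]] V_T[OF outer_V[OF \<psi>_56_outer[OF j]]]])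
  qed
qed

lemma inner_\<psi>_T:
  assumes "i \<in> {1..6}" "j \<in> {1..6}"
  shows "L2_inner (\<psi> i) (T n (\<psi> j)) = of_bool (n = 0 \<and> i = j)"
proof -
  have sym: "L2_inner (\<psi> i) (T n (\<psi> j)) = L2_inner (\<psi> j) (T (- n) (\<psi> i))"
    using inner_T_right[of "\<psi> i" n "\<psi> j"] by (simp add: L2_inner_commute)
  have "i \<in> {1, 2} \<or> i \<in> {3, 4} \<or> i \<in> {5, 6}" "j \<in> {1, 2} \<or> j \<in> {3, 4} \<or> j \<in> {5, 6}"
    using assms by auto
  then consider "i \<in> {1, 2}" "j \<in> {1, 2}" | "i \<in> {1, 2}" "j \<in> {3, 4}" | "i \<in> {1, 2}" "j \<in> {5, 6}"
    | "i \<in> {3, 4}" "j \<in> {1, 2}" | "i \<in> {3, 4}" "j \<in> {3, 4}" | "i \<in> {3, 4}" "j \<in> {5, 6}"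
    | "i \<in> {5, 6}" "j \<in> {1, 2}" | "i \<in> {5, 6}" "j \<in> {3, 4}" | "i \<in> {5, 6}" "j \<in> {5, 6}"
    by blast
  then show ?thesis
  proof cases
    case 1
    then show ?thesis using \<psi>_12_inner[of i j] inner_\<psi>_12_12[of i j n] by (cases "n = 0") simp_all
  next
    case 2
    then show ?thesis using inner_\<psi>_12_34[of i j n] by auto
  next
    case 3
    then show ?thesis using inner_\<psi>_56_12[of j i "- n"] unfolding sym by auto
  next
    case 4
    then show ?thesis using inner_\<psi>_12_34[of j i "- n"] unfolding sym by auto
  next
    case 5
    then show ?thesis using \<psi>_34_inner[of i j] inner_\<psi>_34_34[of i j n] by (cases "n = 0") simp_all
  next
    case 6
    then show ?thesis using inner_\<psi>_56_34[of j i "- n"] unfolding sym by auto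
  next
    case 7
    then show ?thesis using inner_\<psi>_56_12[of i j n] by auto
  next
    case 8
    then show ?thesis using inner_\<psi>_56_34[of i j n] by auto
  next
    case 9
    then show ?thesis using \<psi>_56_inner[of i j] inner_\<psi>_56_56[of i j n] by (cases "n = 0") simp_all
  qed
qed

section \<open>Wavelets on all scales\<close>

abbreviation F :: "int \<Rightarrow> int \<Rightarrow> real \<Rightarrow> real" where
  "F \<equiv> wavelet_fn \<psi>"

lemma F_idx: "l \<in> {1..6} \<Longrightarrow> F j (6 * k + int l) = dil j (T (if l \<le> 2 then k else k + 1) (\<psi> l))"
  unfolding wavelet_fn_def by (rule dilates_eq)

lemma F_dil: "dil i (F j k) = F (i + j) k"
  unfolding wavelet_fn_def by (rule dilates_dil)

lemma F_T0: "T n (F 0 k) = F 0 (k + 6 * n)"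
  unfolding wavelet_fn_def by (subst dilates_T) auto

lemma \<psi>_eq_F: "l \<in> {1, 2} \<Longrightarrow> \<psi> l = F 0 (int l)"
  using F_idx[of l 0 0] by auto

lemma \<psi>_eq_F': "l \<in> {3..6} \<Longrightarrow> \<psi> l = F 0 (int l - 6)"
  using F_idx[of l 0 "-1"] by auto

lemma F_CC [simp]: "F j k \<in> CC"
  by (rule index_cases[of k]) (auto simp: F_idx intro!: dil_CC shift_CC \<psi>_CC)

lemma F_inner: "L2_inner (F j k) (F j k') = of_bool (k = k')"
proof -
  obtain n l where k: "k = 6 * n + int l" "l \<in> {1..6}" by (rule index_cases)
  obtain n' l' where k': "k' = 6 * n' + int l'" "l' \<in> {1..6}" by (rule index_cases)
  have "k = k' \<longleftrightarrow> n = n' \<and> l = l'"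
    using k k' by (auto; presburger)
  then show ?thesis
    unfolding k(1) k'(1) F_idx[OF k(2)] F_idx[OF k'(2)] dil_isometry inner_T_left shift_shift
    using inner_\<psi>_T[OF k(2) k'(2), of "(if l' \<le> 2 then n' else n' + 1) - (if l \<le> 2 then n else n + 1)"]
    by (auto simp: algebra_simps)
qed

lemma E_F_inner: "L2_inner (E j k) (F j k') = 0"
proof -
  obtain n l where k': "k' = 6 * n + int l" "l \<in> {1..6}" by (rule index_cases)
  have "L2_inner (E 0 k) (F 0 k') = 0" for k
    unfolding k'(1) F_idx[OF k'(2)] dil_0 inner_T_right E_T0
    using \<psi>_perp_E0[OF k'(2)] by (simp add: L2_inner_commute)
  then show ?thesis
    using E_dil[of j 0] F_dil[of j 0] dil_isometry[of j "E 0 k" "F 0 k'"] by simp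
qed

lemma F_E_inner: "L2_inner (F j k) (E j k') = 0"
  using E_F_inner by (simp add: L2_inner_commute)

lemma F_span: "F j k \<in> span (range (E (j + 1)))"
proof -
  obtain n l where k: "k = 6 * n + int l" "l \<in> {1..6}" by (rule index_cases)
  let ?n = "if l \<le> 2 then n else n + 1"
  have "F 0 k \<in> V {-11 + 12 * ?n..10 + 12 * ?n}"
    unfolding k(1) F_idx[OF k(2)] dil_0 by (rule V_T[OF \<psi>_V[OF k(2)]])
  then have "F 0 k \<in> V UNIV" using V_mono[OF subset_UNIV] by blast
  then have "dil j (F 0 k) \<in> span (dil j ` range (E 1))"
    by (rule span_linear_image[OF dil_linear])
  then show ?thesis by (simp add: F_dil image_image E_dil)
qed

section \<open>Scale 1 recovered from scale 0\<close>

abbreviation B0 :: "(real \<Rightarrow> real) set" where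
  "B0 \<equiv> range (E 0) \<union> range (F 0)"

lemma span_B0_T: "f \<in> span B0 \<Longrightarrow> T n f \<in> span B0"
proof -
  assume "f \<in> span B0"
  then have "T n f \<in> span (T n ` B0)" by (rule span_linear_image[OF shift_linear])
  moreover have "T n ` B0 \<subseteq> B0" by (auto simp: E_T0 F_T0)
  ultimately show ?thesis using span_mono by blast
qed

lemma \<psi>_B0: "l \<in> {1..6} \<Longrightarrow> \<psi> l \<in> span B0"
proof -
  assume "l \<in> {1..6}"
  then have "l \<in> {1, 2} \<or> l \<in> {3..6}" by auto
  then show ?thesis using \<psi>_eq_F[of l] \<psi>_eq_F'[of l] by (metis UnI2 rangeI span_base)
qed

lemma E0_B0: "E 0 k \<in> span B0"
  by (auto intro: span_base)

lemma E1_m1_0_B0: "k \<in> {-1, 0} \<Longrightarrow> E 1 k \<in> span B0"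
proof -
  assume k: "k \<in> {-1, 0}"
  have "span {\<psi> 3, \<psi> 4} \<subseteq> span B0" using \<psi>_B0 by (intro span_minimal) auto
  then have "r k \<in> span B0"
    using k unfolding span_r by (auto intro: span_base)
  then have "r k + L2_inner (E 1 k) (E 0 0) *\<^sub>R E 0 0 + L2_inner (E 1 k) (E 0 (-1)) *\<^sub>R E 0 (-1) \<in> span B0"
    by (intro span_add span_scale E0_B0)
  then show ?thesis by (simp add: r_def)
qed

text \<open>Once \<open>E 0 (-1)\<close>, \<open>E 0 0\<close>, \<psi>_3, \<psi>_4 are projected
  off, the remainder meets every condition of the outer wavelet space. Since \<psi>_5, \<psi>_6 span
  all of that space, it is a combination of them.\<close>

lemma u_m1_0_B0:
  assumes k: "k \<in> {-1, 0}"
  shows "u k \<in> span B0"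
proof -
  let ?O = "{E 0 (-1), E 0 0, \<psi> 3, \<psi> 4}"
  have O: "?O \<subseteq> V {-11..10}" using E0_m1_0_V \<psi>_V by auto
  have OL: "?O \<subseteq> L2" using O V_CC CC_L2 by blast
  obtain g where g: "g \<in> span ?O" "\<And>h. h \<in> span ?O \<Longrightarrow> L2_inner (u k - g) h = 0"
    using projection_exists[of ?O "u k"] O V_CC proj01_CC by blast
  have gV: "g \<in> V {-11..10}" using g(1) O span_minimal[of ?O] by auto
  have L: "u k \<in> L2" "g \<in> L2" using gV V_CC proj01_CC CC_L2 by auto
  have split: "L2_inner (u k - g) h = 0" if "h \<in> L2" "L2_inner (u k) h = 0" "\<And>s. s \<in> ?O \<Longrightarrow> L2_inner h s = 0" for h
    using that L L2_inner_span_right[OF g(1) OL, of h] by (simp add: L2_inner_diff_left L2_inner_commute[of g])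
  have far: "L2_inner (u k) h = 0" if "h \<in> V K" "{1..10} \<inter> K = {}" for h K
    by (rule V_disjoint[OF proj01_V that])
  have "u k - g \<in> outer_wavelet_space \<phi> \<psi>"
    unfolding outer_iff
  proof (intro conjI ballI)
    show "u k - g \<in> V {-11..10}"
      using gV proj01_V V_mono[of "{1..10}" "{-11..10}"] by (intro span_diff) auto
    show "L2_inner (u k - g) (E 0 m) = 0" if m: "m \<in> {-7..6}" for m
    proof (cases "m \<in> {-1, 0}")
      case True
      then show ?thesis using g(2) by (auto intro: span_base)
    next
      case False
      \<comment> \<open>Indices below -1 have windows ending at -2, the indices 1 to 4 belong to
        \<open>G1\<close>, and 5, 6 are covered by \<open>u_perp_u\<close>.\<close>
      have "m \<in> {-7, -6} \<or> m \<in> {-5..-2} \<or> m \<in> {1..4} \<or> m \<in> {5, 6}"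
        using m False by auto
      then have "L2_inner (u k) (E 0 m) = 0"
      proof (elim disjE)
        assume "m \<in> {-7, -6}"
        then have "E 0 m \<in> V {-23..-2}" using E0_V_56[of 5 "-2"] E0_V_56[of 6 "-2"] by auto
        then show ?thesis by (rule far) auto
      next
        assume m: "m \<in> {-5..-2}"
        then have "nat (m + 6) \<in> {1..4}" by (auto simp: Suc_le_eq)
        then have "E 0 m \<in> V {-11..-2}" using m E0_V_14[of "nat (m + 6)" "-1"] by simp
        then show ?thesis by (rule far) auto
      next
        assume "m \<in> {1..4}"
        then show ?thesis using u_perp_G1[of k "E 0 m"] k by (auto simp: G1_def L2_inner_commute)
      next
        assume m: "m \<in> {5, 6}"
        then show ?thesis using u_perp_u[OF k m] inner_u[OF proj01_V] by simp
      qed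
      then show ?thesis
        using False \<psi>_perp_E0[of 3] \<psi>_perp_E0[of 4]
        by (intro split) (auto simp: CC_L2 E_inner L2_inner_commute[of "E 0 m"])
    qed
    fix l :: nat assume l: "l \<in> {1, 2}"
    have l6: "l \<in> {1..6}" using l by auto
    have *: "L2_inner (T n (\<psi> l)) s = 0" if "s \<in> ?O" for s n
    proof -
      have "L2_inner (\<psi> l) (T (- n) s) = 0"
        using that inner_\<psi>_T[OF l6, of 3 "- n"] inner_\<psi>_T[OF l6, of 4 "- n"] l \<psi>_perp_E0[OF l6] E_T0[of "- n"]
        by auto
      then show ?thesis by (simp only: inner_T_left)
    qed
    have "T (-1) (\<psi> l) \<in> V {-11..-2}" using V_T[OF \<psi>_12_V[OF l], of "-1"] by simp
    then have "L2_inner (u k) (T (-1) (\<psi> l)) = 0" by (rule far) auto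
    then show "L2_inner (u k - g) (T (-1) (\<psi> l)) = 0"
      using *[of _ "-1"] \<psi>_CC[OF l6] by (intro split) (auto simp: CC_L2)
    have "L2_inner (u k) (\<psi> l) = 0"
      using u_perp_G1[of k "\<psi> l"] k l by (auto simp: G1_def L2_inner_commute)
    then show "L2_inner (u k - g) (\<psi> l) = 0"
      using *[of _ 0] \<psi>_CC[OF l6] by (intro split) (auto simp: CC_L2)
  next
    fix l :: nat assume "l \<in> {3, 4}"
    then show "L2_inner (u k - g) (\<psi> l) = 0" using g(2) by (auto intro: span_base)
  qed
  then have "u k - g \<in> span {\<psi> 5, \<psi> 6}" by (simp add: \<psi>_56_span)
  also have "span {\<psi> 5, \<psi> 6} \<subseteq> span B0" using \<psi>_B0 by (intro span_minimal) auto
  finally have "u k - g \<in> span B0" .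
  moreover have "span ?O \<subseteq> span B0" using \<psi>_B0 E0_B0 by (intro span_minimal) auto
  ultimately have "u k - g + g \<in> span B0" using g(1) by (intro span_add) auto
  then show ?thesis by simp
qed

text \<open>\<open>u k\<close> is the translate by 1 of the left part of \<open>E 0 (k - 6)\<close>,
  its components with indices -11..-2. The central components and the right part
  \<open>u (k - 6)\<close> are already in \<open>span B0\<close>, so the left part follows by
  subtraction.\<close>

lemma u_5_6_B0:
  assumes k: "k \<in> {5, 6}"
  shows "u k \<in> span B0"
proof -
  let ?f = "E 0 (k - 6)"
  have k': "k - 6 \<in> {-1, 0}" using k by auto
  have s: "{-11..10::int} = {-11..-2} \<union> ({-1, 0} \<union> {1..10})" by auto
  have "?f = fourier_sum {-11..10} (E 1) ?f"
    using fourier_sum_E1_eq[OF _ E0_m10_V[OF k']] by simp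
  also have "\<dots> = fourier_sum {-11..-2} (E 1) ?f + (fourier_sum {-1, 0} (E 1) ?f + proj01 ?f)"
    unfolding fourier_sum_def proj01_def s by (subst sum.union_disjoint; (subst sum.union_disjoint)?) auto
  finally have "fourier_sum {-11..-2} (E 1) ?f = ?f - fourier_sum {-1, 0} (E 1) ?f - proj01 ?f"
    by (simp add: algebra_simps)
  also have "\<dots> \<in> span B0"
    unfolding fourier_sum_def
    by (intro span_diff span_sum span_scale E0_B0 E1_m1_0_B0 u_m1_0_B0 k')
  finally have "T 1 (fourier_sum {-11..-2} (E 1) ?f) \<in> span B0" by (rule span_B0_T)
  moreover have "T 1 (fourier_sum {-11..-2} (E 1) ?f) = u k"
  proof -
    have "u k = (\<Sum>i\<in>{1..10}. L2_inner (T 1 ?f) (E 1 i) *\<^sub>R E 1 i)"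
      by (simp add: proj01_def fourier_sum_def E_T0[of 1, simplified])
    also have "\<dots> = (\<Sum>i\<in>{-11..-2}. L2_inner (T 1 ?f) (E 1 (i + 12)) *\<^sub>R E 1 (i + 12))"
      by (rule sum.reindex_bij_witness[of _ "\<lambda>i. i + 12" "\<lambda>i. i - 12"]) auto
    also have "\<dots> = (\<Sum>i\<in>{-11..-2}. L2_inner ?f (E 1 i) *\<^sub>R T 1 (E 1 i))"
      by (intro sum.cong refl) (simp only: E_T1[of 1, unfolded mult_1_right, symmetric] shift_isometry)
    finally show ?thesis unfolding shift_fourier_sum by simp
  qed
  ultimately show ?thesis by simp
qed

text \<open>Translation by \<open>n\<close> preserves \<open>span B0\<close> and moves indices by
  \<open>12 * n\<close>, so the block -1..10 of twelve indices suffices.\<close>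

lemma E1_B0: "E 1 k \<in> span B0"
proof -
  have base: "E 1 k \<in> span B0" if "k \<in> {-1..10}" for k
  proof (cases "k \<in> {-1, 0}")
    case True
    then show ?thesis by (rule E1_m1_0_B0)
  next
    case False
    then have "E 1 k \<in> V {1..10}" using that by (intro V_E) auto
    then have "E 1 k \<in> span (E 0 ` {1..4} \<union> u ` {-1, 0, 5, 6} \<union> {\<psi> 1, \<psi> 2})"
      by (rule V_decomposition_u)
    also have "\<dots> \<subseteq> span B0"
      using E0_B0 \<psi>_B0 u_m1_0_B0 u_5_6_B0 by (intro span_minimal) auto
    finally show ?thesis .
  qed
  define n where "n = (k + 1) div 12"
  have "0 \<le> (k + 1) mod 12" "(k + 1) mod 12 < 12" by auto
  then have "k - 12 * n \<in> {-1..10}"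
    using mult_div_mod_eq[of 12 "k + 1"] by (auto simp: n_def)
  then have "T n (E 1 (k - 12 * n)) \<in> span B0" by (intro span_B0_T base)
  then show ?thesis by (simp add: E_T1)
qed

lemma E_step_up: "E (j + 1) k \<in> span (range (E j) \<union> range (F j))"
proof -
  have "dil j (E 1 k) \<in> span (dil j ` B0)"
    by (rule span_linear_image[OF dil_linear E1_B0])
  then show ?thesis by (simp add: E_dil F_dil image_Un image_image)
qed

lemma E_wavelet_system: "E (int n) k \<in> span (wavelet_system \<phi> \<psi>)"
proof (induction n arbitrary: k)
  case 0
  then show ?case by (auto simp: wavelet_system_def intro: span_base)
next
  case (Suc n)
  have "range (E (int n)) \<union> range (F (int n)) \<subseteq> span (wavelet_system \<phi> \<psi>)"
  proof (intro Un_least image_subsetI)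
    show "E (int n) x \<in> span (wavelet_system \<phi> \<psi>)" for x by (rule Suc)
    show "F (int n) x \<in> span (wavelet_system \<phi> \<psi>)" for x
      by (rule span_base) (auto simp: wavelet_system_def)
  qed
  then have "span (range (E (int n)) \<union> range (F (int n))) \<subseteq> span (wavelet_system \<phi> \<psi>)"
    by (intro span_minimal) auto
  then show ?case using E_step_up[of "int n" k] by (auto simp: add.commute)
qed

section \<open>Orthogonality across scales, moments, supports, completeness\<close>

lemma E_F_inner_le:
  assumes "i \<le> j"
  shows "L2_inner (E i k) (F j l) = 0"
proof -
  have "E i k \<in> span (range (E j))" using subsetD[OF E_nested[OF assms] span_base[OF rangeI]] .
  then have "L2_inner (F j l) (E i k) = 0"
    by (rule L2_inner_span_right) (auto simp: CC_L2 F_E_inner)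
  then show ?thesis by (simp add: L2_inner_commute)
qed

text \<open>For i < j the coarser wavelet lies in the span of scale i + 1, hence of scale j, to
  which the finer one is orthogonal.\<close>

lemma F_F_inner: "L2_inner (F i k) (F j l) = of_bool (i = j) * of_bool (k = l)"
proof -
  have lt: "L2_inner (F i k) (F j l) = 0" if "i < j" for i j k l
  proof -
    have "F i k \<in> span (range (E j))"
      using F_span[of i k] E_nested[of "i + 1" j] that by auto
    then have "L2_inner (F j l) (F i k) = 0"
      by (rule L2_inner_span_right) (auto simp: CC_L2 F_E_inner)
    then show ?thesis by (simp add: L2_inner_commute)
  qed
  then show ?thesis
    using lt[of i j k l] lt[of j i l k] F_inner[of i k l]
    by (cases i j rule: linorder_cases) (auto simp: L2_inner_commute)
qed

lemma F_C1_splines: "F j k \<in> C1_splines"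
proof -
  have "span (range (E (j + 1))) \<subseteq> C1_splines"
    using E_C1_splines by (intro span_minimal subspace_C1_splines) auto
  then show ?thesis using F_span by blast
qed

text \<open>Dilation preserves the degree of polynomials, so scale 0 suffices. There the wavelet is
  orthogonal to scaling functions whose span contains every \<open>\<xi> 1 m\<close>.\<close>

lemma F_moments: 
  assumes "degree p < 4"
  shows "has_bochner_integral lebesgue (\<lambda>x. poly p x * F j k x) 0"
proof -
  have orth: "L2_inner (F 0 k) (\<xi> 1 m) = 0" for m
    using \<xi>_1_span[of m] by (rule L2_inner_span_right) (auto simp: CC_L2 F_E_inner)
  define c where "c = (2 :: real) powi j"
  define q where "q = pcompose p [:0, 1 / c:]"
  have c: "c \<noteq> 0" by (simp add: c_def)
  have q: "degree q < 4" using assms c by (simp add: q_def degree_pcompose)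
  have "(LINT x|lebesgue. poly q x * F 0 k x) = 0"
    by (rule has_bochner_integral_integral_eq[OF moments_vanish[OF _ orth q]]) simp
  then have 0: "(LINT x|lebesgue. poly q (c * x) * F 0 k (c * x)) = 0"
    using lebesgue_integral_real_affine[OF c, of "\<lambda>x. poly q x * F 0 k x" 0] c by simp
  have "poly p x * F j k x = 2 powr (real_of_int j / 2) * (poly q (c * x) * F 0 k (c * x))" for x
  proof -
    have "F j k x = 2 powr (real_of_int j / 2) * F 0 k (c * x)"
      using F_dil[of j 0 k] by (simp add: dil_def c_def fun_eq_iff)
    moreover have "poly q (c * x) = poly p x" using c by (simp add: q_def poly_pcompose)
    ultimately show ?thesis by simp
  qed
  then have "(LINT x|lebesgue. poly p x * F j k x) = 0"
    using 0 by simp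
  moreover have "(\<lambda>x. F j k x * poly p x) \<in> CC"
    by (rule CC_mult) (auto intro: continuous_intros)
  then have "integrable lebesgue (\<lambda>x. poly p x * F j k x)"
    using CC_integrable_lebesgue by (simp add: mult.commute)
  ultimately show ?thesis
    using has_bochner_integral_integrable by fastforce
qed

lemma \<psi>_eq_0:
  assumes "l \<in> {1..6}" "1 < \<bar>x\<bar>"
  shows "\<psi> l x = 0"
proof -
  have "V {-11..10} \<subseteq> {f. f x = 0}"
    using E1_eq_0[OF _ assms(2)] by (intro span_minimal) (auto intro: subspaceI)
  then show ?thesis using \<psi>_V[OF assms(1)] by auto
qed

lemma F_supp: "bounded (supp (F j k)) \<and> diameter (supp (F j k)) \<le> 2 powi (1 - j)"
proof -
  obtain n l where k: "k = 6 * n + int l" "l \<in> {1..6}" by (rule index_cases)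
  let ?n = "if l \<le> 2 then n else n + 1"
  define c :: real where "c = 2 powi j"
  have c: "c > 0" by (simp add: c_def)
  have "F j k x = 0" if "1 / c < \<bar>x - of_int ?n / c\<bar>" for x
  proof -
    have "c * (1 / c) < c * \<bar>x - of_int ?n / c\<bar>" using that c by (intro mult_strict_left_mono)
    also have "c * \<bar>x - of_int ?n / c\<bar> = \<bar>c * (x - of_int ?n / c)\<bar>" using c by (simp add: abs_mult)
    also have "c * (x - of_int ?n / c) = c * x - of_int ?n" using c by (simp add: right_diff_distrib)
    finally have "\<psi> l (c * x - of_int ?n) = 0" using c by (intro \<psi>_eq_0[OF k(2)]) simp
    then show ?thesis unfolding k(1) F_idx[OF k(2)] by (simp add: dil_def shift_def c_def)
  qed
  then have "bounded (supp (F j k)) \<and> diameter (supp (F j k)) \<le> 2 * (1 / c)"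
    using c by (intro supp_bounded_diameter[of "1 / c" "of_int ?n / c"]) auto
  moreover have "2 * (1 / c) = 2 powi (1 - j)"
    by (simp add: c_def power_int_diff)
  ultimately show ?thesis by simp
qed

lemma \<psi>_C1_splines: "l \<in> {1..6} \<Longrightarrow> \<psi> l \<in> C1_splines"
proof -
  have "V {-11..10} \<subseteq> C1_splines"
    using E_C1_splines by (intro span_minimal subspace_C1_splines) auto
  then show "l \<in> {1..6} \<Longrightarrow> \<psi> l \<in> C1_splines" using \<psi>_V by blast
qed

lemma \<phi>_\<psi>_inner:
  assumes "i \<in> {1..6}" "j \<in> {1..6}"
  shows "L2_inner (\<phi> i) (\<psi> j) = 0"
proof -
  have "i \<in> {1..4} \<or> i \<in> {5, 6}" using assms by auto
  then obtain m where "\<phi> i = E 0 m" using \<phi>_eq_E[of i] \<phi>_eq_E'[of i] by blast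
  then show ?thesis using \<psi>_perp_E0[OF assms(2), of m] by (simp add: L2_inner_commute)
qed

lemma wavelet_system_orthogonal_basis: "orthogonal_basis_L2 (wavelet_system \<phi> \<psi>)"
  unfolding orthogonal_basis_L2_def
proof (intro conjI ballI allI impI)
  show "wavelet_system \<phi> \<psi> \<subseteq> L2"
    by (auto simp: wavelet_system_def CC_L2)
  show "L2_norm f \<noteq> 0" if "f \<in> wavelet_system \<phi> \<psi>" for f
    using that by (auto simp: wavelet_system_def L2_norm_eq_0_iff E_inner F_inner)
  show "pairwise (\<lambda>f g. L2_inner f g = 0) (wavelet_system \<phi> \<psi>)"
  proof (rule pairwiseI)
    fix f g assume "f \<in> wavelet_system \<phi> \<psi>" "g \<in> wavelet_system \<phi> \<psi>" "f \<noteq> g"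
    then show "L2_inner f g = 0"
      by (auto simp: wavelet_system_def E_inner F_F_inner E_F_inner_le L2_inner_commute[of "F _ _" "E _ _"])
  qed
  fix f \<epsilon> assume f: "f \<in> L2" and "0 < (\<epsilon> :: real)"
  then obtain j :: nat and g where g: "g \<in> span (range (\<xi> (int j)))" "L2_norm (f - g) < \<epsilon>"
    using splines_dense[OF f] unfolding L2_approximable_def by blast
  have "span (range (E (int j))) \<subseteq> span (wavelet_system \<phi> \<psi>)"
    using E_wavelet_system by (intro span_minimal) auto
  \<comment> \<open>\<open>\<xi>_span\<close> lands on scale \<open>j - 1\<close>, which is -1 for
    \<open>j = 0\<close> and outside the system; nestedness raises it to \<open>j\<close>.\<close>
  moreover have "\<xi> (int j) m \<in> span (range (E (int j)))" for m
    using \<xi>_span[of "int j" m] E_nested[of "int j - 1" "int j"] by auto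
  then have "span (range (\<xi> (int j))) \<subseteq> span (range (E (int j)))"
    by (intro span_minimal) auto
  ultimately show "\<exists>g\<in>span (wavelet_system \<phi> \<psi>). L2_norm (f - g) < \<epsilon>"
    using g by blast
qed

end

theorem theorem6:
  fixes \<phi> \<psi> :: "nat \<Rightarrow> real \<Rightarrow> real"
  assumes "scaling_generators \<phi>" and "wavelet_generators \<phi> \<psi>"
  shows
    "((\<forall>i\<in>{1..6}. cubic_spline (\<psi> i) \<and> \<psi> i C1_differentiable_on UNIV) \<and>
      (\<forall>j k. cubic_spline (wavelet_fn \<psi> j k) \<and> wavelet_fn \<psi> j k C1_differentiable_on UNIV)) \<and>
     (\<forall>i\<in>{1..6}. \<forall>j\<in>{1..6}.
        L2_inner (\<phi> i) (\<phi> j) = of_bool (i = j) \<and>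
        L2_inner (\<psi> i) (\<psi> j) = of_bool (i = j) \<and>
        L2_inner (\<phi> i) (\<psi> j) = 0) \<and>
     (\<forall>i j k l.
        L2_inner (scaling_fn \<phi> i k) (scaling_fn \<phi> i l) = of_bool (k = l) \<and>
        L2_inner (wavelet_fn \<psi> i k) (wavelet_fn \<psi> j l) = of_bool (i = j) * of_bool (k = l) \<and>
        (i \<le> j \<longrightarrow> L2_inner (scaling_fn \<phi> i k) (wavelet_fn \<psi> j l) = 0)) \<and>
     (\<forall>j k. \<forall>p :: real poly. degree p < 4 \<longrightarrow>
        has_bochner_integral lebesgue (\<lambda>x. poly p x * wavelet_fn \<psi> j k x) 0) \<and>
     orthogonal_basis_L2 (wavelet_system \<phi> \<psi>) \<and>
     (\<forall>k. bounded (supp (scaling_fn \<phi> 0 k)) \<and> diameter (supp (scaling_fn \<phi> 0 k)) \<le> 2) \<and>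
     (\<forall>j k. bounded (supp (wavelet_fn \<psi> j k)) \<and>
        diameter (supp (wavelet_fn \<psi> j k)) \<le> 2 powi (1 - j))"
proof -
  interpret wavelet_generating_system \<phi> \<psi>
    using assms by unfold_locales
  have "L2_inner (\<phi> i) (\<phi> j) = of_bool (i = j)" if "i \<in> {1..6}" "j \<in> {1..6}" for i j
    using inner_T\<phi>[OF that, of 0 0] by simp
  moreover have "L2_inner (\<psi> i) (\<psi> j) = of_bool (i = j)" if "i \<in> {1..6}" "j \<in> {1..6}" for i j
    using inner_\<psi>_T[OF that, of 0] by simp
  moreover have "cubic_spline (\<psi> i)" "\<psi> i C1_differentiable_on UNIV" if "i \<in> {1..6}" for i
    using \<psi>_C1_splines[OF that] by (simp_all add: C1_splines_def)
  moreover have "cubic_spline (F j k)" "F j k C1_differentiable_on UNIV" for j k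
    using F_C1_splines[of j k] by (simp_all add: C1_splines_def)
  ultimately show ?thesis
    by (intro conjI ballI allI impI)
       (assumption | rule \<phi>_\<psi>_inner E_inner F_F_inner E_F_inner_le F_moments wavelet_system_orthogonal_basis
          E0_supp[THEN conjunct1] E0_supp[THEN conjunct2] F_supp[THEN conjunct1] F_supp[THEN conjunct2])+
qed

end
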